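(* Let $p=2$, $n\ge 5$, $n\not\equiv 2\pmod 4$, and let $G\le\mathsf A_n$ be a subgroup. If $E^{\beta_n}_+\downarrow_G$ or $E^{\beta_n}_-\downarrow_G$ is irreducible, then one of the following holds: (i) $G$ is primitive (as a permutation group on $\{1,\dots,n\}$). (ii) $G\le \mathsf A_{n-k,k}$ (up to conjugation in $\mathsf S_n$) for some $1\le k<n$, and either $n\equiv 0\pmod 4$ and $k$ is odd, or $k\equiv 2\pmod 4$. Moreover, in all of these cases (that is, for all such $n$ and $k$) $E^{\beta_n}_\pm\downarrow_{\mathsf A_{n-k,k}}$ is irreducible. (iii) $G\le (\mathsf S_a\wr\mathsf S_b)\cap\mathsf A_n$ (up to conjugation in $\mathsf S_n$) for some $a,b>1$ with $n=ab$, and either $a$ is odd, or $a\equiv 2\pmod 4$ and $b=2$. Moreover, in all of these cases (that is, for all such $a$ and $b$) $E^{\beta_n}_\pm\downarrow_{(\mathsf S_a\wr\mathsf S_b)\cap\mathsf A_n}$ is irreducible.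
   Context: Let $\mathbb F$ be an algebraically closed field of characteristic $p=2$; $\mathsf S_n$, $\mathsf A_n$ are the symmetric and alternating groups on $\{1,\dots,n\}$; modules are finite-dimensional over $\mathbb F$. $\mathsf A_{n-k,k}:=(\mathsf S_{n-k}\times\mathsf S_k)\cap\mathsf A_n$, and $\mathsf S_a\wr\mathsf S_b\le\mathsf S_n$ ($n=ab$) is the stabilizer of a partition of $\{1,\dots,n\}$ into $b$ blocks of size $a$. The partition $\beta_n$ is $(n/2+1,n/2-1)$ if $n$ is even and $((n+1)/2,(n-1)/2)$ if $n$ is odd. $D^{\beta_n}$ (the basic spin module) is the irreducible $\mathbb F\mathsf S_n$-module labelled by $\beta_n$, i.e. the head of the Specht module $S^{\beta_n}$ (James' labelling). For $n\not\equiv 2\pmod 4$ one has $D^{\beta_n}\downarrow_{\mathsf A_n}\cong E^{\beta_n}_+\oplus E^{\beta_n}_-$ with $E^{\beta_n}_+\not\cong E^{\beta_n}_-$ irreducible $\mathbb F\mathsf A_n$-modules, conjugate under odd permutations; for subgroups normalized by an odd permutation (such as $\mathsf A_{n-k,k}$ and $(\mathsf S_a\wr\mathsf S_b)\cap\mathsf A_n$) the restrictions of $E^{\beta_n}_+$ and $E^{\beta_n}_-$ are irreducible simultaneously, and "$E^{\beta_n}_\pm\downarrow$ is irreducible" means both are. *)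

theory Defs
  imports
    "HOL-Algebra.Sym_Groups"
    "HOL-Library.Function_Algebras"
    "HOL-Computational_Algebra.Polynomial"
begin

text \<open>
  A module for a group \<open>G\<close> of permutations (given as the set of its elements) is a linear
  subspace \<open>V\<close> of an ambient vector space with scalar multiplication \<open>s\<close>, together with an
  action \<open>\<rho>\<close>. Only the values of \<open>\<rho> g\<close> on \<open>V\<close>, for \<open>g \<in> G\<close>, are relevant; hence the restriction
  of a module to a subgroup is obtained by replacing \<open>G\<close> and leaving \<open>s\<close>, \<open>\<rho>\<close>, \<open>V\<close> unchanged.
\<close>

definition linear_on ::
  "('f::field \<Rightarrow> 'v::ab_group_add \<Rightarrow> 'v) \<Rightarrow> ('f \<Rightarrow> 'w::ab_group_add \<Rightarrow> 'w) \<Rightarrow>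
    'v set \<Rightarrow> ('v \<Rightarrow> 'w) \<Rightarrow> bool" where
  "linear_on s s' V f \<longleftrightarrow>
     (\<forall>v\<in>V. \<forall>w\<in>V. f (v + w) = f v + f w) \<and> (\<forall>c. \<forall>v\<in>V. f (s c v) = s' c (f v))"

definition perm_module ::
  "('f::field \<Rightarrow> 'v::ab_group_add \<Rightarrow> 'v) \<Rightarrow> (nat \<Rightarrow> nat) set \<Rightarrow>
    ((nat \<Rightarrow> nat) \<Rightarrow> 'v \<Rightarrow> 'v) \<Rightarrow> 'v set \<Rightarrow> bool" where
  "perm_module s G \<rho> V \<longleftrightarrow>
     vector_space s \<and> module.subspace s V \<and>
     (\<forall>g\<in>G. linear_on s s V (\<rho> g) \<and> \<rho> g ` V \<subseteq> V) \<and>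
     (\<forall>v\<in>V. \<rho> id v = v) \<and>
     (\<forall>g\<in>G. \<forall>h\<in>G. \<forall>v\<in>V. \<rho> (g \<circ> h) v = \<rho> g (\<rho> h v))"

definition perm_submodule ::
  "('f::field \<Rightarrow> 'v::ab_group_add \<Rightarrow> 'v) \<Rightarrow> (nat \<Rightarrow> nat) set \<Rightarrow>
    ((nat \<Rightarrow> nat) \<Rightarrow> 'v \<Rightarrow> 'v) \<Rightarrow> 'v set \<Rightarrow> 'v set \<Rightarrow> bool" where
  "perm_submodule s G \<rho> V W \<longleftrightarrow>
     module.subspace s W \<and> W \<subseteq> V \<and> (\<forall>g\<in>G. \<rho> g ` W \<subseteq> W)"

definition irreducible_module ::
  "('f::field \<Rightarrow> 'v::ab_group_add \<Rightarrow> 'v) \<Rightarrow> (nat \<Rightarrow> nat) set \<Rightarrow>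
    ((nat \<Rightarrow> nat) \<Rightarrow> 'v \<Rightarrow> 'v) \<Rightarrow> 'v set \<Rightarrow> bool" where
  "irreducible_module s G \<rho> V \<longleftrightarrow>
     perm_module s G \<rho> V \<and> V \<noteq> {0} \<and>
     (\<forall>W. perm_submodule s G \<rho> V W \<longrightarrow> W = {0} \<or> W = V)"

definition maximal_submodule ::
  "('f::field \<Rightarrow> 'v::ab_group_add \<Rightarrow> 'v) \<Rightarrow> (nat \<Rightarrow> nat) set \<Rightarrow>
    ((nat \<Rightarrow> nat) \<Rightarrow> 'v \<Rightarrow> 'v) \<Rightarrow> 'v set \<Rightarrow> 'v set \<Rightarrow> bool" where
  "maximal_submodule s G \<rho> V W \<longleftrightarrow>
     perm_submodule s G \<rho> V W \<and> W \<noteq> V \<and>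
     (\<forall>U. perm_submodule s G \<rho> V U \<and> W \<subseteq> U \<longrightarrow> U = W \<or> U = V)"

definition module_radical ::
  "('f::field \<Rightarrow> 'v::ab_group_add \<Rightarrow> 'v) \<Rightarrow> (nat \<Rightarrow> nat) set \<Rightarrow>
    ((nat \<Rightarrow> nat) \<Rightarrow> 'v \<Rightarrow> 'v) \<Rightarrow> 'v set \<Rightarrow> 'v set" where
  "module_radical s G \<rho> V = V \<inter> \<Inter>{W. maximal_submodule s G \<rho> V W}"

definition equivariant_hom ::
  "(nat \<Rightarrow> nat) set \<Rightarrow>
    ('f::field \<Rightarrow> 'v::ab_group_add \<Rightarrow> 'v) \<Rightarrow> ((nat \<Rightarrow> nat) \<Rightarrow> 'v \<Rightarrow> 'v) \<Rightarrow> 'v set \<Rightarrow>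
    ('f \<Rightarrow> 'w::ab_group_add \<Rightarrow> 'w) \<Rightarrow> ((nat \<Rightarrow> nat) \<Rightarrow> 'w \<Rightarrow> 'w) \<Rightarrow> 'w set \<Rightarrow>
    ('v \<Rightarrow> 'w) \<Rightarrow> bool" where
  "equivariant_hom G s \<rho> V s' \<rho>' V' f \<longleftrightarrow>
     linear_on s s' V f \<and> f ` V \<subseteq> V' \<and> (\<forall>g\<in>G. \<forall>v\<in>V. f (\<rho> g v) = \<rho>' g (f v))"

definition isomorphic_modules ::
  "(nat \<Rightarrow> nat) set \<Rightarrow>
    ('f::field \<Rightarrow> 'v::ab_group_add \<Rightarrow> 'v) \<Rightarrow> ((nat \<Rightarrow> nat) \<Rightarrow> 'v \<Rightarrow> 'v) \<Rightarrow> 'v set \<Rightarrow>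
    ('f \<Rightarrow> 'w::ab_group_add \<Rightarrow> 'w) \<Rightarrow> ((nat \<Rightarrow> nat) \<Rightarrow> 'w \<Rightarrow> 'w) \<Rightarrow> 'w set \<Rightarrow> bool" where
  "isomorphic_modules G s \<rho> V s' \<rho>' V' \<longleftrightarrow>
     (\<exists>f. equivariant_hom G s \<rho> V s' \<rho>' V' f \<and> bij_betw f V V')"

text \<open>
  \<open>D\<close> is (isomorphic to) the head \<open>V / rad V\<close> of \<open>V\<close>. The quotient is presented, as an abstract
  module, by a surjective homomorphism with kernel \<open>rad V\<close>; this fixes \<open>D\<close> up to isomorphism.
\<close>
definition is_head ::
  "(nat \<Rightarrow> nat) set \<Rightarrow>
    ('f::field \<Rightarrow> 'v::ab_group_add \<Rightarrow> 'v) \<Rightarrow> ((nat \<Rightarrow> nat) \<Rightarrow> 'v \<Rightarrow> 'v) \<Rightarrow> 'v set \<Rightarrow>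
    ('f \<Rightarrow> 'w::ab_group_add \<Rightarrow> 'w) \<Rightarrow> ((nat \<Rightarrow> nat) \<Rightarrow> 'w \<Rightarrow> 'w) \<Rightarrow> 'w set \<Rightarrow> bool" where
  "is_head G s \<rho> V s' \<rho>' D \<longleftrightarrow>
     perm_module s' G \<rho>' D \<and>
     (\<exists>f. equivariant_hom G s \<rho> V s' \<rho>' D f \<and> f ` V = D \<and>
          {v \<in> V. f v = 0} = module_radical s G \<rho> V)"

definition internal_direct_sum :: "'v::ab_group_add set \<Rightarrow> 'v set \<Rightarrow> 'v set \<Rightarrow> bool" where
  "internal_direct_sum V A B \<longleftrightarrow> V = {a + b |a b. a \<in> A \<and> b \<in> B} \<and> A \<inter> B = {0}"

text \<open>
  A partition is the list of its parts; rows and columns of diagrams are numbered from 0.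
  A tableau is a map on cells, whose values outside the diagram are irrelevant.
\<close>

definition diagram :: "nat list \<Rightarrow> (nat \<times> nat) set" where
  "diagram la = {(i, j). i < length la \<and> j < la ! i}"

definition is_tableau :: "nat list \<Rightarrow> (nat \<times> nat \<Rightarrow> nat) \<Rightarrow> bool" where
  "is_tableau la t \<longleftrightarrow> bij_betw t (diagram la) {1..sum_list la}"

definition tableau_column :: "nat list \<Rightarrow> (nat \<times> nat \<Rightarrow> nat) \<Rightarrow> nat \<Rightarrow> nat set" where
  "tableau_column la t j = t ` {(i, j') \<in> diagram la. j' = j}"

text \<open>
  The tabloid of \<open>t\<close>, i.e. its row equivalence class, is encoded by the sequence of the sets of
  entries of the rows of \<open>t\<close> (followed by empty sets).
\<close>
definition tabloid :: "nat list \<Rightarrow> (nat \<times> nat \<Rightarrow> nat) \<Rightarrow> nat \<Rightarrow> nat set" where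
  "tabloid la t = (\<lambda>i. t ` {(i', j) \<in> diagram la. i' = i})"

definition column_stabilizer :: "nat list \<Rightarrow> (nat \<times> nat \<Rightarrow> nat) \<Rightarrow> (nat \<Rightarrow> nat) set" where
  "column_stabilizer la t =
     {g \<in> carrier (sym_group (sum_list la)). \<forall>j. g ` tableau_column la t j = tableau_column la t j}"

text \<open>
  The permutation module on tabloids consists of functions from tabloids to the field:
  the function \<open>f\<close> stands for the formal linear combination of the tabloids \<open>T\<close> with
  coefficients \<open>f T\<close>. A permutation sends the basis vector of \<open>T\<close> to that of \<open>g T\<close>, that is,
  \<open>(g f) T = f (inv g T)\<close>.
\<close>

definition fun_scale :: "'f::field \<Rightarrow> ('x \<Rightarrow> 'f) \<Rightarrow> 'x \<Rightarrow> 'f" where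
  "fun_scale c f = (\<lambda>x. c * f x)"

definition tabloid_vector :: "(nat \<Rightarrow> nat set) \<Rightarrow> (nat \<Rightarrow> nat set) \<Rightarrow> 'f::field" where
  "tabloid_vector T = (\<lambda>T'. of_bool (T' = T))"

definition tabloid_action ::
  "(nat \<Rightarrow> nat) \<Rightarrow> ((nat \<Rightarrow> nat set) \<Rightarrow> 'f::field) \<Rightarrow> (nat \<Rightarrow> nat set) \<Rightarrow> 'f" where
  "tabloid_action g f = (\<lambda>T. f (\<lambda>i. inv' g ` T i))"

definition polytabloid ::
  "nat list \<Rightarrow> (nat \<times> nat \<Rightarrow> nat) \<Rightarrow> (nat \<Rightarrow> nat set) \<Rightarrow> 'f::field" where
  "polytabloid la t =
     (\<Sum>g\<in>column_stabilizer la t.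
        fun_scale (of_int (sign g)) (tabloid_vector (tabloid la (g \<circ> t))))"

definition specht_module :: "nat list \<Rightarrow> ((nat \<Rightarrow> nat set) \<Rightarrow> 'f::field) set" where
  "specht_module la = module.span fun_scale {polytabloid la t |t. is_tableau la t}"

definition beta :: "nat \<Rightarrow> nat list" where
  "beta n = (if even n then [n div 2 + 1, n div 2 - 1] else [(n + 1) div 2, (n - 1) div 2])"

definition basic_spin_module ::
  "nat \<Rightarrow> ('f::field \<Rightarrow> 'v::ab_group_add \<Rightarrow> 'v) \<Rightarrow> ((nat \<Rightarrow> nat) \<Rightarrow> 'v \<Rightarrow> 'v) \<Rightarrow> 'v set \<Rightarrow> bool"
  where
  "basic_spin_module n s \<rho> D \<longleftrightarrow>
     is_head (carrier (sym_group n))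
       (fun_scale :: 'f \<Rightarrow> _) tabloid_action (specht_module (beta n)) s \<rho> D"

text \<open>
  The decomposition of the restriction to the alternating group is taken internally: \<open>E\<^sub>p\<close> and
  \<open>E\<^sub>m\<close> are submodules of \<open>D\<close>, with the same scalar multiplication and action.
\<close>
definition basic_spin_summands ::
  "nat \<Rightarrow> ('f::field \<Rightarrow> 'v::ab_group_add \<Rightarrow> 'v) \<Rightarrow> ((nat \<Rightarrow> nat) \<Rightarrow> 'v \<Rightarrow> 'v) \<Rightarrow>
    'v set \<Rightarrow> 'v set \<Rightarrow> 'v set \<Rightarrow> bool" where
  "basic_spin_summands n s \<rho> D E\<^sub>p E\<^sub>m \<longleftrightarrow>
     basic_spin_module n s \<rho> D \<and>
     internal_direct_sum D E\<^sub>p E\<^sub>m \<and>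
     irreducible_module s (carrier (alt_group n)) \<rho> E\<^sub>p \<and>
     irreducible_module s (carrier (alt_group n)) \<rho> E\<^sub>m \<and>
     \<not> isomorphic_modules (carrier (alt_group n)) s \<rho> E\<^sub>p s \<rho> E\<^sub>m"

definition transitive_on :: "(nat \<Rightarrow> nat) set \<Rightarrow> nat set \<Rightarrow> bool" where
  "transitive_on G X \<longleftrightarrow> (\<forall>x\<in>X. \<forall>y\<in>X. \<exists>g\<in>G. g x = y)"

definition is_block :: "(nat \<Rightarrow> nat) set \<Rightarrow> nat set \<Rightarrow> nat set \<Rightarrow> bool" where
  "is_block G X B \<longleftrightarrow> B \<subseteq> X \<and> B \<noteq> {} \<and> (\<forall>g\<in>G. g ` B = B \<or> g ` B \<inter> B = {})"

definition primitive_on :: "(nat \<Rightarrow> nat) set \<Rightarrow> nat set \<Rightarrow> bool" where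
  "primitive_on G X \<longleftrightarrow>
     transitive_on G X \<and> (\<forall>B. is_block G X B \<longrightarrow> card B = 1 \<or> B = X)"

definition young_subgroup :: "nat \<Rightarrow> nat \<Rightarrow> (nat \<Rightarrow> nat) set" where
  "young_subgroup m k = {g \<circ> h |g h. g permutes {1..m} \<and> h permutes {m + 1..m + k}}"

definition alt_young :: "nat \<Rightarrow> nat \<Rightarrow> (nat \<Rightarrow> nat) set" where
  "alt_young m k = young_subgroup m k \<inter> carrier (alt_group (m + k))"

definition standard_blocks :: "nat \<Rightarrow> nat \<Rightarrow> nat set set" where
  "standard_blocks a b = {{a * i + 1..a * i + a} |i. i < b}"

definition wreath_subgroup :: "nat \<Rightarrow> nat \<Rightarrow> (nat \<Rightarrow> nat) set" where
  "wreath_subgroup a b =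
     {g \<in> carrier (sym_group (a * b)). (\<lambda>B. g ` B) ` standard_blocks a b = standard_blocks a b}"

definition alt_wreath :: "nat \<Rightarrow> nat \<Rightarrow> (nat \<Rightarrow> nat) set" where
  "alt_wreath a b = wreath_subgroup a b \<inter> carrier (alt_group (a * b))"

definition subconjugate :: "nat \<Rightarrow> (nat \<Rightarrow> nat) set \<Rightarrow> (nat \<Rightarrow> nat) set \<Rightarrow> bool" where
  "subconjugate n G H \<longleftrightarrow>
     (\<exists>x \<in> carrier (sym_group n). (\<lambda>g. x \<circ> g \<circ> inv' x) ` G \<subseteq> H)"

end

theory Submission
  imports Defs
begin

text \<open>
  The proof rests on one property of the basic spin module \<open>D\<close>: over a field of characteristic two
  every 3-cycle \<open>c\<close> satisfies \<open>1 + c + c\<^sup>2 = 0\<close> on \<open>D\<close>, equivalently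
  \<open>(i j) + (j k) + (i k) = 0\<close> for distinct points \<open>i\<close>, \<open>j\<close>, \<open>k\<close>. By this relation the transpositions act as the vectors
  \<open>e\<^sub>i + e\<^sub>j\<close> of the even-weight subspace of \<open>F\<^sup>n\<close> in its Clifford algebra for the quadratic form
  with \<open>Q(e\<^sub>i + e\<^sub>j) = 1\<close>. To a set \<open>S\<close> of even size belongs the vector \<open>v\<^sub>S\<close>, the sum of the
  \<open>e\<^sub>i\<close> with \<open>i \<in> S\<close>; it satisfies \<open>v\<^sub>S\<^sup>2 = |S|/2\<close> and \<open>v\<^sub>S v\<^sub>T + v\<^sub>T v\<^sub>S = |S \<inter> T|\<close> modulo two
  (\<open>vec_sq\<close>, \<open>vec_comm\<close>), and permutations act on these vectors through the sets (\<open>opr_vec\<close>). Everything below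
  holds for any irreducible \<open>A\<^sub>n\<close>-submodule \<open>E\<close> of a module with this property.

  The property itself comes from James' description of the Specht module. In characteristic two
  a polytabloid of the two-row shape is the indicator function of the transversals of the columns
  of its tableau. The column symmetrizer of \<open>t\<close> maps a vector \<open>f\<close> to \<open>psi t f\<close> times the
  polytabloid of \<open>t\<close>, where \<open>psi t f\<close> is the sum of the values of \<open>f\<close> at the transversals of \<open>t\<close>
  (\<open>kappa_eq\<close>); hence the common kernel of the \<open>psi t\<close> contains all proper submodules. It is itself
  proper (\<open>psi_nonzero\<close>), so it is the radical, and it contains the image of
  \<open>(i j) + (j k) + (i k)\<close> by a parity count: the relevant coefficient is the number of solutions of
  a linear system over the field with two elements that has fewer equations than unknowns
  (\<open>psi_theta\<close>).

  Reducibility. Let a group \<open>G\<close> permute a family of proper nonempty sets of sizes divisible by four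
  with pairwise even intersections, and let the family be stable under some transposition. The vectors of the family act by commuting square-zero
  operators, and their common kernel in \<open>E\<close> is a proper nonzero \<open>G\<close>-submodule
  (\<open>reducible_restrictI\<close>). This applies to a stable set of size divisible by four, to the blocks of
  an imprimitive group if their size is divisible by four, and to the unions of two blocks if the
  block size is congruent to two modulo four and there are more than two blocks.

  Irreducibility. Let \<open>N\<close> be a group containing a transposition \<open>t\<close>, and let \<open>W\<close> be a subspace of
  \<open>E\<close> invariant under \<open>N \<inter> A\<^sub>n\<close>. Elements of \<open>N\<close> preserve or exchange \<open>W\<close> and \<open>t W\<close> according to
  their sign. If all transpositions exchange \<open>W\<close> and \<open>t W\<close>, then \<open>W\<close> is invariant under \<open>A\<^sub>n\<close>
  (\<open>irreducible_restrictI\<close>). It is therefore enough to write every transposition in terms of odd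
  elements of \<open>N\<close> and of elements known to act on \<open>E\<close> by scalars. For a Young subgroup with two
  parts of odd size, the all-one vector acts as zero (\<open>vec_all_zero\<close>), so the missing
  transpositions are sums of the available ones. For a part \<open>Y\<close> of size congruent to two modulo
  four one uses the generator \<open>z\<close> of the centre of the even Clifford algebra, which acts on \<open>E\<close> by a
  scalar (\<open>psum_scalar\<close>) and has the form \<open>w v\<^sub>Y\<close> plus available terms, for a missing transposition
  \<open>w\<close> and \<open>v\<^sub>Y\<^sup>2 = 1\<close>. For blocks of odd size, the permutation exchanging two blocks is expanded in
  the Clifford algebra, and the vector of the union of the two blocks is recovered from it
  (\<open>wreath_irreducible_odd\<close>).
\<close>

section \<open>Clifford relations in characteristic two\<close>

text \<open>
  The calculations take place in a corner of a ring: \<open>e\<close> is an idempotent, the identity of the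
  elements called \<open>unital\<close>, and need not be an identity of the whole ring. The application is to
  operators on an ambient space that first project onto a submodule.
\<close>
locale char2_unit =
  fixes e :: "'r::ring"
  assumes char2: "a + a = (0::'r)"
    and ee: "e * e = e"
begin

lemma char2_left: "a + (a + b) = (b::'r)"
  by (metis add.assoc add_0 char2)

lemma eqI_add_zero: "a + b = 0 \<Longrightarrow> a = (b::'r)"
  by (metis char2_left add_0_right)

lemmas char2_simps = add.assoc add.commute add.left_commute char2 char2_left

lemma sum_const_char2: "finite A \<Longrightarrow> (\<Sum>i\<in>A. c) = (if odd (card A) then (c::'r) else 0)"
  by (induction A rule: finite_induct) (auto simp: char2)

text \<open>Membership in the corner \<open>e R e\<close>.\<close>
definition unital :: "'r \<Rightarrow> bool" where
  "unital a \<longleftrightarrow> e * a = a \<and> a * e = a"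

lemma unital_0 [simp]: "unital 0" by (simp add: unital_def)
lemma unital_e [simp]: "unital e" by (simp add: unital_def ee)
lemma unital_add: "unital a \<Longrightarrow> unital b \<Longrightarrow> unital (a + b)"
  by (simp add: unital_def distrib_left distrib_right)
lemma unital_mult: "unital a \<Longrightarrow> unital b \<Longrightarrow> unital (a * b)"
  by (simp add: unital_def mult.assoc) (simp add: mult.assoc [symmetric])
lemma unital_sum: "(\<And>i. i \<in> A \<Longrightarrow> unital (f i)) \<Longrightarrow> unital (sum f A)"
  by (induction A rule: infinite_finite_induct) (auto simp: unital_add)

text \<open>The sum of the products \<open>a\<^sub>i a\<^sub>j\<close> with \<open>i < j\<close> over the entries of a list \<open>[a\<^sub>1, \<dots>, a\<^sub>k]\<close>.\<close>
fun psum :: "'r list \<Rightarrow> 'r" where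
  "psum [] = 0"
| "psum (a # l) = a * sum_list l + psum l"

lemma psum_append: "psum (us @ vs) = psum us + sum_list us * sum_list vs + psum vs"
  by (induction us) (auto simp: distrib_left distrib_right add.assoc)

text \<open>
  The entries behave like vectors with \<open>Q = 1\<close> and pairwise value 1 of the polar form; this is the
  situation of transpositions through a common point.
\<close>
fun clifford_list :: "'r list \<Rightarrow> bool" where
  "clifford_list [] = True"
| "clifford_list (a # l) \<longleftrightarrow>
     unital a \<and> a * a = e \<and> (\<forall>b\<in>set l. a * b + b * a = e) \<and> clifford_list l"

lemma comm_sum_list:
  "(\<forall>b\<in>set l. g * b + b * g = e) \<Longrightarrow>
    g * sum_list l + sum_list l * g = (if odd (length l) then e else 0)"
proof (induction l)
  case (Cons a l)
  have "g * sum_list (a # l) + sum_list (a # l) * g =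
      (g * a + a * g) + (g * sum_list l + sum_list l * g)"
    by (simp add: distrib_left distrib_right add_ac)
  then show ?case using Cons by (auto simp: char2)
qed simp

lemma comm_mult: "g * (a * b) + (a * b) * g = (g * a + a * g) * b + a * (g * b + b * (g::'r))"
  by (simp add: distrib_left distrib_right mult.assoc char2_simps)

lemma clifford_list_unital: "clifford_list l \<Longrightarrow> unital (sum_list l)"
  by (induction l) (simp_all add: unital_add)

lemma comm_psum:
  assumes "\<forall>b\<in>set l. g * b + b * g = e" and "clifford_list l"
  shows "g * psum l + psum l * g = (if even (length l) then sum_list l else 0)"
  using assms
proof (induction l)
  case (Cons a l)
  have "g * psum (a # l) + psum (a # l) * g =
      (g * (a * sum_list l) + (a * sum_list l) * g) + (g * psum l + psum l * g)"
    by (simp add: distrib_left distrib_right add_ac)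
  also have "g * (a * sum_list l) + (a * sum_list l) * g =
      sum_list l + (if odd (length l) then a else 0)"
    unfolding comm_mult using Cons.prems comm_sum_list [of l g] clifford_list_unital [of l]
    by (auto simp: unital_def)
  finally show ?case using Cons by (auto simp: char2_simps)
qed simp

lemma clifford_list_append:
  "clifford_list (us @ vs) \<longleftrightarrow> clifford_list us \<and> clifford_list vs \<and>
     (\<forall>a\<in>set us. \<forall>b\<in>set vs. a * b + b * a = e)"
  by (induction us) auto

text \<open>
  In even length \<open>psum l\<close> satisfies \<open>g z = (z + 1) g\<close> for all entries \<open>g\<close>, hence commutes with the
  products of an even number of entries.
\<close>
lemma comm_psum_member:
  assumes "g \<in> set l" and "clifford_list l" and "even (length l)"
  shows "g * psum l + psum l * g = g"
proof -
  obtain us vs where l: "l = us @ g # vs" using assms(1) by (meson split_list)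
  have cl: "clifford_list us" "clifford_list vs" "unital g" "g * g = e"
    and gv: "\<forall>b\<in>set vs. g * b + b * g = e" and gu: "\<forall>b\<in>set us. g * b + b * g = e"
    using assms(2) by (auto simp: l clifford_list_append add.commute)
  define U V where "U = sum_list us" and "V = sum_list vs"
  have un: "unital U" "unital V" using cl by (auto simp: U_def V_def clifford_list_unital)
  have U: "g * U + U * g = (if odd (length us) then e else 0)"
    and V: "g * V + V * g = (if odd (length vs) then e else 0)"
    using comm_sum_list gu gv by (auto simp: U_def V_def)
  have gg: "g * (U * g) + (U * g) * g = (g * U + U * g) * g"
       "g * (g * V) + (g * V) * g = g * (g * V + V * g)"
    by (simp_all add: distrib_left distrib_right mult.assoc)
  have "psum l = psum us + (U * g + (U * V + (g * V + psum vs)))"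
    by (simp add: l psum_append U_def V_def distrib_left add.assoc)
  then have "g * psum l + psum l * g = (g * psum us + psum us * g) + (g * psum vs + psum vs * g)
     + (g * U + U * g) * g + ((g * U + U * g) * V + U * (g * V + V * g)) + g * (g * V + V * g)"
    unfolding comm_mult [symmetric] gg [symmetric] by (simp add: distrib_left distrib_right add_ac)
  moreover have "odd (length us + length vs)" using assms(3) by (simp add: l)
  ultimately show ?thesis
    using comm_psum [OF gu cl(1)] comm_psum [OF gv cl(2)] U V un cl(3)
    by (auto simp: unital_def char2_simps U_def [symmetric] V_def [symmetric])
qed

lemma comm_psum_sum:
  assumes "clifford_list l" and "even (length l)"
  shows "sum_list l * psum l + psum l * sum_list l = sum_list l"
proof -
  have "set m \<subseteq> set l \<Longrightarrow> sum_list m * psum l + psum l * sum_list m = sum_list m" for m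
  proof (induction m)
    case (Cons c m)
    have "sum_list (c # m) * psum l + psum l * sum_list (c # m) =
       (c * psum l + psum l * c) + (sum_list m * psum l + psum l * sum_list m)"
      by (simp add: distrib_left distrib_right add_ac)
    then show ?case using Cons comm_psum_member [OF _ assms, of c] by simp
  qed simp
  then show ?thesis by blast
qed

lemma clifford_list_sum_sq: "clifford_list l \<Longrightarrow> sum_list l * sum_list l \<in> {0, e}"
proof (induction l)
  case (Cons a l)
  have "sum_list (a # l) * sum_list (a # l) =
      a * a + (a * sum_list l + sum_list l * a) + sum_list l * sum_list l"
    by (simp add: distrib_left distrib_right add_ac)
  then show ?case using Cons comm_sum_list [of l a] by (auto simp: char2_simps)
qed simp

lemma zero_e_add: "a \<in> {0, e} \<Longrightarrow> b \<in> {0, e} \<Longrightarrow> a + b \<in> {0, e}" by (auto simp: char2)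
lemma zero_e_mult: "a \<in> {0, e} \<Longrightarrow> b \<in> {0, e} \<Longrightarrow> a * b \<in> {0, e}" by (auto simp: ee)

text \<open>
  Two more entries \<open>a\<close>, \<open>b\<close> change \<open>z\<close> by \<open>p q\<close> and a constant, where \<open>p = a + s\<close>, \<open>q = b + s\<close> and
  \<open>s\<close> is the sum of the old entries; \<open>p\<close> and \<open>q\<close> commute with \<open>z\<close>, and \<open>p q\<close> satisfies an equation of
  the same kind.
\<close>
lemma psum_quadratic:
  "clifford_list l \<Longrightarrow> even (length l) \<Longrightarrow> psum l * psum l + psum l \<in> {0, e}"
proof (induction l rule: induct_list012)
  case (3 a b l)
  define s Z where "s = sum_list l" and "Z = psum l"
  have cl: "clifford_list l" "unital a" "unital b" "a * a = e" "b * b = e" "a * b + b * a = e"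
     "\<forall>c\<in>set l. a * c + c * a = e" "\<forall>c\<in>set l. b * c + c * b = e" and ev: "even (length l)"
    using "3.prems" by auto
  have IH: "Z * Z + Z \<in> {0, e}" using 3 by (auto simp: Z_def)
  have us: "unital s" using cl by (simp add: s_def clifford_list_unital)
  have as: "a * s + s * a = 0" and bs: "b * s + s * b = 0"
    using comm_sum_list [of l a] comm_sum_list [of l b] cl ev by (auto simp: s_def)
  have aZ: "a * Z + Z * a = s" and bZ: "b * Z + Z * b = s"
    using comm_psum [of l a] comm_psum [of l b] cl ev by (auto simp: s_def Z_def)
  have sZ: "s * Z + Z * s = s" unfolding s_def Z_def by (rule comm_psum_sum [OF cl(1) ev])
  have s2: "s * s \<in> {0, e}" using clifford_list_sum_sq cl(1) by (simp add: s_def)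
  define p q where "p = a + s" and "q = b + s"
  have pZ: "p * Z = Z * p" and qZ: "q * Z = Z * q"
  proof -
    have "p * Z + Z * p = (a * Z + Z * a) + (s * Z + Z * s)"
      by (simp add: p_def distrib_left distrib_right add_ac)
    then show "p * Z = Z * p" using aZ sZ by (simp add: char2 eqI_add_zero)
    have "q * Z + Z * q = (b * Z + Z * b) + (s * Z + Z * s)"
      by (simp add: q_def distrib_left distrib_right add_ac)
    then show "q * Z = Z * q" using bZ sZ by (simp add: char2 eqI_add_zero)
  qed
  have pp: "p * p = e + s * s"
  proof -
    have "p * p = a * a + (a * s + s * a) + s * s"
      by (simp add: p_def distrib_left distrib_right add_ac)
    then show ?thesis using as cl by simp
  qed
  have qq: "q * q = e + s * s"
  proof -
    have "q * q = b * b + (b * s + s * b) + s * s"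
      by (simp add: q_def distrib_left distrib_right add_ac)
    then show ?thesis using bs cl by simp
  qed
  have pq: "p * q + q * p = e"
  proof -
    have "p * q + q * p = (a * b + b * a) + (a * s + s * a) + (b * s + s * b) + (s * s + s * s)"
      by (simp add: p_def q_def distrib_left distrib_right add_ac)
    then show ?thesis using as bs cl by (simp add: char2)
  qed
  have up: "unital p" "unital q" using cl us by (auto simp: p_def q_def unital_add)
  have pq2: "(p * q) * (p * q) + p * q \<in> {0, e}"
  proof -
    have "q * p = p * q + e" using pq by (metis char2_left add.commute)
    then have "(p * q) * (p * q) = p * (p * q + e) * q" by (metis mult.assoc)
    also have "\<dots> = (p * p) * (q * q) + p * q"
      using up by (simp add: distrib_left distrib_right mult.assoc unital_def)
    finally have "(p * q) * (p * q) + p * q = (p * p) * (q * q)" by (simp add: char2_simps)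
    then show ?thesis
      using zero_e_mult [OF zero_e_add [OF _ s2] zero_e_add [OF _ s2], of e e] by (simp add: pp qq)
  qed
  have Z': "psum (a # b # l) = Z + p * q + s * s"
  proof -
    have "s * b = b * s" using bs by (metis eqI_add_zero add.commute)
    then show ?thesis
      by (simp add: p_def q_def s_def [symmetric] Z_def [symmetric] distrib_left distrib_right char2_simps)
  qed
  have pqZ: "(p * q) * Z = Z * (p * q)" by (metis pZ qZ mult.assoc)
  define y where "y = p * q"
  define c where "c = s * s"
  have c: "c = 0 \<or> c = e" using s2 by (auto simp: c_def)
  have uZ: "unital Z"
  proof -
    have "clifford_list m \<Longrightarrow> unital (psum m)" for m
    proof (induction m)
      case (Cons c m)
      then have "unital (c * sum_list m)" using clifford_list_unital [of m] by (simp add: unital_mult)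
      then show ?case using Cons by (simp add: unital_add)
    qed simp
    then show ?thesis using cl by (simp add: Z_def)
  qed
  have uy: "unital y" using up by (simp add: y_def unital_mult)
  have "(Z + y + c) * (Z + y + c) + (Z + y + c) =
      (Z * Z + Z) + (y * y + y) + (c * c + c) + (Z * y + y * Z) + (Z * c + c * Z) + (y * c + c * y)"
    by (simp add: distrib_left distrib_right add_ac)
  moreover have "c * c + c = 0" "Z * c + c * Z = 0" "y * c + c * y = 0"
    using c uZ uy by (auto simp: ee char2 unital_def)
  moreover have "Z * y + y * Z = 0" using pqZ by (simp add: y_def char2)
  moreover have "y * y + y \<in> {0, e}" using pq2 by (simp add: y_def)
  ultimately have "(Z + y + c) * (Z + y + c) + (Z + y + c) = (Z * Z + Z) + (y * y + y)"
    and "y * y + y \<in> {0, e}"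
    by (simp_all only: add_0_right)
  then have "(Z + y + c) * (Z + y + c) + (Z + y + c) \<in> {0, e}"
    using zero_e_add [OF IH, of "y * y + y"] by (simp only:)
  then show ?case unfolding Z' y_def [symmetric] c_def [symmetric] .
qed auto

text \<open>The change of \<open>psum\<close> under translation of all entries by \<open>w\<close>.\<close>
lemma psum_translate:
  assumes "w * w = e" "unital w" and "\<forall>a\<in>set l. unital a \<and> a * w + w * a = e"
  shows "\<exists>c\<in>{0, e}. psum (map (\<lambda>a. w + a) l) =
    c + (if even (length l) then w * sum_list l else 0) + psum l"
  using assms(3)
proof (induction l)
  case (Cons a l)
  define s Z where "s = sum_list l" and "Z = psum l"
  have us: "unital s" using Cons.prems unfolding s_def by (induction l) (simp_all add: unital_add)
  obtain c where c: "c \<in> {0, e}"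
    "psum (map (\<lambda>a. w + a) l) = c + (if even (length l) then w * s else 0) + Z"
  proof -
    have "\<exists>c\<in>{0, e}. psum (map (\<lambda>a. w + a) l) =
       c + (if even (length l) then w * sum_list l else 0) + psum l"
      using Cons.prems by (intro Cons.IH) simp
    then show ?thesis using that unfolding s_def Z_def by blast
  qed
  have sm: "sum_list (map (\<lambda>a. w + a) l) = (if odd (length l) then w else 0) + s"
    unfolding s_def by (induction l) (auto simp: char2_simps)
  have aw: "a * w = w * a + e" using Cons.prems by (metis char2_left add.commute list.set_intros(1))
  have ex: "c + e \<in> {0, e}" using c by (auto simp: char2)
  have ps: "psum (map (\<lambda>a. w + a) (a # l)) =
      (w + a) * ((if odd (length l) then w else 0) + s) + (c + (if even (length l) then w * s else 0) + Z)"
    using c(2) sm by simp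
  show ?case
  proof (cases "even (length l)")
    case True
    then show ?thesis using c(1) unfolding ps
      by (intro bexI [of _ c]) (simp_all add: distrib_left distrib_right s_def [symmetric]
        Z_def [symmetric] char2_simps)
  next
    case False
    then show ?thesis using c(1) unfolding ps
      by (intro bexI [of _ c]) (simp_all add: distrib_left distrib_right s_def [symmetric]
        Z_def [symmetric] char2_simps aw assms(1))
  qed
qed auto

end

text \<open>
  Elements \<open>x i\<close> of which only the sums \<open>x i + x j\<close> have a prescribed square. The relations are
  symmetric in the indices, and one of the \<open>x i\<close> may be taken to be 0.
\<close>
locale clifford = char2_unit e for e :: "'r::ring" +
  fixes x :: "nat \<Rightarrow> 'r" and N :: "nat set"
  assumes unital_x: "i \<in> N \<Longrightarrow> unital (x i)"
    and sq: "i \<in> N \<Longrightarrow> j \<in> N \<Longrightarrow> i \<noteq> j \<Longrightarrow> (x i + x j) * (x i + x j) = e"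
begin

text \<open>
  The vector of a set of points. It is used for sets of even size, for which it is a sum of
  elements \<open>x i + x p\<close> with \<open>p\<close> arbitrary (\<open>vec_via_base\<close>).
\<close>
definition vec :: "nat set \<Rightarrow> 'r" where "vec S = sum x S"

lemma anticomm:
  assumes "i \<in> N" "j \<in> N"
  shows "x i * x j + x j * x i = x i * x i + x j * x j + (if i = j then 0 else e)"
proof (cases "i = j")
  case False
  have "(x i + x j) * (x i + x j) = x i * x i + x j * x j + (x i * x j + x j * x i)"
    by (simp add: distrib_left distrib_right add_ac)
  then have "x i * x i + x j * x j + (x i * x j + x j * x i) = e"
    using sq [OF assms False] by simp
  then show ?thesis
    using False char2_left [of "x i * x i + x j * x j" "x i * x j + x j * x i"] by simp
qed (simp add: char2)

text \<open>
  The polar form is the size of the intersection modulo two: the squares of the \<open>x i\<close> cancel since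
  both sets have even size.
\<close>
lemma vec_comm:
  assumes "finite S" "finite T" "S \<subseteq> N" "T \<subseteq> N" "even (card S)" "even (card T)"
  shows "vec S * vec T + vec T * vec S = (if odd (card (S \<inter> T)) then e else 0)"
proof -
  have "vec S * vec T + vec T * vec S = (\<Sum>i\<in>S. \<Sum>j\<in>T. x i * x j + x j * x i)"
    unfolding vec_def sum_product sum.distrib by (subst sum.swap [of _ S T]) simp
  also have "\<dots> = (\<Sum>i\<in>S. (\<Sum>j\<in>T. x j * x j) + (if i \<in> T then e else 0))"
  proof (rule sum.cong)
    fix i assume i: "i \<in> S"
    have "(\<Sum>j\<in>T. x i * x j + x j * x i) =
        (\<Sum>j\<in>T. x i * x i + (x j * x j + (if j = i then 0 else e)))"
      using assms(3,4) i by (intro sum.cong) (auto simp: anticomm subset_iff add.assoc)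
    also have "\<dots> = (\<Sum>j\<in>T. x j * x j) + (\<Sum>j\<in>T. if j = i then 0 else e)"
      using assms by (simp add: sum.distrib sum_const_char2)
    also have "(\<Sum>j\<in>T. if j = i then 0 else e) = (\<Sum>j\<in>T - {i}. e)"
      using assms by (intro sum.mono_neutral_cong_right) auto
    also have "\<dots> = (if i \<in> T then e else 0)"
    proof (cases "i \<in> T")
      case True
      then have "card T = Suc (card (T - {i}))" using assms(2) card_Suc_Diff1 by metis
      then have "odd (card (T - {i}))" using assms by simp
      then show ?thesis using True assms by (simp add: sum_const_char2)
    qed (use assms in \<open>simp add: sum_const_char2\<close>)
    finally show "(\<Sum>j\<in>T. x i * x j + x j * x i) = (\<Sum>j\<in>T. x j * x j) + (if i \<in> T then e else 0)" .
  qed simp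
  also have "\<dots> = (\<Sum>i\<in>S. if i \<in> T then e else 0)"
    using assms by (simp add: sum.distrib sum_const_char2)
  also have "\<dots> = (\<Sum>i\<in>S \<inter> T. e)"
    using assms by (simp add: sum.inter_restrict)
  finally show ?thesis using assms by (simp add: sum_const_char2)
qed

lemma vec_Un: "finite S \<Longrightarrow> finite T \<Longrightarrow> S \<inter> T = {} \<Longrightarrow> vec (S \<union> T) = vec S + vec T"
  by (simp add: vec_def sum.union_disjoint)

lemma vec_pair: "i \<noteq> j \<Longrightarrow> vec {i, j} = x i + x j"
  by (simp add: vec_def)

text \<open>The square of a vector is half the size of the set, modulo two.\<close>
lemma vec_sq:
  assumes "finite S" "S \<subseteq> N" "even (card S)"
  shows "vec S * vec S = (if odd (card S div 2) then e else 0)"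
  using assms
proof (induction "card S" arbitrary: S rule: less_induct)
  case less
  show ?case
  proof (cases "S = {}")
    case True
    then show ?thesis by (simp add: vec_def)
  next
    case False
    then obtain a where a: "a \<in> S" by auto
    have "card S \<noteq> 1" using less.prems by auto
    then obtain b where b: "b \<in> S" "b \<noteq> a" using a by (metis is_singletonI' is_singleton_altdef empty_iff)
    define T where "T = S - {a, b}"
    have S: "S = T \<union> {a, b}" "T \<inter> {a, b} = {}" using a b by (auto simp: T_def)
    have fT: "finite T" "T \<subseteq> N" using less.prems by (auto simp: T_def)
    have card: "card S = card T + 2" using S b less.prems fT by (simp add: card_Un_disjoint)
    have IH: "vec T * vec T = (if odd (card T div 2) then e else 0)"
      using less.hyps [of T] less.prems card fT by auto
    have "vec S = vec T + vec {a, b}" using vec_Un [of T "{a, b}"] S fT by simp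
    then have "vec S * vec S =
       vec T * vec T + (vec T * vec {a, b} + vec {a, b} * vec T) + vec {a, b} * vec {a, b}"
      by (simp add: distrib_left distrib_right add_ac)
    also have "vec T * vec {a, b} + vec {a, b} * vec T = 0"
      using vec_comm [of T "{a, b}"] S b fT less.prems card by auto
    also have "vec {a, b} * vec {a, b} = e"
      using sq [of a b] a b less.prems by (auto simp: vec_pair)
    finally show ?thesis using IH card by (auto simp: char2)
  qed
qed

lemma vec_via_base:
  assumes "finite S" "even (card S)"
  shows "vec S = (\<Sum>i\<in>S. x i + x p)"
  using assms by (simp add: vec_def sum.distrib sum_const_char2)

end

section \<open>Modules on which 3-cycles have no fixed vectors\<close>

text \<open>
  The ring of additive endomorphisms of an abelian group. Linearity is recorded separately
  (predicate \<open>linop\<close> below), since the scalar multiplication is not part of the type.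
\<close>
typedef (overloaded) 'v additive = "{f :: 'v::ab_group_add \<Rightarrow> 'v. \<forall>x y. f (x + y) = f x + f y}"
  morphisms app Additive
  by (rule exI [of _ "\<lambda>x. x"]) simp

setup_lifting type_definition_additive

instantiation additive :: (ab_group_add) ring
begin

lift_definition zero_additive :: "'a additive" is "\<lambda>x. 0" by simp
lift_definition plus_additive :: "'a additive \<Rightarrow> 'a additive \<Rightarrow> 'a additive"
  is "\<lambda>f g x. f x + g x" by (simp add: algebra_simps)
lift_definition uminus_additive :: "'a additive \<Rightarrow> 'a additive"
  is "\<lambda>f x. - f x" by (simp add: algebra_simps)
lift_definition minus_additive :: "'a additive \<Rightarrow> 'a additive \<Rightarrow> 'a additive"
  is "\<lambda>f g x. f x - g x" by (simp add: algebra_simps)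
lift_definition times_additive :: "'a additive \<Rightarrow> 'a additive \<Rightarrow> 'a additive"
  is "\<lambda>f g x. f (g x)" by simp

instance
  by standard (transfer; simp add: fun_eq_iff algebra_simps)+

end

lemma app_add: "app r (x + y) = app r x + app r y" by transfer simp
lemma app_zero [simp]: "app r 0 = 0"
  using app_add [of r 0 0] by simp
lemma app_zero_additive [simp]: "app 0 x = 0" by transfer simp
lemma app_plus: "app (r + q) x = app r x + app q x" by transfer simp
lemma app_times: "app (r * q) x = app r (app q x)" by transfer simp
lemma additive_eqI: "(\<And>x. app r x = app q x) \<Longrightarrow> r = q" by (simp add: app_inject [symmetric] fun_eq_iff)

text \<open>
  A module for the symmetric group in characteristic two with \<open>(i j) + (j k) + (i k) = 0\<close> for
  distinct \<open>i\<close>, \<open>j\<close>, \<open>k\<close>. Multiplication by a transposition gives \<open>1 + c + c\<^sup>2 = 0\<close> for 3-cycles \<open>c\<close>.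
\<close>
locale spin_module =
  fixes s :: "'f::field \<Rightarrow> 'v::ab_group_add \<Rightarrow> 'v"
    and \<rho> :: "(nat \<Rightarrow> nat) \<Rightarrow> 'v \<Rightarrow> 'v"
    and D :: "'v set" and n :: nat
  assumes char: "CHAR('f) = 2"
    and n_pos: "n > 0"
    and module_D: "perm_module s {p. p permutes {1..n}} \<rho> D"
    and three_cycle: "\<lbrakk>i \<in> {1..n}; j \<in> {1..n}; k \<in> {1..n}; i \<noteq> j; j \<noteq> k; i \<noteq> k; v \<in> D\<rbrakk> \<Longrightarrow>
      \<rho> (transpose i j) v + \<rho> (transpose j k) v + \<rho> (transpose i k) v = 0"
begin

sublocale vs: vector_space s using module_D by (simp add: perm_module_def)

lemma subspace_D: "vs.subspace D" using module_D by (simp add: perm_module_def)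

lemma rho_linear: "g permutes {1..n} \<Longrightarrow> linear_on s s D (\<rho> g)"
  and rho_closed: "g permutes {1..n} \<Longrightarrow> v \<in> D \<Longrightarrow> \<rho> g v \<in> D"
  and rho_id: "v \<in> D \<Longrightarrow> \<rho> id v = v"
  and rho_comp: "g permutes {1..n} \<Longrightarrow> h permutes {1..n} \<Longrightarrow> v \<in> D \<Longrightarrow> \<rho> (g \<circ> h) v = \<rho> g (\<rho> h v)"
  using module_D by (auto simp: perm_module_def)

lemma two_eq_0: "(1::'f) + 1 = 0"
  using of_nat_CHAR [where 'a = 'f] by (simp add: char)

lemma vec_char2: "v + v = (0::'v)"
proof -
  have "v + v = s (1 + 1) v" by (simp only: vs.scale_left_distrib vs.scale_one)
  then show ?thesis by (simp only: two_eq_0 vs.scale_zero_left)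
qed

lemma additive_char2: "r + r = (0::'v additive)"
  by (rule additive_eqI) (simp add: app_plus vec_char2)

text \<open>
  An additive projection of the ambient space onto \<open>D\<close>. It extends the action, of which only the
  values on \<open>D\<close> are meaningful, to additive maps on the ambient space.
\<close>
definition proj :: "'v \<Rightarrow> 'v" where
  "proj = (SOME p. (\<forall>x y. p (x + y) = p x + p y) \<and> (\<forall>v. p v \<in> D) \<and> (\<forall>v\<in>D. p v = v))"

lemma proj: "proj (x + y) = proj x + proj y" "proj v \<in> D" "v \<in> D \<Longrightarrow> proj v = v"
proof -
  interpret vsp: vector_space_pair s s by unfold_locales
  have "Vector_Spaces.linear s s (\<lambda>x. x)" by (simp add: vs.linear_id [unfolded id_def])
  from vsp.linear_exists_left_inverse_on [OF this subspace_D]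
  obtain p where p: "p ` UNIV \<subseteq> D" "Vector_Spaces.linear s s p" "\<forall>v\<in>D. p v = v" by auto
  then have "(\<forall>x y. p (x + y) = p x + p y) \<and> (\<forall>v. p v \<in> D) \<and> (\<forall>v\<in>D. p v = v)"
    by (auto simp: Vector_Spaces.linear.axioms module_hom.add
       Vector_Spaces.linear_iff_module_hom)
  then have "(\<forall>x y. proj (x + y) = proj x + proj y) \<and> (\<forall>v. proj v \<in> D) \<and> (\<forall>v\<in>D. proj v = v)"
    
    using someI [of "\<lambda>p. (\<forall>x y. p (x + y) = p x + p y) \<and> (\<forall>v. p v \<in> D) \<and> (\<forall>v\<in>D. p v = v)" p]
    unfolding proj_def by blast
  then show "proj (x + y) = proj x + proj y" "proj v \<in> D" "v \<in> D \<Longrightarrow> proj v = v" by auto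
qed

text \<open>The operator of a permutation. The operator of the identity is \<open>proj\<close>, not the identity map.\<close>
definition opr :: "(nat \<Rightarrow> nat) \<Rightarrow> 'v additive" where
  "opr g = Additive (\<lambda>v. \<rho> g (proj v))"

lemma app_opr': "g permutes {1..n} \<Longrightarrow> app (opr g) v = \<rho> g (proj v)"
  unfolding opr_def
  by (subst Additive_inverse) (use rho_linear [of g] in \<open>auto simp: proj linear_on_def\<close>)

lemma app_opr: "g permutes {1..n} \<Longrightarrow> v \<in> D \<Longrightarrow> app (opr g) v = \<rho> g v"
  by (simp add: app_opr' proj)

lemma opr_comp: "g permutes {1..n} \<Longrightarrow> h permutes {1..n} \<Longrightarrow> opr (g \<circ> h) = opr g * opr h"
  by (rule additive_eqI) (simp add: app_times app_opr' permutes_compose rho_comp rho_closed proj)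

lemma opr_id_app: "app (opr id) v = proj v"
  by (simp add: app_opr' permutes_id rho_id proj)

lemma transpose_permutes: "i \<in> {1..n} \<Longrightarrow> j \<in> {1..n} \<Longrightarrow> transpose i j permutes {1..n}"
  by (rule permutes_swap_id)

sublocale char2_unit "opr id"
  by unfold_locales
    (simp_all add: additive_char2 opr_comp [OF permutes_id permutes_id, symmetric])

lemma unital_opr: "g permutes {1..n} \<Longrightarrow> unital (opr g)"
  using opr_comp [OF permutes_id, of g] opr_comp [OF _ permutes_id, of g] by (simp add: unital_def)

lemma nn: "n \<in> {1..n}" using n_pos by simp

text \<open>
  The generators of the Clifford algebra, with base point \<open>n\<close>: by the relation for 3-cycles the
  transposition of \<open>i\<close> and \<open>j\<close> acts as \<open>gen i + gen j\<close>, including the case that one of them is \<open>n\<close>.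
\<close>
definition gen :: "nat \<Rightarrow> 'v additive" where
  "gen i = (if i = n then 0 else opr (transpose i n))"

lemma gen_add:
  assumes "i \<in> {1..n}" "j \<in> {1..n}" "i \<noteq> j"
  shows "gen i + gen j = opr (transpose i j)"
proof (cases "i = n \<or> j = n")
  case True
  then show ?thesis using assms by (auto simp: gen_def transpose_commute)
next
  case False
  have "opr (transpose i j) + opr (transpose j n) + opr (transpose i n) = 0"
    using assms False nn
    by (intro additive_eqI)
      (simp add: app_plus app_opr' transpose_permutes three_cycle proj del: atLeastAtMost_iff One_nat_def)
  then have "opr (transpose i j) = opr (transpose j n) + opr (transpose i n)"
    by (metis add.assoc eqI_add_zero)
  then show ?thesis using False by (simp add: gen_def add.commute)
qed

lemma opr_transpose_sq:
  "i \<in> {1..n} \<Longrightarrow> j \<in> {1..n} \<Longrightarrow> opr (transpose i j) * opr (transpose i j) = opr id"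
  using opr_comp [OF transpose_permutes transpose_permutes, of i j i j] by (simp add: id_def)

sublocale clifford "opr id" gen "{1..n}"
proof
  show "unital (gen i)" if "i \<in> {1..n}" for i
    using that nn by (simp add: gen_def unital_opr transpose_permutes del: atLeastAtMost_iff One_nat_def)
  show "(gen i + gen j) * (gen i + gen j) = opr id" if "i \<in> {1..n}" "j \<in> {1..n}" "i \<noteq> j" for i j
    using that by (simp add: gen_add opr_transpose_sq)
qed

text \<open>Permutations act on the vectors of sets of even size through their action on sets.\<close>
lemma opr_vec:
  assumes g: "g permutes {1..n}" and S: "S \<subseteq> {1..n}" "even (card S)"
  shows "opr g * vec S = vec (g ` S) * opr g"
proof -
  have fin: "finite S" using S finite_subset by blast
  have inj: "inj g" using g permutes_inj by blast
  have gS: "g ` S \<subseteq> {1..n}" using S g permutes_image by blast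
  have gn: "g n \<in> {1..n}" using g nn permutes_in_image by metis
  have tr: "opr g * (gen i + gen n) = (gen (g i) + gen (g n)) * opr g" if i: "i \<in> S" for i
  proof (cases "i = n")
    case True
    then show ?thesis by (simp add: char2)
  next
    case False
    have "i \<in> {1..n}" using i S by auto
    moreover have "g i \<in> {1..n}" using calculation g permutes_in_image by metis
    moreover have "g i \<noteq> g n" using False inj by (auto dest: injD)
    moreover have "g \<circ> transpose i n = transpose (g i) (g n) \<circ> g"
      using inj by (auto simp: fun_eq_iff transpose_def dest: injD)
    ultimately show ?thesis using False nn gn g
      by (simp add: gen_add opr_comp [symmetric] transpose_permutes del: atLeastAtMost_iff One_nat_def)
  qed
  have "vec S = (\<Sum>i\<in>S. gen i + gen n)" using vec_via_base fin S by blast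
  then have "opr g * vec S = (\<Sum>i\<in>S. gen (g i) + gen (g n)) * opr g"
    by (simp add: sum_distrib_left sum_distrib_right tr)
  also have "(\<Sum>i\<in>S. gen (g i) + gen (g n)) = (\<Sum>i\<in>g ` S. gen i + gen (g n))"
    using inj by (subst sum.reindex) (auto intro: inj_on_subset)
  also have "\<dots> = vec (g ` S)"
    using vec_via_base [of "g ` S" "g n"] fin S inj card_image [of g S] by (simp add: inj_on_subset)
  finally show ?thesis .
qed

text \<open>Operators that preserve \<open>D\<close> and are linear on it.\<close>
definition linop :: "'v additive \<Rightarrow> bool" where
  "linop r \<longleftrightarrow> (\<forall>v\<in>D. app r v \<in> D \<and> (\<forall>c. app r (s c v) = s c (app r v)))"

lemma linop_zero [simp]: "linop 0" using subspace_D by (simp add: linop_def vs.subspace_0)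
lemma linop_add: "linop r \<Longrightarrow> linop q \<Longrightarrow> linop (r + q)"
  using subspace_D by (simp add: linop_def app_plus vs.subspace_add vs.scale_right_distrib)
lemma linop_mult: "linop r \<Longrightarrow> linop q \<Longrightarrow> linop (r * q)"
  by (simp add: linop_def app_times)
lemma linop_opr: "g permutes {1..n} \<Longrightarrow> linop (opr g)"
  using rho_linear [of g] subspace_D
  by (auto simp: linop_def app_opr rho_closed vs.subspace_scale linear_on_def)
lemma linop_sum: "(\<And>i. i \<in> A \<Longrightarrow> linop (f i)) \<Longrightarrow> linop (sum f A)"
  by (induction A rule: infinite_finite_induct) (auto simp: linop_add)
lemma linop_vec: "S \<subseteq> {1..n} \<Longrightarrow> linop (vec S)"
  unfolding vec_def using n_pos
  by (intro linop_sum) (auto simp: gen_def intro!: linop_opr transpose_permutes)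

end

section \<open>Parity of operators and irreducible restrictions\<close>

text \<open>
  The operator \<open>r\<close> is odd (\<open>b\<close> true) or even (\<open>b\<close> false) for the pair of sets \<open>W\<close>, \<open>W'\<close>: it exchanges
  them or preserves each of them.
\<close>
definition parity_map :: "'v::ab_group_add set \<Rightarrow> 'v set \<Rightarrow> bool \<Rightarrow> 'v additive \<Rightarrow> bool" where
  "parity_map W W' b r \<longleftrightarrow>
     (if b then (\<forall>x\<in>W. app r x \<in> W') \<and> (\<forall>x\<in>W'. app r x \<in> W)
      else (\<forall>x\<in>W. app r x \<in> W) \<and> (\<forall>x\<in>W'. app r x \<in> W'))"

definition add_closed :: "'v::ab_group_add set \<Rightarrow> bool" where
  "add_closed W \<longleftrightarrow> 0 \<in> W \<and> (\<forall>x\<in>W. \<forall>y\<in>W. x + y \<in> W)"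

lemma add_closed_image: "add_closed W \<Longrightarrow> add_closed (app r ` W)"
proof -
  assume W: "add_closed W"
  have "0 \<in> app r ` W" using W by (force simp: add_closed_def intro!: image_eqI [of _ _ 0])
  moreover have "app r x + app r y \<in> app r ` W" if "x \<in> W" "y \<in> W" for x y
    using W that by (auto simp: add_closed_def app_add [symmetric])
  ultimately show ?thesis by (auto simp: add_closed_def)
qed

lemma parity_map_mult:
  "parity_map W W' b r \<Longrightarrow> parity_map W W' c q \<Longrightarrow> parity_map W W' (b \<noteq> c) (r * q)"
  by (auto simp: parity_map_def app_times split: if_splits)

context
  fixes W W' :: "'v::ab_group_add set"
  assumes W: "add_closed W" and W': "add_closed W'"
begin

lemma parity_map_0: "parity_map W W' b 0"
  using W W' by (auto simp: parity_map_def add_closed_def)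

lemma parity_map_add:
  "parity_map W W' b r \<Longrightarrow> parity_map W W' b q \<Longrightarrow> parity_map W W' b (r + q)"
  using W W' by (auto simp: parity_map_def app_plus add_closed_def split: if_splits)

lemma parity_map_sum:
  "(\<And>i. i \<in> A \<Longrightarrow> parity_map W W' b (f i)) \<Longrightarrow> parity_map W W' b (sum f A)"
  by (induction A rule: infinite_finite_induct) (auto simp: parity_map_add parity_map_0)

lemma parity_map_sum_list:
  "(\<And>a. a \<in> set l \<Longrightarrow> parity_map W W' b a) \<Longrightarrow> parity_map W W' b (sum_list l)"
  by (induction l) (auto simp: parity_map_add parity_map_0)

end

context spin_module
begin

lemma add_closed_subspace: "vs.subspace W \<Longrightarrow> add_closed W"
  by (simp add: add_closed_def vs.subspace_0 vs.subspace_add)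

text \<open>A sum of products of two odd operators is even.\<close>
lemma parity_map_psum:
  assumes "add_closed W" "add_closed W'"
  shows "(\<And>a. a \<in> set l \<Longrightarrow> parity_map W W' True a) \<Longrightarrow> parity_map W W' False (psum l)"
proof (induction l)
  case (Cons a l)
  have "parity_map W W' (True \<noteq> True) (a * sum_list l)"
    using Cons.prems assms by (intro parity_map_mult parity_map_sum_list) auto
  then show ?case using Cons assms by (auto intro!: parity_map_add)
qed (simp add: parity_map_0 assms)

lemma parity_map_vec:
  assumes "add_closed W" "add_closed W'" and "finite S" "even (card S)"
    and "\<And>i. i \<in> S \<Longrightarrow> parity_map W W' b (gen i + gen p)"
  shows "parity_map W W' b (vec S)"
  using assms by (simp add: vec_via_base [of S p] parity_map_sum)

lemma app_opr_sq: "i \<in> {1..n} \<Longrightarrow> j \<in> {1..n} \<Longrightarrow> v \<in> D \<Longrightarrow>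
    app (opr (transpose i j)) (app (opr (transpose i j)) v) = v"
  by (simp add: app_times [symmetric] opr_transpose_sq opr_id_app proj del: atLeastAtMost_iff One_nat_def)

lemma odd_transpose: "i \<noteq> j \<Longrightarrow> \<not> evenperm (transpose i j)"
  by (simp add: evenperm_swap)

lemma perm_permutation: "g permutes {1..n} \<Longrightarrow> permutation g"
  using permutation_permutes by blast

lemma evenperm_mult: "g permutes {1..n} \<Longrightarrow> h permutes {1..n} \<Longrightarrow>
    evenperm (g \<circ> h) \<longleftrightarrow> (evenperm g = evenperm h)"
  by (simp add: evenperm_comp perm_permutation)

text \<open>
  If \<open>W\<close> is invariant under the even elements of a group, then the elements of the group have on the
  pair of \<open>W\<close> and its translate by a transposition of the group the parity given by their sign.
\<close>
lemma parity_map_opr: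
  assumes N: "\<And>g. g \<in> N \<Longrightarrow> g permutes {1..n}" "\<And>g h. g \<in> N \<Longrightarrow> h \<in> N \<Longrightarrow> g \<circ> h \<in> N"
    and ab: "a \<in> {1..n}" "b \<in> {1..n}" "a \<noteq> b" "transpose a b \<in> N"
    and W: "W \<subseteq> D" "\<And>g x. g \<in> N \<Longrightarrow> evenperm g \<Longrightarrow> x \<in> W \<Longrightarrow> \<rho> g x \<in> W"
    and g: "g \<in> N"
  shows "parity_map W (app (opr (transpose a b)) ` W) (\<not> evenperm g) (opr g)"
proof -
  let ?t = "transpose a b"
  have inv: "app (opr h) x \<in> W" if "h \<in> N" "evenperm h" "x \<in> W" for h x
    using W(2) [OF that] W(1) that N(1) [OF that(1)] by (simp add: app_opr subset_iff)
  have t: "\<not> evenperm ?t" using ab(3) by (rule odd_transpose)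
  have t': "?t permutes {1..n}" using ab(1,2) by (rule transpose_permutes)
  have tt: "app (opr ?t) (app (opr ?t) x) = x" if "x \<in> D" for x
    by (rule app_opr_sq [OF ab(1,2) that])
  have gp: "g permutes {1..n}" using g by (rule N(1))
  have tg: "app (opr (?t \<circ> g)) x = app (opr ?t) (app (opr g) x)"
     "app (opr (g \<circ> ?t)) x = app (opr g) (app (opr ?t) x)"
     "app (opr (?t \<circ> g \<circ> ?t)) x = app (opr ?t) (app (opr g) (app (opr ?t) x))" for x
    using t' gp by (simp_all add: opr_comp app_times permutes_compose)
  have memN: "?t \<circ> g \<in> N" "g \<circ> ?t \<in> N" "?t \<circ> g \<circ> ?t \<in> N"
    by (intro N(2) ab(4) g)+
  have D: "app (opr g) x \<in> D" if "x \<in> D" for x using that gp by (simp add: app_opr rho_closed)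
  have D': "app (opr ?t) x \<in> D" if "x \<in> D" for x using that t' by (simp add: app_opr rho_closed)
  show ?thesis
  proof (cases "evenperm g")
    case True
    have "evenperm (?t \<circ> g \<circ> ?t)" using True t t' gp by (simp add: evenperm_mult permutes_compose)
    then have "app (opr ?t) (app (opr g) (app (opr ?t) x)) \<in> W" if "x \<in> W" for x
      using inv [OF memN(3) _ that] by (simp add: tg)
    then have 2: "app (opr g) (app (opr ?t) x) \<in> app (opr ?t) ` W" if "x \<in> W" for x
      using that tt [OF D [OF D' [of x]]] W(1)
      by (intro image_eqI [where x = "app (opr ?t) (app (opr g) (app (opr ?t) x))"]) (auto dest: subsetD)
    have 1: "app (opr g) x \<in> W" if "x \<in> W" for x using inv g True that by blast
    show ?thesis unfolding parity_map_def using True 1 2 by simp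
  next
    case False
    have ev: "evenperm (?t \<circ> g)" "evenperm (g \<circ> ?t)" 
      by (simp_all only: evenperm_mult [OF t' gp] evenperm_mult [OF gp t'] t False)
    have 1: "app (opr g) (app (opr ?t) x) \<in> W" if "x \<in> W" for x
      using inv [OF memN(2) ev(2) that] by (simp add: tg)
    have "app (opr ?t) (app (opr g) x) \<in> W" if "x \<in> W" for x
      using inv [OF memN(1) ev(1) that] by (simp add: tg)
    then have 2: "app (opr g) x \<in> app (opr ?t) ` W" if "x \<in> W" for x
      using that tt [OF D [of x]] W(1)
      by (intro image_eqI [where x = "app (opr ?t) (app (opr g) x)"]) (auto dest: subsetD)
    show ?thesis unfolding parity_map_def using False 1 2 by simp
  qed
qed

lemma parity_map_transposition:
  assumes ac: "add_closed W" "add_closed W'"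
    and par: "\<And>g. g \<in> N \<Longrightarrow> parity_map W W' (\<not> evenperm g) (opr g)"
    and ij: "i \<in> {1..n}" "j \<in> {1..n}" "i \<noteq> j \<Longrightarrow> transpose i j \<in> N"
  shows "parity_map W W' True (gen i + gen j)"
proof (cases "i = j")
  case True
  then show ?thesis using ac by (simp add: char2 parity_map_0)
next
  case False
  then show ?thesis using par [OF ij(3)] gen_add [OF ij(1,2)] odd_transpose [of i j] by simp
qed

lemma parity_map_id:
  assumes par: "\<And>g. g \<in> N \<Longrightarrow> parity_map W W' (\<not> evenperm g) (opr g)"
    and ab: "a \<in> {1..n}" "b \<in> {1..n}" "a \<noteq> b" "transpose a b \<in> N"
  shows "parity_map W W' False (opr id)"
proof -
  have "parity_map W W' True (opr (transpose a b))" using par [OF ab(4)] odd_transpose [OF ab(3)] by simp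
  then have "parity_map W W' (True \<noteq> True) (opr (transpose a b) * opr (transpose a b))"
    by (intro parity_map_mult)
  then show ?thesis unfolding opr_transpose_sq [OF ab(1,2)] by simp
qed

end

text \<open>
  An irreducible submodule \<open>E\<close> for the alternating group. For the basic spin module these are the
  two summands, the half-spin modules of the quadratic space; \<open>D\<close> need not be the sum of \<open>E\<close> and
  its odd translate.
\<close>
locale half_spin = spin_module s \<rho> D n
  for s :: "'f::alg_closed_field \<Rightarrow> 'v::ab_group_add \<Rightarrow> 'v" and \<rho> D n +
  fixes E :: "'v set"
  assumes E_D: "E \<subseteq> D"
    and irreducible_E: "irreducible_module s {p. p permutes {1..n} \<and> evenperm p} \<rho> E"
begin

lemma subspace_E: "vs.subspace E"
  using irreducible_E by (simp add: irreducible_module_def perm_module_def)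

lemma E_closed: "g permutes {1..n} \<Longrightarrow> evenperm g \<Longrightarrow> x \<in> E \<Longrightarrow> \<rho> g x \<in> E"
  using irreducible_E by (auto simp: irreducible_module_def perm_module_def)

lemma E_nonzero: "\<exists>x\<in>E. x \<noteq> 0"
  using irreducible_E subspace_E vs.subspace_0 by (auto simp: irreducible_module_def)

lemma E_irreducible:
  assumes "vs.subspace W" "W \<subseteq> E"
    and "\<And>g x. g permutes {1..n} \<Longrightarrow> evenperm g \<Longrightarrow> x \<in> W \<Longrightarrow> \<rho> g x \<in> W"
  shows "W = {0} \<or> W = E"
  using irreducible_E assms by (auto simp: irreducible_module_def perm_submodule_def)

lemma perm_module_restrict:
  assumes "H \<subseteq> {p. p permutes {1..n} \<and> evenperm p}"
  shows "perm_module s H \<rho> E"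
proof -
  have "perm_module s {p. p permutes {1..n} \<and> evenperm p} \<rho> E"
    using irreducible_E by (simp add: irreducible_module_def)
  then show ?thesis unfolding perm_module_def using assms by (meson subsetD)
qed

text \<open>
  The condition is that the elements \<open>gen i + gen p\<close>, which are transpositions for \<open>i \<noteq> p\<close>, exchange
  every subspace of \<open>E\<close> invariant under the even part of \<open>N\<close> and its odd translate. Then all
  transpositions do, and the subspace is invariant under the whole alternating group.
\<close>
lemma irreducible_restrictI:
  assumes N: "\<And>g. g \<in> N \<Longrightarrow> g permutes {1..n}" "\<And>g h. g \<in> N \<Longrightarrow> h \<in> N \<Longrightarrow> g \<circ> h \<in> N"
    and ab: "a \<in> {1..n}" "b \<in> {1..n}" "a \<noteq> b" "transpose a b \<in> N"
    and key: "\<And>W W'. vs.subspace W \<Longrightarrow> W \<subseteq> E \<Longrightarrow> W' = app (opr (transpose a b)) ` W \<Longrightarrow>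
       add_closed W \<Longrightarrow> add_closed W' \<Longrightarrow>
       (\<And>g. g \<in> N \<Longrightarrow> parity_map W W' (\<not> evenperm g) (opr g)) \<Longrightarrow>
       (\<And>i. i \<in> {1..n} \<Longrightarrow> parity_map W W' True (gen i + gen p))"
  shows "irreducible_module s (N \<inter> {p. evenperm p}) \<rho> E"
proof -
  have "W = {0} \<or> W = E" if W: "perm_submodule s (N \<inter> {p. evenperm p}) \<rho> E W" for W
  proof -
    have sub: "vs.subspace W" "W \<subseteq> E" using W by (auto simp: perm_submodule_def)
    have inv: "\<rho> g x \<in> W" if "g \<in> N" "evenperm g" "x \<in> W" for g x
      using W that by (auto simp: perm_submodule_def)
    define W' where "W' = app (opr (transpose a b)) ` W"
    have ac: "add_closed W" "add_closed W'"
      using sub by (simp_all add: W'_def add_closed_subspace add_closed_image)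
    have "parity_map W W' (\<not> evenperm g) (opr g)" if "g \<in> N" for g
      unfolding W'_def using parity_map_opr [OF N ab _ inv that] sub(2) E_D by blast
    then have gen: "parity_map W W' True (gen i + gen p)" if "i \<in> {1..n}" for i
      using key [OF sub W'_def ac] that by blast
    have tr: "parity_map W W' True (opr (transpose i j))"
      if "i \<in> {1..n}" "j \<in> {1..n}" "i \<noteq> j" for i j
    proof -
      have "gen i + gen j = (gen i + gen p) + (gen j + gen p)" by (simp add: char2_simps)
      then show ?thesis using that gen ac by (metis gen_add parity_map_add)
    qed
    have all: "parity_map W W' (\<not> evenperm g) (opr g)" if "g permutes {1..n}" for g
      using that finite_atLeastAtMost
    proof (induction g rule: permutes_induct)
      case id
      have [unfolded id_def]: "app (opr id) x = x" if "x \<in> W \<union> W'" for x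
      proof -
        have "app (opr (transpose a b)) y \<in> D" if "y \<in> D" for y
          using that ab N by (simp add: app_opr rho_closed)
        then have "x \<in> D" using that sub(2) E_D by (auto simp: W'_def)
        then show ?thesis by (simp add: opr_id_app proj)
      qed
      then show ?case by (simp add: parity_map_def evenperm_id id_def)
    next
      case (swap c d h)
      have "opr (transpose c d \<circ> h) = opr (transpose c d) * opr h"
        using swap by (simp only: opr_comp transpose_permutes)
      moreover have "evenperm (transpose c d \<circ> h) \<longleftrightarrow> \<not> evenperm h"
        using swap by (simp add: evenperm_mult transpose_permutes odd_transpose
             del: atLeastAtMost_iff One_nat_def)
      ultimately show ?case
        using parity_map_mult [OF tr [OF swap.hyps(1-3)] swap.IH] by (simp add: o_def)
    qed
    have "\<rho> g x \<in> W" if "g permutes {1..n}" "evenperm g" "x \<in> W" for g x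
      using all [OF that(1)] that sub(2) E_D by (auto simp: parity_map_def app_opr subset_iff)
    then show ?thesis using E_irreducible sub by blast
  qed
  moreover have "perm_module s (N \<inter> {p. evenperm p}) \<rho> E"
    by (rule perm_module_restrict) (use N in blast)
  ultimately show ?thesis
    using E_nonzero by (auto simp: irreducible_module_def)
qed

lemma parity_map_E:
  assumes "a \<in> {1..n}" "b \<in> {1..n}" "a \<noteq> b" "g permutes {1..n}"
  shows "parity_map E (app (opr (transpose a b)) ` E) (\<not> evenperm g) (opr g)"
  using assms E_closed E_D
  by (intro parity_map_opr [where N = "{p. p permutes {1..n}}"])
     (auto simp: permutes_compose transpose_permutes simp del: atLeastAtMost_iff One_nat_def)

lemma add_closed_E: "add_closed E" "add_closed (app r ` E)"
  using subspace_E by (simp_all add: add_closed_subspace add_closed_image)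

lemma parity_map_gen:
  assumes "a \<in> {1..n}" "b \<in> {1..n}" "a \<noteq> b" "i \<in> {1..n}" "j \<in> {1..n}"
  shows "parity_map E (app (opr (transpose a b)) ` E) True (gen i + gen j)"
  by (rule parity_map_transposition [where N = "{p. p permutes {1..n}}"])
    (use assms parity_map_E add_closed_E transpose_permutes in \<open>simp_all del: atLeastAtMost_iff One_nat_def\<close>)

text \<open>
  Vectors of sets of size divisible by four square to zero, and they commute if the intersections
  are even. A nonzero vector killed by all of them is found by applying them one after the other,
  skipping those that kill the current vector. The result lies in \<open>E\<close> or in its odd translate, and
  in the latter case the transposition, which permutes the family, moves it back to \<open>E\<close>.
\<close>
lemma common_kernel:
  assumes fin: "finite F" and ab: "a \<in> {1..n}" "b \<in> {1..n}" "a \<noteq> b"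
    and F: "\<And>S. S \<in> F \<Longrightarrow> S \<subseteq> {1..n} \<and> 4 dvd card S"
    and even: "\<And>S T. S \<in> F \<Longrightarrow> T \<in> F \<Longrightarrow> even (card (S \<inter> T))"
    and stable: "\<And>S. S \<in> F \<Longrightarrow> transpose a b ` S \<in> F"
  shows "\<exists>x\<in>E. x \<noteq> 0 \<and> (\<forall>S\<in>F. app (vec S) x = 0)"
proof -
  let ?t = "transpose a b"
  have evc: "even (card S)" "finite S" "S \<subseteq> {1..n}" "vec S * vec S = 0" if "S \<in> F" for S
  proof -
    show S: "even (card S)" "finite S" "S \<subseteq> {1..n}" using F [OF that] finite_subset
      by (auto elim: dvd_trans [rotated])
    have "even (card S div 2)" using F [OF that] by auto
    then show "vec S * vec S = 0" using vec_sq S by simp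
  qed
  have "\<exists>x\<in>E \<union> app (opr ?t) ` E. x \<noteq> 0 \<and> (\<forall>S\<in>F'. app (vec S) x = 0)" if "F' \<subseteq> F" for F'
    using finite_subset [OF that fin] that
  proof (induction F' rule: finite_induct)
    case empty
    then show ?case using E_nonzero by auto
  next
    case (insert S F')
    then obtain x where x: "x \<in> E \<union> app (opr ?t) ` E" "x \<noteq> 0" "\<forall>T\<in>F'. app (vec T) x = 0" by auto
    show ?case
    proof (cases "app (vec S) x = 0")
      case True
      then show ?thesis using x by auto
    next
      case False
      have S: "S \<in> F" using insert by simp
      have "parity_map E (app (opr ?t) ` E) True (vec S)"
        using ab S evc [OF S]
        by (intro parity_map_vec [of _ _ _ _ a] parity_map_gen) (auto simp: add_closed_E)
      then have "app (vec S) x \<in> E \<union> app (opr ?t) ` E" using x by (auto simp: parity_map_def)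
      moreover have "app (vec S) (app (vec S) x) = 0"
        using evc [OF S] by (simp add: app_times [symmetric])
      moreover have "app (vec T) (app (vec S) x) = 0" if T: "T \<in> F'" for T
      proof -
        have TF: "T \<in> F" using T insert by auto
        have "vec T * vec S + vec S * vec T = 0"
          using vec_comm [of T S] evc [OF S] evc [OF TF] even [OF TF S] by auto
        then have "vec T * vec S = vec S * vec T" by (rule eqI_add_zero)
        then have "app (vec T) (app (vec S) x) = app (vec S) (app (vec T) x)"
          by (simp add: app_times [symmetric])
        then show ?thesis using x T by simp
      qed
      ultimately show ?thesis using False by auto
    qed
  qed
  then obtain x where x: "x \<in> E \<union> app (opr ?t) ` E" "x \<noteq> 0" "\<forall>S\<in>F. app (vec S) x = 0" by blast
  show ?thesis
  proof (cases "x \<in> E")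
    case True
    then show ?thesis using x by auto
  next
    case False
    then obtain y where y: "y \<in> E" "x = app (opr ?t) y" using x by auto
    have "y \<noteq> 0" using x y by auto
    moreover have "app (vec S) y = 0" if S: "S \<in> F" for S
    proof -
      have tp: "?t permutes {1..n}" using ab transpose_permutes by blast
      have "opr ?t * vec S = vec (?t ` S) * opr ?t" using opr_vec tp evc [OF S] by blast
      then have "app (opr ?t) (app (vec S) y) = app (vec (?t ` S)) x"
        by (metis app_times y(2))
      also have "\<dots> = 0" using x stable S by blast
      finally have "app (opr ?t) (app (opr ?t) (app (vec S) y)) = 0" by simp
      moreover have "app (vec S) y \<in> D" using linop_vec [OF evc(3) [OF S]] y E_D by (auto simp: linop_def)
      ultimately show ?thesis using app_opr_sq ab by metis
    qed
    ultimately show ?thesis using y by auto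
  qed
qed

lemma linop_kernel_subspace:
  assumes "\<And>r. r \<in> A \<Longrightarrow> linop r"
  shows "vs.subspace {x \<in> E. \<forall>r\<in>A. app r x = 0}"
proof (rule vs.subspaceI)
  show "0 \<in> {x \<in> E. \<forall>r\<in>A. app r x = 0}" using subspace_E by (simp add: vs.subspace_0)
  fix x y c assume x: "x \<in> {x \<in> E. \<forall>r\<in>A. app r x = 0}"
  have "app r (s c x) = s c (app r x)" if "r \<in> A" for r
    using assms [OF that] x E_D by (auto simp: linop_def)
  then show "s c x \<in> {x \<in> E. \<forall>r\<in>A. app r x = 0}"
    using x subspace_E by (simp add: vs.subspace_scale)
  assume "y \<in> {x \<in> E. \<forall>r\<in>A. app r x = 0}"
  then show "x + y \<in> {x \<in> E. \<forall>r\<in>A. app r x = 0}"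
    using x subspace_E by (simp add: vs.subspace_add app_add)
qed

text \<open>
  The common kernel of the family is not all of \<open>E\<close>: for \<open>i, k \<in> S\<close> and \<open>j \<notin> S\<close>, if \<open>v\<^sub>S\<close> kills \<open>x\<close>
  and its image under the even element \<open>(i j) (i k)\<close>, then \<open>v\<^sub>S (i j) = (i j) v\<^sub>S + 1\<close> and
  \<open>v\<^sub>S (i k) = (i k) v\<^sub>S\<close> give \<open>(i k) x = 0\<close>.
\<close>
lemma reducible_restrictI:
  assumes G: "G \<subseteq> {p. p permutes {1..n} \<and> evenperm p}"
    and fin: "finite F" "F \<noteq> {}" and ab: "a \<in> {1..n}" "b \<in> {1..n}" "a \<noteq> b"
    and F: "\<And>S. S \<in> F \<Longrightarrow> S \<subseteq> {1..n} \<and> 4 dvd card S \<and> S \<noteq> {} \<and> S \<noteq> {1..n}"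
    and even: "\<And>S T. S \<in> F \<Longrightarrow> T \<in> F \<Longrightarrow> even (card (S \<inter> T))"
    and stable: "\<And>S. S \<in> F \<Longrightarrow> transpose a b ` S \<in> F"
    and stableG: "\<And>g S. g \<in> G \<Longrightarrow> S \<in> F \<Longrightarrow> g ` S \<in> F"
  shows "\<not> irreducible_module s G \<rho> E"
proof
  assume irr: "irreducible_module s G \<rho> E"
  define K where "K = {x \<in> E. \<forall>r\<in>vec ` F. app r x = 0}"
  have evc: "even (card S)" "finite S" "S \<subseteq> {1..n}" if "S \<in> F" for S
    using F [OF that] finite_subset by (auto elim: dvd_trans [rotated])
  have "perm_submodule s G \<rho> E K"
    unfolding perm_submodule_def
  proof (intro conjI ballI subsetI)
    show "vs.subspace K" unfolding K_def
      by (rule linop_kernel_subspace) (use F linop_vec in auto)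
    show "x \<in> E" if "x \<in> K" for x using that by (simp add: K_def)
    fix g y assume g: "g \<in> G" and "y \<in> \<rho> g ` K"
    then obtain x where x: "x \<in> K" "y = \<rho> g x" by auto
    have gp: "g permutes {1..n}" "evenperm g" using G g by auto
    have xD: "x \<in> D" using x E_D by (auto simp: K_def)
    have "y \<in> E" using gp E_closed x by (auto simp: K_def)
    moreover have "app (vec S) y = 0" if S: "S \<in> F" for S
    proof -
      have "inj_on ((`) g) F"
        using permutes_inj [OF gp(1)] by (auto simp: inj_on_def inj_image_eq_iff)
      then have "(`) g ` F = F" using fin stableG g by (intro endo_inj_surj) auto
      then obtain T where T: "T \<in> F" "S = g ` T" using S by (metis imageE)
      have "opr g * vec T = vec S * opr g" using opr_vec gp evc [OF T(1)] T by blast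
      then have "app (vec S) (app (opr g) x) = app (opr g) (app (vec T) x)"
        by (simp add: app_times [symmetric])
      also have "\<dots> = 0" using x T by (simp add: K_def)
      finally show ?thesis using x xD gp by (simp add: app_opr)
    qed
    ultimately show "y \<in> K" by (simp add: K_def)
  qed
  then have "K = {0} \<or> K = E" using irr by (auto simp: irreducible_module_def)
  moreover have "K \<noteq> {0}"
    using common_kernel [OF fin(1) ab _ even stable] F by (auto simp: K_def)
  moreover have "K \<noteq> E"
  proof
    assume KE: "K = E"
    obtain S where S: "S \<in> F" using fin by auto
    have "card S \<noteq> 0" using F [OF S] evc [OF S] by auto
    then have c4: "card S \<ge> 4" using F [OF S] by (auto dest: dvd_imp_le)
    obtain i where i: "i \<in> S" using F [OF S] by auto
    obtain j where j: "j \<in> {1..n}" "j \<notin> S" using F [OF S] by blast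
    obtain k where k: "k \<in> S" "k \<noteq> i"
    proof -
      have "card S \<noteq> 1" using c4 by simp
      then show ?thesis using that i by (metis is_singletonI' is_singleton_altdef empty_iff)
    qed
    let ?u = "vec {i, j}" and ?w = "vec {i, k}"
    have ij: "i \<noteq> j" "i \<in> {1..n}" "k \<in> {1..n}" using i j k F [OF S] by auto
    have "vec S * ?u + ?u * vec S = opr id"
      using vec_comm [of S "{i, j}"] i j ij evc [OF S] by auto
    then have vu: "vec S * ?u = ?u * vec S + opr id" by (metis char2_left add.commute)
    have "vec S * ?w + ?w * vec S = 0"
    proof -
      have "S \<inter> {i, k} = {i, k}" using i k by auto
      then show ?thesis using vec_comm [of S "{i, k}"] i k ij evc [OF S] by auto
    qed
    then have vw: "vec S * ?w = ?w * vec S" by (rule eqI_add_zero)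
    have u: "?u = opr (transpose i j)" "?w = opr (transpose i k)"
      using gen_add [of i j] gen_add [of i k] ij j k by (auto simp: vec_pair)
    obtain x where x: "x \<in> E" "x \<noteq> 0" using E_nonzero by auto
    have tp: "transpose i j permutes {1..n}" "transpose i k permutes {1..n}"
      using ij j transpose_permutes by blast+
    have "app (?u * ?w) x \<in> E"
    proof -
      have ev: "evenperm (transpose i j \<circ> transpose i k)"
        using tp ij k by (simp add: evenperm_mult odd_transpose)
      have "?u * ?w = opr (transpose i j \<circ> transpose i k)" using tp by (simp only: u opr_comp)
      then show ?thesis
        using E_closed [OF permutes_compose [OF tp(2,1)] ev x(1)] x E_D
          permutes_compose [OF tp(2,1)] by (auto simp: app_opr)
    qed
    then have "app (?u * ?w) x \<in> K" by (simp add: KE)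
    then have "app (vec S * (?u * ?w)) x = 0" using S by (auto simp: K_def app_times)
    also have "vec S * (?u * ?w) = ?u * ?w * vec S + ?w"
      using vu vw unital_opr [OF tp(2)]
    proof -
      have "vec S * (?u * ?w) = (?u * vec S + opr id) * ?w" by (simp only: mult.assoc [symmetric] vu)
      also have "\<dots> = ?u * (vec S * ?w) + opr id * ?w" by (simp only: distrib_right mult.assoc)
      also have "opr id * ?w = ?w" using unital_opr [OF tp(2)] by (simp only: u unital_def)
      finally show ?thesis by (simp only: vw mult.assoc)
    qed
    also have "app \<dots> x = app ?w x"
    proof -
      have "x \<in> K" using x KE by simp
      then have "app (vec S) x = 0" using S by (simp add: K_def)
      then show ?thesis by (simp add: app_plus app_times)
    qed
    finally have "app ?w (app ?w x) = 0" by simp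
    then show False using app_opr_sq [of i k x] ij x E_D by (auto simp: u)
  qed
  ultimately show False by blast
qed

text \<open>
  When four divides \<open>n\<close>, the all-one vector squares to zero and commutes with all permutations, so
  its kernel in \<open>E\<close> is a nonzero submodule.
\<close>
lemma vec_all_zero:
  assumes n4: "4 dvd n" and ab: "a \<in> {1..n}" "b \<in> {1..n}" "a \<noteq> b"
    and x: "x \<in> E \<union> app (opr (transpose a b)) ` E"
  shows "app (vec {1..n}) x = 0"
proof -
  let ?t = "transpose a b"
  define K where "K = {x \<in> E. \<forall>r\<in>{vec {1..n}}. app r x = 0}"
  have comm: "opr g * vec {1..n} = vec {1..n} * opr g" if "g permutes {1..n}" for g
    using opr_vec [OF that, of "{1..n}"] n4 permutes_image [OF that] by (auto elim: dvd_trans [rotated])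
  have tp: "?t permutes {1..n}" using ab transpose_permutes by blast
  have "\<exists>x\<in>E. x \<noteq> 0 \<and> (\<forall>S\<in>{{1..n}}. app (vec S) x = 0)"
    by (rule common_kernel [OF _ ab]) (use n4 permutes_image [OF tp] in \<open>auto elim: dvd_trans [rotated]\<close>)
  then have "K \<noteq> {0}" by (auto simp: K_def)
  moreover have "K = {0} \<or> K = E"
  proof (rule E_irreducible)
    show "vs.subspace K" unfolding K_def by (rule linop_kernel_subspace) (use linop_vec in auto)
    show "K \<subseteq> E" by (auto simp: K_def)
    fix g x assume g: "g permutes {1..n}" "evenperm g" and x: "x \<in> K"
    have "app (vec {1..n}) (app (opr g) x) = app (opr g) (app (vec {1..n}) x)"
      using comm [OF g(1)] by (simp add: app_times [symmetric])
    then show "\<rho> g x \<in> K" using x g E_closed E_D by (auto simp: K_def app_opr)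
  qed
  ultimately have KE: "K = E" by blast
  have E: "app (vec {1..n}) y = 0" if "y \<in> E" for y
  proof -
    have "y \<in> K" using that KE by simp
    then show ?thesis by (simp add: K_def)
  qed
  moreover have "app (vec {1..n}) (app (opr ?t) y) = 0" if "y \<in> E" for y
    using comm [OF tp] E [OF that] by (metis app_times app_zero)
  ultimately show ?thesis using x by auto
qed

text \<open>
  An element \<open>z\<close> with \<open>z t = t z + t\<close> for transpositions \<open>t\<close> commutes with the alternating group. It
  satisfies a quadratic equation, so it has an eigenvector in \<open>E\<close> and acts on \<open>E\<close> by a scalar \<open>c\<close>; on
  the odd translate it acts by \<open>c + 1\<close>.
\<close>
lemma scalar_action:
  assumes ab: "a \<in> {1..n}" "b \<in> {1..n}" "a \<noteq> b"
    and lin: "linop z" and quad: "z * z + z \<in> {0, opr id}"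
    and even: "parity_map E (app (opr (transpose a b)) ` E) False z"
    and comm: "\<And>i j x. i \<in> {1..n} \<Longrightarrow> j \<in> {1..n} \<Longrightarrow> i \<noteq> j \<Longrightarrow> x \<in> E \<union> app (opr (transpose a b)) ` E \<Longrightarrow>
      app (z * opr (transpose i j)) x = app (opr (transpose i j) * z + opr (transpose i j)) x"
  shows "\<exists>c. \<forall>x\<in>E. app z x = s c x \<and>
     app z (app (opr (transpose a b)) x) = app (opr (transpose a b)) (s (c + 1) x)"
proof -
  let ?t = "transpose a b"
  obtain d :: 'f where d: "\<And>x. x \<in> D \<Longrightarrow> app z (app z x) + app z x = s d x"
  proof (cases "z * z + z = 0")
    case True
    then have "\<And>x. app z (app z x) + app z x = s 0 x" by (metis app_plus app_times app_zero_additive vs.scale_zero_left)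
    then show ?thesis using that by blast
  next
    case False
    then have "z * z + z = opr id" using quad by auto
    then have "\<And>x. x \<in> D \<Longrightarrow> app z (app z x) + app z x = s 1 x"
      by (metis app_plus app_times opr_id_app proj(3) vs.scale_one)
    then show ?thesis using that by blast
  qed
  \<comment> \<open>On \<open>D\<close> the operator \<open>z\<close> is annihilated by \<open>(z + r) (z + r + 1)\<close>.\<close>
  obtain r where "poly [:d, 1, 1:] r = 0"
    using alg_closed_imp_poly_has_root [of "[:d, 1, 1:]"] by auto
  then have "d + (r + 1) * r = 0" by (simp add: algebra_simps)
  moreover have "u + u = 0" for u :: 'f using two_eq_0 by (metis mult_2 mult_zero_left one_add_one)
  ultimately have dr: "d = (r + 1) * r" by (metis add.commute add_left_cancel)
  have ED: "x \<in> D" if "x \<in> E" for x using that E_D by auto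
  have zE: "app z x \<in> E" if "x \<in> E" for x using even that by (auto simp: parity_map_def)
  obtain x where x: "x \<in> E" "x \<noteq> 0" using E_nonzero by auto
  define y where "y = app z x + s r x"
  have zr: "app z (s r u) = s r (app z u)" if "u \<in> E" for r u
    using lin that ED by (auto simp: linop_def)
  have "app z y = s (r + 1) y"
  proof -
    have "app z y = app z (app z x) + s r (app z x)" by (simp add: y_def app_add zr x)
    also have "app z (app z x) = app z x + s d x"
      using d [OF ED [OF x(1)]] vec_char2 by (metis add.assoc add.commute add_0)
    finally show ?thesis
      by (simp add: y_def dr vs.scale_right_distrib vs.scale_left_distrib add_ac)
  qed
  moreover have "y \<in> E" using x zE subspace_E by (simp add: y_def vs.subspace_add vs.subspace_scale)
  moreover have "app z x = s r x" if "y = 0"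
    using that vec_char2 [of "s r x"] by (metis y_def add_right_cancel)
  ultimately obtain c u where u: "u \<in> E" "u \<noteq> 0" "app z u = s c u" using x by metis
  define K where "K = {x \<in> E. app z x = s c x}"
  have g_comm: "x \<in> E \<Longrightarrow> app (z * opr g) x = app (opr g * z) x + (if evenperm g then 0 else app (opr g) x)"
    if "g permutes {1..n}" for g x
    using that finite_atLeastAtMost
  proof (induction g rule: permutes_induct)
    case id
    then have "app z x \<in> D" using zE ED by auto
    then show ?case using id ED by (simp add: app_times opr_id_app [unfolded id_def] proj evenperm_id id_def)
  next
    case (swap i j h)
    have hx: "app (opr h) x \<in> E \<union> app (opr ?t) ` E"
      using parity_map_E [OF ab swap.hyps(4)] swap.prems by (auto simp: parity_map_def split: if_splits)
    have "opr (transpose i j \<circ> h) = opr (transpose i j) * opr h"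
      using swap.hyps by (simp only: opr_comp transpose_permutes)
    moreover have "evenperm (transpose i j \<circ> h) \<longleftrightarrow> \<not> evenperm h"
      using swap by (simp add: evenperm_mult transpose_permutes odd_transpose
           del: atLeastAtMost_iff One_nat_def)
    ultimately show ?case
      using comm [OF swap.hyps(1-3) hx] swap.IH swap.prems
      by (auto simp: app_times app_plus app_add add.assoc vec_char2 o_def)
  qed
  have "K = {0} \<or> K = E"
  proof (rule E_irreducible)
    show "vs.subspace K"
      using subspace_E by (auto simp: K_def vs.subspace_def app_add zr vs.scale_right_distrib mult.commute)
    show "K \<subseteq> E" by (auto simp: K_def)
    fix g x assume g: "g permutes {1..n}" "evenperm g" and x: "x \<in> K"
    have xE: "x \<in> E" "app z x = s c x" using x by (auto simp: K_def)
    have "app z (app (opr g) x) = app (opr g) (s c x)"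
      using g_comm [OF g(1) xE(1)] g xE by (simp add: app_times)
    also have "\<dots> = s c (app (opr g) x)"
      using linop_opr [OF g(1)] ED [OF xE(1)] by (auto simp: linop_def)
    finally show "\<rho> g x \<in> K" using xE g E_closed ED by (auto simp: K_def app_opr)
  qed
  then have KE: "K = E" using u by (auto simp: K_def)
  have "app z x = s c x \<and> app z (app (opr ?t) x) = app (opr ?t) (s (c + 1) x)" if x: "x \<in> E" for x
  proof -
    have "x \<in> K" using x KE by simp
    then have zx: "app z x = s c x" by (simp add: K_def)
    moreover have "app z (app (opr ?t) x) = app (opr ?t) (app z x) + app (opr ?t) x"
      using comm [OF ab, of x] x by (simp add: app_times app_plus)
    ultimately show ?thesis by (simp add: app_add vs.scale_left_distrib)
  qed
  then show ?thesis by blast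
qed

end

section \<open>The head of a two-row Specht module\<close>

lemma sum_involution_char2:
  fixes h :: "'b \<Rightarrow> 'f::ring_1"
  assumes "CHAR('f) = 2" and "finite A"
    and "\<And>x. x \<in> A \<Longrightarrow> \<phi> x \<in> A \<and> \<phi> (\<phi> x) = x \<and> \<phi> x \<noteq> x \<and> h (\<phi> x) = h x"
  shows "sum h A = 0"
  using assms(2,3)
proof (induction "card A" arbitrary: A rule: less_induct)
  case less
  show ?case
  proof (cases "A = {}")
    case False
    then obtain a where a: "a \<in> A" by auto
    have pa: "\<phi> a \<in> A" "\<phi> (\<phi> a) = a" "\<phi> a \<noteq> a" "h (\<phi> a) = h a" using less.prems(2) [OF a] by auto
    let ?B = "A - {a, \<phi> a}"
    have "card ?B < card A" using a less.prems(1) by (intro psubset_card_mono) auto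
    moreover have "\<phi> x \<in> ?B \<and> \<phi> (\<phi> x) = x \<and> \<phi> x \<noteq> x \<and> h (\<phi> x) = h x" if "x \<in> ?B" for x
      using less.prems(2) [of x] that pa by (metis DiffD1 DiffD2 DiffI insertCI insertE singletonD)
    ultimately have "sum h ?B = 0" using less.prems(1) by (intro less.hyps) auto
    moreover have "sum h A = sum h ?B + sum h {a, \<phi> a}"
      using a pa less.prems(1) by (intro sum.subset_diff) auto
    moreover have "h a + h a = 0"
      using of_nat_CHAR [where 'a = 'f] assms(1) by (metis mult_2 mult_zero_left of_nat_numeral)
    ultimately show ?thesis using pa by simp
  qed simp
qed

lemma vector_space_fun_scale: "vector_space (fun_scale :: 'f::field \<Rightarrow> ('x \<Rightarrow> 'f) \<Rightarrow> 'x \<Rightarrow> 'f)"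
  by unfold_locales (auto simp: fun_scale_def fun_eq_iff algebra_simps)

text \<open>Vector space facts for functions into the field, prefixed \<open>fs\<close>.\<close>
interpretation fs: vector_space "fun_scale :: 'f::field \<Rightarrow> ('x \<Rightarrow> 'f) \<Rightarrow> 'x \<Rightarrow> 'f"
  by (rule vector_space_fun_scale)

text \<open>
  Shapes \<open>(n - r, r)\<close> with \<open>n = 2 r + 1\<close> or \<open>n = 2 r + 2\<close>. A column has two entries for \<open>j < r\<close>, and one
  entry for \<open>r \<le> j < n - r\<close>.
\<close>
locale two_row =
  fixes n r :: nat
  assumes r_less: "2 * r < n" and r_large: "n < 2 * r + 3"
begin

abbreviation "la \<equiv> [n - r, r]"

lemma sum_list_la: "sum_list la = n" using r_less by simp

lemma diagram_la: "(i, j) \<in> diagram la \<longleftrightarrow> (i = 0 \<and> j < n - r) \<or> (i = 1 \<and> j < r)"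
  by (auto simp: diagram_def less_Suc_eq nth_Cons')

text \<open>The two-row tabloid with second row \<open>T\<close>.\<close>
definition enc :: "nat set \<Rightarrow> nat \<Rightarrow> nat set" where
  "enc T = (\<lambda>i. if i = 0 then {1..n} - T else if i = 1 then T else {})"

lemma enc_inject: "enc T = enc U \<longleftrightarrow> T = U"
  by (auto simp: enc_def fun_eq_iff dest: spec [of _ "1::nat"])

text \<open>
  The number modulo two of points of \<open>T\<close> in column \<open>j\<close> of \<open>t\<close>. As a function of \<open>T\<close> it is linear over
  the field with two elements.
\<close>
definition col_parity :: "(nat \<times> nat \<Rightarrow> nat) \<Rightarrow> nat \<Rightarrow> nat set \<Rightarrow> bool" where
  "col_parity t j T \<longleftrightarrow> (if j < r then (t (0, j) \<in> T) \<noteq> (t (1, j) \<in> T) else t (0, j) \<in> T)"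

text \<open>Sets with one point in every column of length two and none in the other columns.\<close>
definition transversals :: "(nat \<times> nat \<Rightarrow> nat) \<Rightarrow> nat set set" where
  "transversals t = {T. T \<subseteq> {1..n} \<and> (\<forall>j<n - r. col_parity t j T \<longleftrightarrow> j < r)}"

definition row2 :: "(nat \<times> nat \<Rightarrow> nat) \<Rightarrow> nat set" where
  "row2 t = (\<lambda>j. t (1, j)) ` {..<r}"

abbreviation tableau :: "(nat \<times> nat \<Rightarrow> nat) \<Rightarrow> bool" where
  "tableau t \<equiv> is_tableau la t"

lemma finite_transversals: "finite (transversals t)"
  by (rule finite_subset [of _ "Pow {1..n}"]) (auto simp: transversals_def)

lemma tableau_cell: "tableau t \<Longrightarrow> p \<in> {1..n} \<Longrightarrow>
    (\<exists>j<r. p = t (0, j) \<or> p = t (1, j)) \<or> (\<exists>j. r \<le> j \<and> j < n - r \<and> p = t (0, j))"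
proof -
  assume "tableau t" "p \<in> {1..n}"
  then have "p \<in> t ` diagram la" unfolding is_tableau_def bij_betw_def sum_list_la by simp
  then obtain i j where "(i, j) \<in> diagram la" "p = t (i, j)" by auto
  then show ?thesis unfolding diagram_la by (metis not_le)
qed

lemma tableau_inj: "tableau t \<Longrightarrow> (i, j) \<in> diagram la \<Longrightarrow> (i', j') \<in> diagram la \<Longrightarrow>
    t (i, j) = t (i', j') \<longleftrightarrow> i = i' \<and> j = j'"
  unfolding is_tableau_def bij_betw_def by (auto dest: inj_onD)

lemma tableau_range: "tableau t \<Longrightarrow> (i, j) \<in> diagram la \<Longrightarrow> t (i, j) \<in> {1..n}"
  unfolding is_tableau_def sum_list_la by (auto dest: bij_betwE)

lemma tableauI:
  assumes "inj_on t (diagram la)" and "t ` diagram la \<subseteq> {1..n}"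
  shows "tableau t"
proof -
  have "diagram la = Pair 0 ` {..<n - r} \<union> Pair 1 ` {..<r}" by (auto simp: diagram_la)
  moreover have "card (Pair (0::nat) ` {..<n - r} \<union> Pair 1 ` {..<r}) = (n - r) + r"
    by (subst card_Un_disjoint) (auto simp: card_image inj_on_def)
  ultimately have "card (t ` diagram la) = card {1..n}" using r_less card_image [OF assms(1)] by simp
  then have "t ` diagram la = {1..n}" using assms(2) by (intro card_subset_eq) auto
  then show ?thesis using assms(1) unfolding is_tableau_def bij_betw_def sum_list_la by simp
qed

lemma diagram_cells: "j < n - r \<Longrightarrow> (0, j) \<in> diagram la" "j < r \<Longrightarrow> (1, j) \<in> diagram la"
    "j < r \<Longrightarrow> (0, j) \<in> diagram la"
  using r_less by (auto simp: diagram_la)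

lemma tableau_compose: "tableau t \<Longrightarrow> g permutes {1..n} \<Longrightarrow> tableau (g \<circ> t)"
  unfolding is_tableau_def sum_list_la by (meson bij_betw_trans permutes_imp_bij)

lemma row2_transversal: "tableau t \<Longrightarrow> row2 t \<in> transversals t"
  using diagram_cells tableau_range [of t 1]
  by (auto simp: transversals_def col_parity_def row2_def tableau_inj image_iff)

lemma tabloid_enc: "tableau t \<Longrightarrow> tabloid la t = enc (row2 t)"
proof -
  assume t: "tableau t"
  have row: "{(i', j) \<in> diagram la. i' = i} =
     (if i = 0 then Pair 0 ` {..<n - r} else if i = 1 then Pair 1 ` {..<r} else {})" for i
    by (auto simp: diagram_la)
  have "t ` Pair 0 ` {..<n - r} = {1..n} - row2 t"
  proof -
    have "t ` diagram la = {1..n}" using t unfolding is_tableau_def bij_betw_def sum_list_la by simp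
    moreover have "diagram la = Pair 0 ` {..<n - r} \<union> Pair 1 ` {..<r}" by (auto simp: diagram_la)
    ultimately have un: "t ` Pair 0 ` {..<n - r} \<union> row2 t = {1..n}"
      by (simp add: image_Un row2_def image_image)
    have "t ` Pair 0 ` {..<n - r} \<inter> row2 t = {}"
      using t diagram_cells by (auto simp: row2_def tableau_inj)
    then show ?thesis using un by blast
  qed
  then show ?thesis by (auto simp: tabloid_def row enc_def fun_eq_iff row2_def image_image)
qed

lemma row2_compose: "row2 (g \<circ> t) = g ` row2 t"
  by (auto simp: row2_def)

lemma column_stabilizer_iff:
  "g \<in> column_stabilizer la t \<longleftrightarrow> g permutes {1..n} \<and>
     (\<forall>j<r. g ` {t (0, j), t (1, j)} = {t (0, j), t (1, j)}) \<and>
     (\<forall>j. r \<le> j \<and> j < n - r \<longrightarrow> g (t (0, j)) = t (0, j))"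
proof -
  have col: "{(i, j') \<in> diagram la. j' = j} = (if j < r then {(0, j), (1, j)}
      else if j < n - r then {(0, j)} else {})" for j
    using r_less by (auto simp: diagram_la)
  have "tableau_column la t j = (if j < r then {t (0, j), t (1, j)}
      else if j < n - r then {t (0, j)} else {})" for j
    by (auto simp: tableau_column_def col)
  moreover have "j < r \<Longrightarrow> j < n - r" for j using r_less by simp
  ultimately show ?thesis
    unfolding column_stabilizer_def sum_list_la sym_group_carrier
    by (auto simp: not_less)
qed

lemma column_swap_cases:
  assumes "g \<in> column_stabilizer la t" "j < r"
  shows "(g (t (0, j)) = t (0, j) \<and> g (t (1, j)) = t (1, j)) \<or>
     (g (t (0, j)) = t (1, j) \<and> g (t (1, j)) = t (0, j))"
proof -
  have "g ` {t (0, j), t (1, j)} = {t (0, j), t (1, j)}" using assms by (simp add: column_stabilizer_iff)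
  then show ?thesis by (simp add: doubleton_eq_iff)
qed

lemma finite_column_stabilizer: "finite (column_stabilizer la t)"
  by (rule finite_subset [OF _ finite_permutations [of "{1..n}"]]) (auto simp: column_stabilizer_iff)

lemma stabilizer_transversal:
  assumes g: "g \<in> column_stabilizer la t" and T: "T \<in> transversals t"
  shows "g ` T \<in> transversals t"
proof -
  have gp: "g permutes {1..n}" using g by (simp add: column_stabilizer_iff)
  note mem = inj_image_mem_iff [OF permutes_inj [OF gp]]
  have "g ` T \<subseteq> {1..n}" using T gp permutes_image [OF gp] by (auto simp: transversals_def)
  moreover have "col_parity t j (g ` T) \<longleftrightarrow> j < r" if j: "j < n - r" for j
  proof (cases "j < r")
    case True
    have "(t (0, j) \<in> T) \<noteq> (t (1, j) \<in> T)" using T True j by (auto simp: transversals_def col_parity_def)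
    then show ?thesis using column_swap_cases [OF g True] True mem
      by (metis col_parity_def)
  next
    case False
    have "g (t (0, j)) = t (0, j)" using g False j by (simp add: column_stabilizer_iff)
    then show ?thesis using T False j mem by (metis (mono_tags, lifting) transversals_def col_parity_def mem_Collect_eq)
  qed
  ultimately show ?thesis by (simp add: transversals_def)
qed

lemma stabilizer_eqI:
  assumes t: "tableau t" and g: "g \<in> column_stabilizer la t" and h: "h \<in> column_stabilizer la t"
    and T: "T \<in> transversals t" and eq: "g ` T = h ` T"
  shows "g = h"
proof
  fix p
  have gp: "g permutes {1..n}" "h permutes {1..n}" using g h by (simp_all add: column_stabilizer_iff)
  note mem = inj_image_mem_iff [OF permutes_inj [OF gp(1)]] inj_image_mem_iff [OF permutes_inj [OF gp(2)]]
  show "g p = h p"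
  proof (cases "p \<in> {1..n}")
    case True
    consider j where "j < r" "p = t (0, j) \<or> p = t (1, j)" | j where "r \<le> j" "j < n - r" "p = t (0, j)"
      using tableau_cell [OF t True] by blast
    then show ?thesis
    proof cases
      case (1 j)
      have "j < n - r" using 1 r_less by simp
      then have "(t (0, j) \<in> T) \<noteq> (t (1, j) \<in> T)" using T 1 by (auto simp: transversals_def col_parity_def)
      then show ?thesis
        using column_swap_cases [OF g 1(1)] column_swap_cases [OF h 1(1)] 1(2) mem eq by metis
    next
      case (2 j)
      then show ?thesis using g h by (simp add: column_stabilizer_iff)
    qed
  next
    case False
    then show ?thesis using gp by (simp add: permutes_not_in)
  qed
qed

lemma stabilizer_transitive:
  assumes t: "tableau t" and T: "T \<in> transversals t" and U: "U \<in> transversals t"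
  shows "\<exists>g\<in>column_stabilizer la t. g ` T = U"
proof -
  \<comment> \<open>The required permutation swaps the two entries of the columns on which \<open>T\<close> and \<open>U\<close> differ.\<close>
  define c where "c = inv_into (diagram la) t"
  define g where "g p = (if p \<in> {1..n} \<and> snd (c p) < r \<and> (p \<in> T) \<noteq> (p \<in> U)
      then t (1 - fst (c p), snd (c p)) else p)" for p
  have c: "c (t (i, j)) = (i, j)" if "(i, j) \<in> diagram la" for i j
    using t that by (simp add: c_def is_tableau_def bij_betw_def inv_into_f_f)
  have rn: "j < r \<Longrightarrow> j < n - r" for j using r_less by simp
  have par: "((t (0, j) \<in> T) \<noteq> (t (1, j) \<in> T)) \<and> ((t (0, j) \<in> U) \<noteq> (t (1, j) \<in> U))" if "j < r" for j
    using T U that rn [OF that] by (auto simp: transversals_def col_parity_def)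
  have single: "t (0, j) \<notin> T \<and> t (0, j) \<notin> U" if "r \<le> j" "j < n - r" for j
    using T U that by (auto simp: transversals_def col_parity_def)
  have g0: "g (t (0, j)) = (if (t (0, j) \<in> T) \<noteq> (t (0, j) \<in> U) then t (1, j) else t (0, j))" if "j < r" for j
    using tableau_range [OF t, of 0 j] c [of 0 j] diagram_cells(3) [OF that] that by (auto simp: g_def)
  have g1: "g (t (1, j)) = (if (t (1, j) \<in> T) \<noteq> (t (1, j) \<in> U) then t (0, j) else t (1, j))" if "j < r" for j
    using tableau_range [OF t, of 1 j] c [of 1 j] diagram_cells(2) [OF that] that by (auto simp: g_def)
  have g2: "g (t (0, j)) = t (0, j)" if "r \<le> j" "j < n - r" for j
    using c [of 0 j] diagram_cells(1) [OF that(2)] that by (auto simp: g_def)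
  have out: "g p = p" if "p \<notin> {1..n}" for p using that by (simp only: g_def if_False simp_thms)
  have inv: "g (g p) = p" for p
  proof (cases "p \<in> {1..n}")
    case True
    then consider j where "j < r" "p = t (0, j)" | j where "j < r" "p = t (1, j)"
      | j where "r \<le> j" "j < n - r" "p = t (0, j)"
      using tableau_cell [OF t] by blast
    then show ?thesis
    proof cases
      case (1 j)
      then show ?thesis using g0 [of j] g1 [of j] par [of j] by auto
    next
      case (2 j)
      then show ?thesis using g0 [of j] g1 [of j] par [of j] by auto
    qed (simp add: g2)
  qed (simp add: out)
  have TU: "(p \<in> T \<longrightarrow> g p \<in> U) \<and> (p \<in> U \<longrightarrow> g p \<in> T)" for p
  proof (cases "p \<in> {1..n}")
    case True
    then consider j where "j < r" "p = t (0, j)" | j where "j < r" "p = t (1, j)"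
      | j where "r \<le> j" "j < n - r" "p = t (0, j)"
      using tableau_cell [OF t] by blast
    then show ?thesis
    proof cases
      case (1 j)
      then show ?thesis using g0 [of j] par [of j] by auto
    next
      case (2 j)
      then show ?thesis using g1 [of j] par [of j] by auto
    qed (simp add: g2 single)
  next
    case False
    then show ?thesis using T U by (auto simp: transversals_def)
  qed
  have "bij g" using inv by (metis bijI' )
  then have gp: "g permutes {1..n}" using out by (auto simp: permutes_def bij_iff)
  have "g ` T = U"
  proof
    show "g ` T \<subseteq> U" using TU by auto
    show "U \<subseteq> g ` T"
    proof
      fix p assume "p \<in> U"
      then show "p \<in> g ` T" using TU inv by (intro image_eqI [of _ _ "g p"]) auto
    qed
  qed
  moreover have "g \<in> column_stabilizer la t"
  proof -
    have "g ` {t (0, j), t (1, j)} = {t (0, j), t (1, j)}" if "j < r" for j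
      using g0 [OF that] g1 [OF that] par [OF that] by auto
    then show ?thesis using gp g2 by (auto simp: column_stabilizer_iff)
  qed
  ultimately show ?thesis by blast
qed

text \<open>The column stabilizer acts simply transitively on the transversals.\<close>
lemma stabilizer_bij:
  assumes "tableau t" "T \<in> transversals t"
  shows "bij_betw (\<lambda>g. g ` T) (column_stabilizer la t) (transversals t)"
  using assms stabilizer_eqI stabilizer_transitive stabilizer_transversal
  by (auto simp: bij_betw_def inj_on_def image_iff) (metis)

lemma card_transversal: "tableau t \<Longrightarrow> T \<in> transversals t \<Longrightarrow> card T = r"
proof -
  assume t: "tableau t" and T: "T \<in> transversals t"
  obtain g where g: "g \<in> column_stabilizer la t" "g ` row2 t = T"
    using stabilizer_transitive [OF t row2_transversal [OF t] T] by blast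
  have "inj_on (\<lambda>j. t (1, j)) {..<r}" using t diagram_cells by (auto simp: inj_on_def tableau_inj)
  then have "card (row2 t) = r" by (simp add: row2_def card_image)
  moreover have "inj g" using g permutes_inj by (auto simp: column_stabilizer_iff)
  ultimately show ?thesis using g by (metis card_image inj_on_subset subset_UNIV)
qed

lemma transversals_compose:
  assumes g: "g permutes {1..n}"
  shows "g ` T \<in> transversals (g \<circ> t) \<longleftrightarrow> T \<in> transversals t"
proof -
  note mem = inj_image_mem_iff [OF permutes_inj [OF g]]
  have "g ` T \<subseteq> {1..n} \<longleftrightarrow> T \<subseteq> {1..n}"
    using permutes_in_image [OF g] by blast
  moreover have "col_parity (g \<circ> t) j (g ` T) = col_parity t j T" for j
    by (simp add: col_parity_def mem)
  ultimately show ?thesis by (simp add: transversals_def)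
qed

end

text \<open>Points are numbered from 1; intervals are kept in the form \<open>{1..n}\<close>.\<close>
declare One_nat_def [simp del]

lemma sum_fun_apply: "(sum F A) x = (\<Sum>g\<in>A. F g x)"
  by (induction A rule: infinite_finite_induct) auto

text \<open>
  If \<open>T\<close> and \<open>U\<close> have equal size and agree outside \<open>{i, j, k}\<close>, then one or all three of the
  transpositions carry \<open>T\<close> to \<open>U\<close>.
\<close>
lemma three_transpositions:
  assumes char: "CHAR('f::field) = 2" and fin: "finite T" "finite U" and card: "card T = card U"
    and d: "i \<noteq> j" "j \<noteq> k" "i \<noteq> k"
  shows "of_bool (transpose i j ` T = U) + of_bool (transpose j k ` T = U) +
     of_bool (transpose i k ` T = U) = (of_bool (T - {i, j, k} = U - {i, j, k}) :: 'f)"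
proof -
  let ?A = "{i, j, k}"
  have im: "transpose a b ` T = U \<longleftrightarrow> T - ?A = U - ?A \<and>
      (\<forall>x\<in>?A. transpose a b x \<in> T \<longleftrightarrow> x \<in> U)" if "a \<in> ?A" "b \<in> ?A" for a b
  proof -
    have mem: "x \<in> transpose a b ` T \<longleftrightarrow> transpose a b x \<in> T" for x
      by (metis image_eqI imageE transpose_involutory)
    have out: "transpose a b x = x" if "x \<notin> ?A" for x
      using that \<open>a \<in> ?A\<close> \<open>b \<in> ?A\<close> by (auto simp: transpose_def)
    have "transpose a b ` T = U \<longleftrightarrow> (\<forall>x. transpose a b x \<in> T \<longleftrightarrow> x \<in> U)" by (auto simp: mem set_eq_iff)
    also have "\<dots> \<longleftrightarrow> (\<forall>x. x \<notin> ?A \<longrightarrow> (x \<in> T \<longleftrightarrow> x \<in> U)) \<and> (\<forall>x\<in>?A. transpose a b x \<in> T \<longleftrightarrow> x \<in> U)"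
      using out by metis
    also have "(\<forall>x. x \<notin> ?A \<longrightarrow> (x \<in> T \<longleftrightarrow> x \<in> U)) \<longleftrightarrow> T - ?A = U - ?A" by blast
    finally show ?thesis .
  qed
  show ?thesis
  proof (cases "T - ?A = U - ?A")
    case False
    then show ?thesis using im [of i j] im [of j k] im [of i k] by simp
  next
    case True
    have cT: "card X = card (X - ?A) + (of_bool (i \<in> X) + of_bool (j \<in> X) + of_bool (k \<in> X))"
      if "finite X" for X
    proof -
      have "card X = card (X - ?A) + card (X \<inter> ?A)"
        using that by (metis card_Diff_subset_Int card_mono Diff_subset Int_lower1 add.commute
            card_Int_Diff finite_Int)
      also have "card (X \<inter> ?A) = (\<Sum>x\<in>?A. of_bool (x \<in> X))"
        by (simp add: sum.If_cases Int_commute of_bool_def)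
      finally show ?thesis using d by simp
    qed
    have "of_bool (i \<in> T) + of_bool (j \<in> T) + of_bool (k \<in> T) =
       (of_bool (i \<in> U) + of_bool (j \<in> U) + of_bool (k \<in> U) :: nat)"
      using cT [OF fin(1)] cT [OF fin(2)] card True by simp
    moreover have "(1::'f) + 1 = 0" using of_nat_CHAR [where 'a = 'f] by (simp add: char)
    moreover have "transpose i j ` T = U \<longleftrightarrow> (j \<in> T \<longleftrightarrow> i \<in> U) \<and> (i \<in> T \<longleftrightarrow> j \<in> U) \<and> (k \<in> T \<longleftrightarrow> k \<in> U)"
      "transpose j k ` T = U \<longleftrightarrow> (k \<in> T \<longleftrightarrow> j \<in> U) \<and> (j \<in> T \<longleftrightarrow> k \<in> U) \<and> (i \<in> T \<longleftrightarrow> i \<in> U)"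
      "transpose i k ` T = U \<longleftrightarrow> (k \<in> T \<longleftrightarrow> i \<in> U) \<and> (i \<in> T \<longleftrightarrow> k \<in> U) \<and> (j \<in> T \<longleftrightarrow> j \<in> U)"
      using im [of i j] im [of j k] im [of i k] True d by (simp_all add: conj_ac)
    ultimately show ?thesis using True
      by (cases "i \<in> T"; cases "j \<in> T"; cases "k \<in> T"; cases "i \<in> U"; cases "j \<in> U"; cases "k \<in> U")
        (simp_all)
  qed
qed

context two_row
begin

text \<open>For sets of size \<open>r\<close> the columns of length one impose no condition.\<close>
lemma transversal_shape:
  assumes t: "tableau t" and T: "T \<subseteq> {1..n}" "card T = r"
    and col: "\<And>j. j < r \<Longrightarrow> (t (0, j) \<in> T) \<noteq> (t (1, j) \<in> T)"
  shows "T \<in> transversals t"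
proof -
  define U where "U = {p \<in> T. \<exists>j<r. p = t (0, j) \<or> p = t (1, j)}"
  have "col_parity t j U \<longleftrightarrow> j < r" if j: "j < n - r" for j
  proof (cases "j < r")
    case True
    then show ?thesis using col [OF True] by (auto simp: col_parity_def U_def)
  next
    case False
    have "t (0, j) \<noteq> t (0, j') \<and> t (0, j) \<noteq> t (1, j')" if "j' < r" for j'
      using False j that t diagram_cells by (auto simp: tableau_inj)
    then show ?thesis using False by (auto simp: col_parity_def U_def)
  qed
  then have U: "U \<in> transversals t" using T by (auto simp: transversals_def U_def)
  moreover have "U = T"
  proof (rule card_subset_eq)
    show "finite T" using T finite_subset by blast
    show "card U = card T" using card_transversal [OF t U] T by simp
  qed (auto simp: U_def)
  ultimately show ?thesis by simp
qed

lemma stabilizer_inv: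
  assumes t: "tableau t" and g: "g \<in> column_stabilizer la t"
  shows "inv' g \<in> column_stabilizer la t"
proof -
  have gp: "g permutes {1..n}" using g by (simp add: column_stabilizer_iff)
  have "inv' g ` {t (0, j), t (1, j)} = {t (0, j), t (1, j)}" if "j < r" for j
    using g that permutes_inj [OF gp] by (metis column_stabilizer_iff image_inv_f_f)
  moreover have "inv' g (t (0, j)) = t (0, j)" if "r \<le> j" "j < n - r" for j
    using g that permutes_inj [OF gp] by (metis column_stabilizer_iff inv_f_f)
  ultimately show ?thesis using permutes_inv [OF gp] by (simp add: column_stabilizer_iff)
qed

lemma stabilizer_comp:
  "g \<in> column_stabilizer la t \<Longrightarrow> h \<in> column_stabilizer la t \<Longrightarrow> g \<circ> h \<in> column_stabilizer la t"
  unfolding column_stabilizer_iff image_comp [symmetric] by (simp add: permutes_compose)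

lemma stabilizer_swap:
  assumes t: "tableau t" and j: "j < r"
  shows "transpose (t (0, j)) (t (1, j)) \<in> column_stabilizer la t"
proof -
  let ?w = "transpose (t (0, j)) (t (1, j))"
  have "?w permutes {1..n}"
    using tableau_range [OF t diagram_cells(3) [OF j]] tableau_range [OF t diagram_cells(2) [OF j]]
    by (rule permutes_swap_id)
  moreover have "?w ` {t (0, j'), t (1, j')} = {t (0, j'), t (1, j')}" if "j' < r" for j'
    using j that t diagram_cells by (auto simp: transpose_def tableau_inj)
  moreover have "?w (t (0, j')) = t (0, j')" if "r \<le> j'" "j' < n - r" for j'
    using j that t diagram_cells by (auto simp: transpose_def tableau_inj)
  ultimately show ?thesis by (simp add: column_stabilizer_iff)
qed

lemma enc_image:
  assumes g: "g permutes {1..n}"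
  shows "(\<lambda>i. g ` enc T i) = enc (g ` T)"
proof -
  have "g ` ({1..n} - T) = {1..n} - g ` T"
    using permutes_image [OF g] permutes_inj [OF g] by (simp add: image_set_diff)
  then show ?thesis by (auto simp: enc_def fun_eq_iff)
qed

lemma action_enc: "g permutes {1..n} \<Longrightarrow> tabloid_action g f (enc T) = f (enc (inv' g ` T))"
  by (simp add: tabloid_action_def enc_image permutes_inv)

end

locale two_row_char2 = two_row n r for n r :: nat +
  fixes F :: "'f::field itself"
  assumes char: "CHAR('f) = 2"
begin

abbreviation poly_t :: "(nat \<times> nat \<Rightarrow> nat) \<Rightarrow> (nat \<Rightarrow> nat set) \<Rightarrow> 'f" where
  "poly_t t \<equiv> polytabloid la t"

lemma one_plus_one: "(1::'f) + 1 = 0"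
  using of_nat_CHAR [where 'a = 'f] by (simp add: char)

text \<open>Signs are trivial, and the polytabloid is the indicator function of the transversals.\<close>
lemma polytabloid_eq:
  assumes t: "tableau t"
  shows "poly_t t = (\<lambda>x. of_bool (x \<in> enc ` transversals t))"
proof
  fix x
  have sg: "of_int (sign g) = (1::'f)" for g :: "nat \<Rightarrow> nat"
    using one_plus_one by (auto simp: sign_def eq_neg_iff_add_eq_0 neg_eq_iff_add_eq_0)
  have "poly_t t x = (\<Sum>g\<in>column_stabilizer la t. of_bool (x = tabloid la (g \<circ> t)))"
    unfolding polytabloid_def by (simp add: sum_fun_apply fun_scale_def sg tabloid_vector_def)
  also have "\<dots> = (\<Sum>g\<in>column_stabilizer la t. of_bool (x = enc (g ` row2 t)))"
    using t by (intro sum.cong) (auto simp: tabloid_enc tableau_compose row2_compose column_stabilizer_iff)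
  also have "\<dots> = (\<Sum>T\<in>transversals t. of_bool (x = enc T))"
    using sum.reindex_bij_betw [OF stabilizer_bij [OF t row2_transversal [OF t]], of "\<lambda>T. of_bool (x = enc T)"]
    by simp
  also have "\<dots> = of_bool (x \<in> enc ` transversals t)"
  proof (cases "x \<in> enc ` transversals t")
    case True
    then obtain T where T: "T \<in> transversals t" "x = enc T" by auto
    have "(\<Sum>U\<in>transversals t. of_bool (x = enc U)) = (\<Sum>U\<in>transversals t. if U = T then 1 else (0::'f))"
      by (intro sum.cong) (auto simp: T enc_inject)
    then show ?thesis using True T finite_transversals by simp
  next
    case False
    then show ?thesis by (auto intro!: sum.neutral)
  qed
  finally show "poly_t t x = of_bool (x \<in> enc ` transversals t)" .
qed

lemma polytabloid_enc: "tableau t \<Longrightarrow> poly_t t (enc T) = of_bool (T \<in> transversals t)"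
  by (auto simp: polytabloid_eq enc_inject)

text \<open>Membership in the permutation module: functions vanishing outside the tabloids of the shape.\<close>
definition supported :: "((nat \<Rightarrow> nat set) \<Rightarrow> 'f) \<Rightarrow> bool" where
  "supported f \<longleftrightarrow> (\<forall>x. f x \<noteq> 0 \<longrightarrow> x \<in> enc ` {T. T \<subseteq> {1..n} \<and> card T = r})"

text \<open>The coefficient in the action of the column symmetrizer \<open>kappa\<close> below.\<close>
definition psi :: "(nat \<times> nat \<Rightarrow> nat) \<Rightarrow> ((nat \<Rightarrow> nat set) \<Rightarrow> 'f) \<Rightarrow> 'f" where
  "psi t f = (\<Sum>T\<in>transversals t. f (enc T))"

text \<open>The column symmetrizer of \<open>t\<close>; no signs are needed in characteristic two.\<close>
definition kappa :: "(nat \<times> nat \<Rightarrow> nat) \<Rightarrow> ((nat \<Rightarrow> nat set) \<Rightarrow> 'f) \<Rightarrow> (nat \<Rightarrow> nat set) \<Rightarrow> 'f" where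
  "kappa t f = (\<Sum>g\<in>column_stabilizer la t. tabloid_action g f)"

lemma supported_polytabloid: "tableau t \<Longrightarrow> supported (poly_t t)"
  using card_transversal [of t] by (auto simp: supported_def polytabloid_eq transversals_def)

text \<open>
  On the tabloid of a set that is no transversal the symmetrizer vanishes, since some swap of two
  entries in a column fixes the set and the terms cancel in pairs.
\<close>
lemma kappa_eq:
  assumes t: "tableau t" and f: "supported f"
  shows "kappa t f = fun_scale (psi t f) (poly_t t)"
proof
  fix x
  let ?C = "column_stabilizer la t"
  have k: "kappa t f x = (\<Sum>g\<in>?C. tabloid_action g f x)" by (simp add: kappa_def sum_fun_apply)
  have gp: "g permutes {1..n}" if "g \<in> ?C" for g using that by (simp add: column_stabilizer_iff)
  consider T where "T \<in> transversals t" "x = enc T"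
    | T where "T \<subseteq> {1..n}" "card T = r" "T \<notin> transversals t" "x = enc T"
    | "x \<notin> enc ` {T. T \<subseteq> {1..n} \<and> card T = r}" "x \<notin> enc ` transversals t"
    using card_transversal [OF t] by (auto simp: transversals_def)
  then show "kappa t f x = fun_scale (psi t f) (poly_t t) x"
  proof cases
    case (1 T)
    have "kappa t f x = (\<Sum>g\<in>?C. f (enc (inv' g ` T)))"
      unfolding k by (intro sum.cong) (auto simp: 1 action_enc gp)
    also have "\<dots> = (\<Sum>g\<in>?C. f (enc (g ` T)))"
    proof (rule sum.reindex_bij_betw [of inv' ?C ?C "\<lambda>g. f (enc (g ` T))"])
      show "bij_betw inv' ?C ?C"
        by (rule bij_betw_byWitness [where f' = inv'])
          (auto simp: stabilizer_inv [OF t] permutes_inv_inv [OF gp])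
    qed
    also have "\<dots> = psi t f" unfolding psi_def
      using sum.reindex_bij_betw [OF stabilizer_bij [OF t 1(1)], of "\<lambda>T. f (enc T)"] by simp
    finally show ?thesis using 1 t by (simp add: fun_scale_def polytabloid_enc)
  next
    case (2 T)
    obtain j where j: "j < r" "(t (0, j) \<in> T) = (t (1, j) \<in> T)"
      using transversal_shape [OF t 2(1,2)] 2(3) by blast
    let ?w = "transpose (t (0, j)) (t (1, j))"
    have w: "?w \<in> ?C" by (rule stabilizer_swap [OF t j(1)])
    have wT: "?w ` T = T" using j(2) by (rule transpose_image_eq)
    have ne: "t (0, j) \<noteq> t (1, j)" using j t diagram_cells by (auto simp: tableau_inj)
    have "kappa t f x = (\<Sum>g\<in>?C. f (enc (inv' g ` T)))"
      unfolding k by (intro sum.cong) (auto simp: 2 action_enc gp)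
    also have "\<dots> = 0"
    proof (rule sum_involution_char2 [OF char finite_column_stabilizer, where \<phi> = "\<lambda>g. ?w \<circ> g"])
      fix g assume g: "g \<in> ?C"
      have "inv' (?w \<circ> g) = inv' g \<circ> ?w"
        using gp [OF g] by (simp add: o_inv_distrib permutes_bij)
      then have "inv' (?w \<circ> g) ` T = inv' g ` T" by (metis image_comp wT)
      moreover have "?w \<circ> g \<noteq> g"
      proof
        assume "?w \<circ> g = g"
        then have "?w (g (inv' g (t (0, j)))) = g (inv' g (t (0, j)))" by (metis comp_apply)
        then show False using ne gp [OF g] by (simp add: permutes_inverses)
      qed
      ultimately show "?w \<circ> g \<in> ?C \<and> ?w \<circ> (?w \<circ> g) = g \<and> ?w \<circ> g \<noteq> g \<and>
         f (enc (inv' (?w \<circ> g) ` T)) = f (enc (inv' g ` T))"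
        using stabilizer_comp [OF w g] by (simp add: comp_assoc [symmetric])
    qed
    finally show ?thesis using 2 t by (simp add: fun_scale_def polytabloid_enc)
  next
    case 3
    have "tabloid_action g f x = 0" if g: "g \<in> ?C" for g
    proof (rule ccontr)
      assume "tabloid_action g f x \<noteq> 0"
      then obtain T where T: "T \<subseteq> {1..n}" "card T = r" "(\<lambda>i. inv' g ` x i) = enc T"
        using f by (auto simp: supported_def tabloid_action_def)
      have "x = (\<lambda>i. g ` (inv' g ` x i))"
        using gp [OF g] by (simp add: image_comp permutes_inv_o)
      also have "\<dots> = enc (g ` T)" using T(3) enc_image [OF gp [OF g], of T] by (metis (full_types))
      finally have "x = enc (g ` T)" .
      moreover have "g ` T \<subseteq> {1..n}" "card (g ` T) = r"
        using T gp [OF g] permutes_image [OF gp [OF g]]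
        by (auto simp: card_image inj_on_subset [OF permutes_inj [OF gp [OF g]]])
      ultimately show False using 3 by blast
    qed
    then show ?thesis using k 3 t by (simp add: fun_scale_def polytabloid_eq)
  qed
qed

lemma psi_add: "psi t (f + g) = psi t f + psi t g"
  by (simp add: psi_def sum.distrib)
lemma psi_scale: "psi t (fun_scale c f) = c * psi t f"
  by (simp add: psi_def fun_scale_def sum_distrib_left)

lemma psi_action:
  assumes g: "g permutes {1..n}"
  shows "psi t (tabloid_action g f) = psi (inv' g \<circ> t) f"
proof -
  have "bij_betw ((`) (inv' g)) (transversals t) (transversals (inv' g \<circ> t))"
  proof (rule bij_betw_byWitness [where f' = "(`) g"])
    show "(`) (inv' g) ` transversals t \<subseteq> transversals (inv' g \<circ> t)"
      using transversals_compose [OF permutes_inv [OF g]] by auto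
    have "g \<circ> (inv' g \<circ> t) = t" using g by (simp add: comp_assoc [symmetric] permutes_inv_o)
    then show "(`) g ` transversals (inv' g \<circ> t) \<subseteq> transversals t"
      using transversals_compose [OF g, of _ "inv' g \<circ> t"] by auto
  qed (use g in \<open>auto simp: image_comp permutes_inv_o\<close>)
  then show ?thesis unfolding psi_def
    using sum.reindex_bij_betw [of "(`) (inv' g)" _ _ "\<lambda>T. f (enc T)"] g by (simp add: action_enc)
qed

lemma action_polytabloid:
  assumes t: "tableau t" and g: "g permutes {1..n}"
  shows "tabloid_action g (poly_t t) = poly_t (g \<circ> t)"
proof
  fix x
  have "(\<lambda>i. inv' g ` x i) \<in> enc ` transversals t \<longleftrightarrow> x \<in> enc ` transversals (g \<circ> t)"
  proof
    assume "(\<lambda>i. inv' g ` x i) \<in> enc ` transversals t"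
    then obtain T where T: "T \<in> transversals t" "(\<lambda>i. inv' g ` x i) = enc T" by auto
    have "x = (\<lambda>i. g ` (inv' g ` x i))" using g by (simp add: image_comp permutes_inv_o)
    also have "\<dots> = enc (g ` T)" using T(2) enc_image [OF g, of T] by (metis (full_types))
    finally show "x \<in> enc ` transversals (g \<circ> t)" using transversals_compose [OF g] T by auto
  next
    assume "x \<in> enc ` transversals (g \<circ> t)"
    then obtain T where T: "T \<in> transversals (g \<circ> t)" "x = enc T" by auto
    have "(\<lambda>i. inv' g ` x i) = enc (inv' g ` T)" using enc_image [OF permutes_inv [OF g]] T by simp
    moreover have "inv' g \<circ> (g \<circ> t) = t" using g by (simp add: comp_assoc [symmetric] permutes_inv_o)
    moreover have "inv' g ` T \<in> transversals (inv' g \<circ> (g \<circ> t))"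
      using transversals_compose [OF permutes_inv [OF g]] T(1) by blast
    ultimately show "(\<lambda>i. inv' g ` x i) \<in> enc ` transversals t" by auto
  qed
  then show "tabloid_action g (poly_t t) x = poly_t (g \<circ> t) x"
    by (simp add: tabloid_action_def polytabloid_eq t tableau_compose g)
qed

text \<open>
  The columns of length two of \<open>s\<close> are \<open>{1, 2}, {3, 4}, \<dots>\<close> and those of \<open>t\<close> are \<open>{2, 3}, {4, 5}, \<dots>\<close>.
  Together they form a path from \<open>1\<close>, which lies in no transversal of \<open>t\<close>. So the set of even numbers
  up to \<open>2 r\<close> is the only common transversal.
\<close>
lemma psi_nonzero: "\<exists>t s. tableau t \<and> tableau s \<and> psi t (poly_t s) \<noteq> 0"
proof -
  define s where "s = (\<lambda>(i::nat, j). if j < r then 2 * j + 1 + i else r + j + 1)"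
  define t where "t = (\<lambda>(i::nat, j). if j < r then 2 * j + 3 - i else if j = r then 1 else r + j + 1)"
  have s: "tableau s"
  proof (rule tableauI)
    show "inj_on s (diagram la)"
      by (auto simp: inj_on_def s_def diagram_la split: if_splits) presburger+
    show "s ` diagram la \<subseteq> {1..n}" using r_less by (auto simp: s_def diagram_la)
  qed
  have t: "tableau t"
  proof (rule tableauI)
    show "inj_on t (diagram la)"
      by (auto simp: inj_on_def t_def diagram_la split: if_splits) presburger+
    show "t ` diagram la \<subseteq> {1..n}" using r_less by (auto simp: t_def diagram_la)
  qed
  define V where "V = (\<lambda>j. 2 * j + 2) ` {..<r}"
  have Vmem: "p \<in> V \<longleftrightarrow> even p \<and> 0 < p \<and> p \<le> 2 * r" for p
  proof
    assume "even p \<and> 0 < p \<and> p \<le> 2 * r"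
    then show "p \<in> V" unfolding V_def
      by (intro image_eqI [of _ _ "p div 2 - 1"]) (auto elim!: evenE)
  qed (auto simp: V_def)
  have "V \<in> transversals s" "V \<in> transversals t"
    using r_less unfolding transversals_def col_parity_def s_def t_def by (auto simp: Vmem)
  moreover have "T = V" if Ts: "T \<in> transversals s" and Tt: "T \<in> transversals t" for T
  proof -
    have s1: "(2 * j + 1 \<in> T) \<noteq> (2 * j + 2 \<in> T)" if "j < r" for j
      using Ts that r_less by (auto simp: transversals_def col_parity_def s_def dest!: spec [of _ j])
    have t1: "(2 * j + 3 \<in> T) \<noteq> (2 * j + 2 \<in> T)" if "j < r" for j
      using Tt that r_less by (auto simp: transversals_def col_parity_def t_def dest!: spec [of _ j])
    have t2: "1 \<notin> T"
      using Tt r_less by (auto simp: transversals_def col_parity_def t_def dest!: spec [of _ r])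
    have odd: "j \<le> r \<Longrightarrow> 2 * j + 1 \<notin> T" for j
    proof (induction j)
      case (Suc j)
      have "2 * Suc j + 1 = 2 * j + 3" by simp
      then show ?case using Suc s1 [of j] t1 [of j] by (metis Suc_leD Suc_le_lessD)
    qed (use t2 in simp)
    have even: "j < r \<Longrightarrow> 2 * j + 2 \<in> T" for j using odd [of j] s1 [of j] by simp
    have big: "p \<notin> T" if "p > 2 * r + 1" "p \<le> n" for p
    proof -
      have "t (0, p - r - 1) = p" "p - r - 1 < n - r" "\<not> p - r - 1 < r" using that by (auto simp: t_def)
      then show ?thesis using Tt unfolding transversals_def col_parity_def by (metis (mono_tags, lifting) mem_Collect_eq)
    qed
    have "p \<in> T \<longleftrightarrow> p \<in> V" if p: "p \<in> {1..n}" for p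
    proof -
      consider "p > 2 * r + 1" | "p \<le> 2 * r + 1" "odd p" | "p \<le> 2 * r + 1" "even p" by linarith
      then show ?thesis
      proof cases
        case 1
        then show ?thesis using big p by (auto simp: Vmem)
      next
        case 2
        then show ?thesis using odd [of "p div 2"] by (auto simp: Vmem elim!: oddE)
      next
        case 3
        then have "2 * (p div 2 - 1) + 2 = p" "p div 2 - 1 < r" using p by (auto elim!: evenE)
        then show ?thesis using even [of "p div 2 - 1"] 3 p by (auto simp: Vmem)
      qed
    qed
    moreover have "T \<subseteq> {1..n}" "V \<subseteq> {1..n}"
      using Ts \<open>V \<in> transversals s\<close> by (auto simp: transversals_def)
    ultimately show ?thesis by blast
  qed
  ultimately have "transversals t \<inter> transversals s = {V}" by blast
  moreover have "psi t (poly_t s) = (\<Sum>T\<in>transversals t. if T \<in> transversals s then 1 else 0)"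
    unfolding psi_def by (intro sum.cong) (auto simp: polytabloid_enc s)
  moreover have "\<dots> = of_nat (card (transversals t \<inter> transversals s))"
    using finite_transversals by (simp add: sum.If_cases Int_def)
  ultimately have "psi t (poly_t s) = 1" by simp
  then show ?thesis using s t by (metis one_neq_zero)
qed

text \<open>The action of the sum of the three transpositions of \<open>i\<close>, \<open>j\<close>, \<open>k\<close>.\<close>
definition theta :: "nat \<Rightarrow> nat \<Rightarrow> nat \<Rightarrow> ((nat \<Rightarrow> nat set) \<Rightarrow> 'f) \<Rightarrow> (nat \<Rightarrow> nat set) \<Rightarrow> 'f" where
  "theta i j k f = tabloid_action (transpose i j) f + tabloid_action (transpose j k) f +
     tabloid_action (transpose i k) f"

text \<open>
  The left-hand side counts modulo two the pairs of a transversal of \<open>t\<close> and a transversal of \<open>s\<close>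
  that agree outside \<open>{i, j, k}\<close>. Such pairs form the solution set of \<open>2 (n - r)\<close> inhomogeneous
  linear equations over the field with two elements in \<open>n + 3\<close> unknowns, and \<open>2 (n - r) < n + 3\<close>:
  translation by a nontrivial solution of the homogeneous system is an involution without fixed
  points.
\<close>
lemma psi_theta:
  assumes t: "tableau t" and s: "tableau s"
    and ijk: "i \<in> {1..n}" "j \<in> {1..n}" "k \<in> {1..n}" "i \<noteq> j" "j \<noteq> k" "i \<noteq> k"
  shows "psi t (theta i j k (poly_t s)) = 0"
proof -
  let ?A = "{i, j, k}"
  define P where "P = {(T, U). T \<in> transversals t \<and> U \<in> transversals s \<and> T - ?A = U - ?A}"
  have tr: "transpose a b permutes {1..n}" if "a \<in> ?A" "b \<in> ?A" for a b
    using that ijk by (intro permutes_swap_id) auto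
  have "theta i j k (poly_t s) (enc T) = (\<Sum>U\<in>transversals s. of_bool (T - ?A = U - ?A))"
    if T: "T \<in> transversals t" for T
  proof -
    have ft: "finite U" if "U \<subseteq> {1..n}" for U using that finite_subset by blast
    have one: "tabloid_action (transpose a b) (poly_t s) (enc T) =
        (\<Sum>U\<in>transversals s. of_bool (transpose a b ` T = U))" if "a \<in> ?A" "b \<in> ?A" for a b
    proof -
      have "tabloid_action (transpose a b) (poly_t s) (enc T) = of_bool (transpose a b ` T \<in> transversals s)"
        using tr [OF that] s by (simp add: action_enc polytabloid_enc)
      also have "\<dots> = (\<Sum>U\<in>transversals s. if transpose a b ` T = U then 1 else 0)"
        using finite_transversals by simp
      finally show ?thesis by (simp add: of_bool_def)
    qed
    have "theta i j k (poly_t s) (enc T) = (\<Sum>U\<in>transversals s. of_bool (transpose i j ` T = U) +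
        of_bool (transpose j k ` T = U) + of_bool (transpose i k ` T = U))"
      by (simp add: theta_def one sum.distrib)
    also have "\<dots> = (\<Sum>U\<in>transversals s. of_bool (T - ?A = U - ?A))"
    proof (rule sum.cong [OF refl])
      fix U assume U: "U \<in> transversals s"
      show "of_bool (transpose i j ` T = U) + of_bool (transpose j k ` T = U) +
          of_bool (transpose i k ` T = U) = (of_bool (T - ?A = U - ?A) :: 'f)"
        using card_transversal [OF t T] card_transversal [OF s U] T U ijk(4-6)
        by (intro three_transpositions char ft) (auto simp: transversals_def)
    qed
    finally show ?thesis .
  qed
  then have "psi t (theta i j k (poly_t s)) =
      (\<Sum>T\<in>transversals t. \<Sum>U\<in>transversals s. of_bool (T - ?A = U - ?A))"
    by (simp add: psi_def)
  also have "\<dots> = (\<Sum>x\<in>transversals t \<times> transversals s. of_bool (x \<in> P))"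
    unfolding sum.cartesian_product by (rule sum.cong [OF refl]) (clarsimp simp: P_def)
  also have "\<dots> = (\<Sum>x\<in>P. 1)"
  proof -
    have "P = transversals t \<times> transversals s \<inter> P" unfolding P_def by blast
    moreover have "(\<Sum>x\<in>transversals t \<times> transversals s. of_bool (x \<in> P)) =
        (\<Sum>x\<in>transversals t \<times> transversals s \<inter> P. 1::'f)"
      using finite_transversals by (subst sum.inter_restrict) (simp_all add: of_bool_def)
    ultimately show ?thesis by metis
  qed
  also have "\<dots> = 0"
  proof -
    \<comment> \<open>The homogeneous system: \<open>Q\<close> is the space of unknowns, \<open>h\<close> evaluates the equations.\<close>
    define Q where "Q = {(S, R). S \<subseteq> {1..n} \<and> R \<subseteq> {1..n} \<and> S - ?A = R - ?A}"
    define h where "h = (\<lambda>(S, R). ({l \<in> {..<n - r}. col_parity t l S}, {l \<in> {..<n - r}. col_parity s l R}))"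
    have finQ: "finite Q"
      by (rule finite_subset [of _ "Pow {1..n} \<times> Pow {1..n}"]) (auto simp: Q_def)
    have "card (h ` Q) \<le> card (Pow {..<n - r} \<times> Pow {..<n - r})"
      by (intro card_mono) (auto simp: h_def)
    also have "\<dots> = 2 ^ (2 * (n - r))" by (simp add: card_cartesian_product card_Pow power_add [symmetric] mult_2)
    also have "\<dots> < 2 ^ (n + 3)" using r_large r_less by (intro power_strict_increasing) auto
    also have "\<dots> = card (Pow {1..n} \<times> Pow ?A)"
      using ijk by (simp add: card_cartesian_product card_Pow power_add)
    also have "\<dots> \<le> card Q"
    proof (rule card_inj_on_le [of "\<lambda>(S, B). (S, (S - ?A) \<union> B)"])
      show "inj_on (\<lambda>(S, B). (S, (S - ?A) \<union> B)) (Pow {1..n} \<times> Pow ?A)"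
      proof (rule inj_onI)
        fix x y
        assume xy: "x \<in> Pow {1..n} \<times> Pow ?A" "y \<in> Pow {1..n} \<times> Pow ?A"
          and eq: "(case x of (S, B) \<Rightarrow> (S, S - ?A \<union> B)) = (case y of (S, B) \<Rightarrow> (S, S - ?A \<union> B))"
        obtain S B S' B' where p: "x = (S, B)" "y = (S', B')" by (metis surj_pair)
        have B: "B = (S - ?A \<union> B) \<inter> ?A" "B' = (S' - ?A \<union> B') \<inter> ?A" using xy p by blast+
        note SB = eq [unfolded p case_prod_conv prod.inject]
        have "S = S'" by (rule conjunct1 [OF SB])
        have eq': "S - ?A \<union> B = S' - ?A \<union> B'" by (rule conjunct2 [OF SB])
        have "B = (S' - ?A \<union> B') \<inter> ?A" by (rule trans [OF B(1)]) (simp only: eq')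
        then have "B = B'" by (rule trans [OF _ B(2) [symmetric]])
        then show "x = y" using \<open>S = S'\<close> p by simp
      qed
      show "(\<lambda>(S, B). (S, (S - ?A) \<union> B)) ` (Pow {1..n} \<times> Pow ?A) \<subseteq> Q"
      proof (rule image_subsetI)
        fix x assume xy: "x \<in> Pow {1..n} \<times> Pow ?A"
        obtain S B where p: "x = (S, B)" by (metis surj_pair)
        have "?A \<subseteq> {1..n}" using ijk(1-3) by blast
        then have "S \<subseteq> {1..n}" "S - ?A \<union> B \<subseteq> {1..n}" "S - ?A = (S - ?A \<union> B) - ?A" using xy p by blast+
        then show "(case x of (S, B) \<Rightarrow> (S, S - ?A \<union> B)) \<in> Q" unfolding Q_def p by simp
      qed
    qed (rule finQ)
    finally have "\<not> inj_on h Q" by (rule pigeonhole)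
    then obtain S R S' R' where SR: "(S, R) \<in> Q" "(S', R') \<in> Q" "(S, R) \<noteq> (S', R')" "h (S, R) = h (S', R')"
      by (auto simp: inj_on_def)
    define K L where "K = sym_diff S S'" and "L = sym_diff R R'"
    have KL: "K \<subseteq> {1..n}" "L \<subseteq> {1..n}" "K - ?A = L - ?A" "K \<noteq> {} \<or> L \<noteq> {}"
      using SR by (auto simp: K_def L_def Q_def)
    have Kt: "\<not> col_parity t l K" and Ls: "\<not> col_parity s l L" if "l < n - r" for l
    proof -
      have "col_parity t l S = col_parity t l S'" "col_parity s l R = col_parity s l R'"
        using SR(4) that by (auto simp: h_def)
      then show "\<not> col_parity t l K" "\<not> col_parity s l L"
        by (auto simp: col_parity_def K_def L_def split: if_splits)
    qed
    have shift: "sym_diff X Y \<in> transversals u"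
      if "X \<in> transversals u" "Y \<subseteq> {1..n}" "\<And>l. l < n - r \<Longrightarrow> \<not> col_parity u l Y" for u X Y
    proof -
      have "col_parity u l (sym_diff X Y) \<longleftrightarrow> l < r" if "l < n - r" for l
        using that \<open>X \<in> transversals u\<close> \<open>\<And>l. l < n - r \<Longrightarrow> \<not> col_parity u l Y\<close> [OF that]
        unfolding transversals_def col_parity_def by (auto split: if_splits)
      then show ?thesis using that by (auto simp: transversals_def)
    qed
    show ?thesis
    proof (rule sum_involution_char2 [OF char, where \<phi> = "\<lambda>(T, U). (sym_diff T K, sym_diff U L)"])
      show "finite P"
        by (rule finite_subset [OF _ finite_cartesian_product [OF finite_transversals finite_transversals]])
          (auto simp: P_def)
      fix x assume "x \<in> P"
      then obtain T U where x: "x = (T, U)" "T \<in> transversals t" "U \<in> transversals s" "T - ?A = U - ?A"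
        by (auto simp: P_def)
      have "sym_diff T K - ?A = sym_diff U L - ?A" using x(4) KL(3) by blast
      moreover have "sym_diff (sym_diff T K) K = T" "sym_diff (sym_diff U L) L = U" by auto
      moreover have "sym_diff T K \<noteq> T \<or> sym_diff U L \<noteq> U" using KL(4) by blast
      ultimately show "(case x of (T, U) \<Rightarrow> (sym_diff T K, sym_diff U L)) \<in> P \<and>
          (case case x of (T, U) \<Rightarrow> (sym_diff T K, sym_diff U L) of (T, U) \<Rightarrow> (sym_diff T K, sym_diff U L)) = x \<and>
          (case x of (T, U) \<Rightarrow> (sym_diff T K, sym_diff U L)) \<noteq> x \<and> (1::'f) = 1"
        using shift [OF x(2) KL(1) Kt] shift [OF x(3) KL(2) Ls] by (auto simp: x(1) P_def)
    qed
  qed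
  finally show ?thesis .
qed

abbreviation specht :: "((nat \<Rightarrow> nat set) \<Rightarrow> 'f) set" where "specht \<equiv> specht_module la"

lemma specht_subspace: "fs.subspace specht"
  unfolding specht_module_def by (rule fs.subspace_span)

lemma action_linear:
  "tabloid_action g (f + f') = tabloid_action g f + tabloid_action g f'"
  "tabloid_action g (fun_scale c f) = fun_scale c (tabloid_action g f)"
  "tabloid_action g 0 = 0"
  by (auto simp: tabloid_action_def fun_scale_def fun_eq_iff)

lemma specht_induct [consumes 1, case_names poly zero add scale]:
  assumes "f \<in> specht"
    and "\<And>t. tableau t \<Longrightarrow> P (poly_t t)" and "P 0"
    and "\<And>f g. P f \<Longrightarrow> P g \<Longrightarrow> P (f + g)" and "\<And>c f. P f \<Longrightarrow> P (fun_scale c f)"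
  shows "P f"
proof -
  have "fs.subspace {f. P f}" using assms(3-5) by (auto simp: fs.subspace_def)
  then have "fs.span {poly_t t |t. tableau t} \<subseteq> {f. P f}"
    using assms(2) by (intro fs.span_minimal) auto
  then show ?thesis using assms(1) unfolding specht_module_def by auto
qed

lemma polytabloid_specht: "tableau t \<Longrightarrow> poly_t t \<in> specht"
  unfolding specht_module_def by (rule fs.span_base) auto

lemma specht_action: "f \<in> specht \<Longrightarrow> g permutes {1..n} \<Longrightarrow> tabloid_action g f \<in> specht"
proof (induction f rule: specht_induct)
  case (poly t)
  then show ?case by (simp add: action_polytabloid polytabloid_specht tableau_compose)
next
  case zero
  then show ?case
    by (simp add: action_linear fs.subspace_0 [OF specht_subspace] del: zero_fun_apply)
next
  case (add f g)
  then show ?case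
    by (simp add: action_linear fs.subspace_add [OF specht_subspace] del: plus_fun_apply)
next
  case (scale c f)
  then show ?case by (simp add: action_linear fs.subspace_scale [OF specht_subspace])
qed

lemma specht_supported: "f \<in> specht \<Longrightarrow> supported f"
proof (induction f rule: specht_induct)
  case (add f g)
  then show ?case unfolding supported_def by (metis add_0 plus_fun_apply)
qed (auto simp: supported_polytabloid, auto simp: supported_def fun_scale_def)

text \<open>
  The common kernel of the functionals \<open>psi\<close> on the Specht module. It is a proper submodule that
  contains every proper submodule, hence the only maximal one.
\<close>
definition spin_radical :: "((nat \<Rightarrow> nat set) \<Rightarrow> 'f) set" where
  "spin_radical = {f \<in> specht. \<forall>t. tableau t \<longrightarrow> psi t f = 0}"

abbreviation Sn :: "(nat \<Rightarrow> nat) set" where "Sn \<equiv> carrier (sym_group n)"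

lemma psi_zero: "psi t 0 = 0" by (simp add: psi_def)

lemma spin_radical_submodule: "perm_submodule fun_scale Sn tabloid_action specht spin_radical"
  unfolding perm_submodule_def
proof (intro conjI ballI)
  show "fs.subspace spin_radical"
    using specht_subspace
    by (auto simp: fs.subspace_def spin_radical_def psi_add psi_scale psi_zero)
  show "spin_radical \<subseteq> specht" by (auto simp: spin_radical_def)
  show "tabloid_action g ` spin_radical \<subseteq> spin_radical" if "g \<in> Sn" for g
    using that by (auto simp: spin_radical_def specht_action psi_action tableau_compose permutes_inv
        sym_group_carrier)
qed

lemma spin_radical_proper: "spin_radical \<noteq> specht"
  using psi_nonzero polytabloid_specht unfolding spin_radical_def by blast

text \<open>
  If \<open>psi t w \<noteq> 0\<close> for some \<open>w\<close> in a submodule, then the symmetrizer of \<open>t\<close> produces the polytabloid of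
  \<open>t\<close> in it, and the translates of a polytabloid span the Specht module.
\<close>
lemma submodule_le_spin_radical:
  assumes W: "perm_submodule fun_scale Sn tabloid_action specht W" and ne: "W \<noteq> specht"
  shows "W \<subseteq> spin_radical"
proof
  fix w assume w: "w \<in> W"
  have sub: "fs.subspace W" "W \<subseteq> specht" using W by (auto simp: perm_submodule_def)
  have act: "tabloid_action g f \<in> W" if "g permutes {1..n}" "f \<in> W" for g f
  proof -
    have "\<forall>g\<in>Sn. tabloid_action g ` W \<subseteq> W" using W by (simp add: perm_submodule_def)
    then show ?thesis using that by (simp add: image_subset_iff sym_group_carrier)
  qed
  have "psi t w = 0" if t: "tableau t" for t
  proof (rule ccontr)
    assume nz: "psi t w \<noteq> 0"
    have "kappa t w \<in> W" unfolding kappa_def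
      using act w by (intro fs.subspace_sum [OF sub(1)]) (simp add: column_stabilizer_iff)
    then have "fun_scale (inverse (psi t w)) (fun_scale (psi t w) (poly_t t)) \<in> W"
      using fs.subspace_scale [OF sub(1)] kappa_eq [OF t specht_supported] sub(2) w by (metis subsetD)
    then have tW: "poly_t t \<in> W" using nz by simp
    have "poly_t u \<in> W" if u: "tableau u" for u
    proof -
      define g where "g p = (if p \<in> {1..n} then u (inv_into (diagram la) t p) else p)" for p
      have bt: "bij_betw t (diagram la) {1..n}" "bij_betw u (diagram la) {1..n}"
        using t u unfolding is_tableau_def sum_list_la by simp_all
      have "bij_betw (u \<circ> inv_into (diagram la) t) {1..n} {1..n}"
        using bij_betw_trans [OF bij_betw_inv_into [OF bt(1)] bt(2)] .
      then have "bij_betw g {1..n} {1..n}" by (rule bij_betw_cong [THEN iffD1, rotated]) (simp add: g_def)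
      then have gp: "g permutes {1..n}" by (rule bij_imp_permutes) (simp only: g_def if_False)
      have gt: "(g \<circ> t) c = u c" if "c \<in> diagram la" for c
        using that bt(1) by (auto simp: g_def bij_betw_def inv_into_f_f)
      have "poly_t (g \<circ> t) = poly_t u"
      proof -
        have "transversals (g \<circ> t) = transversals u"
        proof -
          have "col_parity (g \<circ> t) l T = col_parity u l T" if "l < n - r" for l T
            using gt diagram_cells [of l] that unfolding col_parity_def by simp
          then show ?thesis unfolding transversals_def by auto
        qed
        then show ?thesis using tableau_compose [OF t gp] u by (simp add: polytabloid_eq)
      qed
      then show ?thesis using act [OF gp tW] action_polytabloid [OF t gp] by simp
    qed
    then have "specht \<subseteq> W" unfolding specht_module_def by (intro fs.span_minimal sub) auto
    then show False using sub ne by blast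
  qed
  then show "w \<in> spin_radical" using w sub by (auto simp: spin_radical_def)
qed

lemma theta_radical:
  assumes f: "f \<in> specht"
    and ijk: "i \<in> {1..n}" "j \<in> {1..n}" "k \<in> {1..n}" "i \<noteq> j" "j \<noteq> k" "i \<noteq> k"
  shows "theta i j k f \<in> module_radical fun_scale Sn tabloid_action specht"
proof -
  have th: "theta i j k f \<in> specht" if "f \<in> specht" for f
    using that ijk unfolding theta_def
    by (intro fs.subspace_add [OF specht_subspace] specht_action permutes_swap_id) auto
  have lin: "theta i j k (f + g) = theta i j k f + theta i j k g"
     "theta i j k (fun_scale c f) = fun_scale c (theta i j k f)" "theta i j k 0 = 0" for f g c
    by (simp_all add: theta_def action_linear fs.scale_right_distrib add_ac)
  have "psi t (theta i j k f) = 0" if t: "tableau t" for t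
    using f
  proof (induction f rule: specht_induct)
    case (poly s)
    then show ?case using psi_theta [OF t _ ijk] by blast
  qed (simp_all add: lin psi_add psi_scale psi_zero del: zero_fun_apply plus_fun_apply)
  then have "theta i j k f \<in> spin_radical" using th f by (simp add: spin_radical_def)
  moreover have "W = spin_radical" if "maximal_submodule fun_scale Sn tabloid_action specht W" for W
    using that submodule_le_spin_radical [of W] spin_radical_submodule spin_radical_proper
    unfolding maximal_submodule_def by blast
  ultimately show ?thesis using th f by (auto simp: module_radical_def)
qed

end

text \<open>The second part of \<open>beta n\<close> is \<open>(n - 1) div 2\<close> in both parities of \<open>n\<close>.\<close>
lemma spin_module_of_basic:
  fixes s :: "'f::field \<Rightarrow> 'v::ab_group_add \<Rightarrow> 'v"
  assumes char: "CHAR('f) = 2" and n: "n > 2" and D: "basic_spin_module n s \<rho> D"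
  shows "spin_module s \<rho> D n"
proof
  show "CHAR('f) = 2" by (rule char)
  show "n > 0" using n by simp
  have carr: "carrier (sym_group n) = {p. p permutes {1..n}}" by (simp add: sym_group_def)
  have head: "is_head (carrier (sym_group n)) (fun_scale :: 'f \<Rightarrow> _) tabloid_action
      (specht_module (beta n)) s \<rho> D"
    using D by (simp add: basic_spin_module_def)
  then show mod: "perm_module s {p. p permutes {1..n}} \<rho> D" by (simp add: is_head_def carr)
  define r where "r = (n - 1) div 2"
  have beta: "beta n = [n - r, r]"
  proof (cases "even n")
    case True
    then obtain m where "n = 2 * m" by (elim evenE)
    then show ?thesis using n by (auto simp: beta_def r_def)
  next
    case False
    then obtain m where "n = 2 * m + 1" by (elim oddE)
    then show ?thesis by (auto simp: beta_def r_def)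
  qed
  interpret two_row_char2 n r "TYPE('f)"
    using n char by unfold_locales (auto simp: r_def)
  obtain f where f: "equivariant_hom (carrier (sym_group n)) fun_scale tabloid_action specht s \<rho> D f"
      "f ` specht = D" "{v \<in> specht. f v = 0} = module_radical fun_scale (carrier (sym_group n)) tabloid_action specht"
    using head unfolding is_head_def beta by blast
  fix i j k v
  assume ijk: "i \<in> {1..n}" "j \<in> {1..n}" "k \<in> {1..n}" "i \<noteq> j" "j \<noteq> k" "i \<noteq> k" and v: "v \<in> D"
  obtain u where u: "u \<in> specht" "v = f u" using f(2) v by blast
  have tr: "transpose a b permutes {1..n}" if "a \<in> {1..n}" "b \<in> {1..n}" for a b
    using that by (rule permutes_swap_id)
  have act: "\<rho> (transpose a b) v = f (tabloid_action (transpose a b) u)"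
    and in_specht: "tabloid_action (transpose a b) u \<in> specht"
    if "a \<in> {1..n}" "b \<in> {1..n}" for a b
    using f(1) u tr [OF that] specht_action [OF u(1) tr [OF that]]
    by (simp_all add: equivariant_hom_def carr)
  have add: "f (x + y) = f x + f y" if "x \<in> specht" "y \<in> specht" for x y
    using f(1) that by (simp add: equivariant_hom_def linear_on_def)
  have "\<rho> (transpose i j) v + \<rho> (transpose j k) v + \<rho> (transpose i k) v = f (theta i j k u)"
    unfolding theta_def using ijk in_specht
    by (simp add: act add fs.subspace_add [OF specht_subspace])
  also have "\<dots> = 0" using theta_radical [OF u(1) ijk] f(3) by blast
  finally show "\<rho> (transpose i j) v + \<rho> (transpose j k) v + \<rho> (transpose i k) v = 0" .
qed

section \<open>Young subgroups\<close>

lemma young_subgroup_iff: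
  "g \<in> young_subgroup m k \<longleftrightarrow> g permutes {1..m + k} \<and> g ` {m + 1..m + k} = {m + 1..m + k}"
proof
  assume "g \<in> young_subgroup m k"
  then obtain g1 h where g: "g = g1 \<circ> h" and p: "g1 permutes {1..m}" "h permutes {m + 1..m + k}"
    by (auto simp: young_subgroup_def)
  have "g1 permutes {1..m + k}" "h permutes {1..m + k}"
    using p by (auto intro: permutes_subset)
  then have "g permutes {1..m + k}" by (simp add: g permutes_compose)
  moreover have "g1 ` {m + 1..m + k} = {m + 1..m + k}"
    using p(1) by (force simp: permutes_def image_iff)
  ultimately show "g permutes {1..m + k} \<and> g ` {m + 1..m + k} = {m + 1..m + k}"
    using permutes_image [OF p(2)] by (simp only: g image_comp [symmetric])
next
  assume g: "g permutes {1..m + k} \<and> g ` {m + 1..m + k} = {m + 1..m + k}"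
  define g1 h where "g1 = (\<lambda>p. if p \<in> {1..m} then g p else p)"
    and "h = (\<lambda>p. if p \<in> {m + 1..m + k} then g p else p)"
  from g have gp: "g permutes {1..m + k}" and gY: "g ` {m + 1..m + k} = {m + 1..m + k}" by simp_all
  have inj: "inj g" by (rule permutes_inj [OF gp])
  have split: "{1..m} = {1..m + k} - {m + 1..m + k}" by auto
  have im: "g ` {1..m} = {1..m}"
    by (simp only: split image_set_diff [OF inj] permutes_image [OF gp] gY)
  have "bij_betw g {1..m} {1..m}" "bij_betw g {m + 1..m + k} {m + 1..m + k}"
    using im gY inj by (auto simp: bij_betw_def intro: inj_on_subset)
  moreover have "bij_betw g1 {1..m} {1..m} = bij_betw g {1..m} {1..m}"
    by (rule bij_betw_cong) (simp add: g1_def)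
  moreover have "bij_betw h {m + 1..m + k} {m + 1..m + k} = bij_betw g {m + 1..m + k} {m + 1..m + k}"
    by (rule bij_betw_cong) (simp add: h_def)
  ultimately have bij: "bij_betw g1 {1..m} {1..m}" "bij_betw h {m + 1..m + k} {m + 1..m + k}" by simp_all
  have "g1 permutes {1..m}"
    by (rule bij_imp_permutes [OF bij(1)]) (simp only: g1_def if_False)
  moreover have "h permutes {m + 1..m + k}"
    by (rule bij_imp_permutes [OF bij(2)]) (simp only: h_def if_False)
  moreover have "g = g1 \<circ> h"
  proof
    fix p
    consider "p \<in> {m + 1..m + k}" | "p \<in> {1..m}" | "p \<notin> {1..m + k}" by force
    then show "g p = (g1 \<circ> h) p"
    proof cases
      case 1
      then have "g p \<in> {m + 1..m + k}" using gY by (metis image_eqI)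
      then show ?thesis using 1 by (auto simp: g1_def h_def)
    next
      case 3
      then show ?thesis using permutes_not_in [OF gp, of p] by (auto simp: g1_def h_def)
    qed (auto simp: g1_def h_def)
  qed
  ultimately show "g \<in> young_subgroup m k" by (auto simp: young_subgroup_def)
qed

context half_spin
begin

lemma irreducible_mono:
  assumes "irreducible_module s H \<rho> E" "H \<subseteq> H'" "H' \<subseteq> {p. p permutes {1..n} \<and> evenperm p}"
  shows "irreducible_module s H' \<rho> E"
proof -
  have "perm_submodule s H \<rho> E W" if "perm_submodule s H' \<rho> E W" for W
    using that assms(2) unfolding perm_submodule_def by blast
  then show ?thesis
    using assms(1) perm_module_restrict [OF assms(3)] by (auto simp: irreducible_module_def)
qed

lemma clifford_list_gen:
  assumes "distinct l" "set l \<subseteq> {1..n} - {p}" "p \<in> {1..n}"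
  shows "clifford_list (map (\<lambda>i. gen i + gen p) l)"
  using assms
proof (induction l)
  case (Cons i l)
  have ip: "i \<in> {1..n}" "i \<noteq> p" using Cons.prems by auto
  have "(gen i + gen p) * (gen j + gen p) + (gen j + gen p) * (gen i + gen p) = opr id" if "j \<in> set l" for j
  proof -
    have j: "j \<in> {1..n}" "j \<noteq> p" "j \<noteq> i" using Cons.prems that by auto
    have "{i, p} \<inter> {j, p} = {p}" using j ip by auto
    then have "vec {i, p} * vec {j, p} + vec {j, p} * vec {i, p} = opr id"
      using vec_comm [of "{i, p}" "{j, p}"] ip j assms(3) by simp
    then show ?thesis using ip j by (simp add: vec_pair)
  qed
  moreover have "unital (gen i + gen p)" using unital_x ip(1) assms(3) unital_add by blast
  moreover have "(gen i + gen p) * (gen i + gen p) = opr id" using sq ip assms(3) by blast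
  moreover have "clifford_list (map (\<lambda>i. gen i + gen p) l)"
    by (rule Cons.IH) (use Cons.prems in simp_all)
  ultimately show ?case unfolding list.map clifford_list.simps set_map by blast
qed simp

lemma linop_gen: "i \<in> {1..n} \<Longrightarrow> linop (gen i)"
  using linop_vec [of "{i}"] by (simp add: vec_def)

lemma linop_psum: "(\<And>a. a \<in> set l \<Longrightarrow> linop a) \<Longrightarrow> linop (psum l)"
proof (induction l)
  case (Cons a l)
  have "linop (sum_list m)" if "\<And>a. a \<in> set m \<Longrightarrow> linop a" for m
    using that by (induction m) (auto intro: linop_add)
  then show ?case using Cons by (auto intro!: linop_add linop_mult)
qed simp

lemma commute_psum:
  assumes "\<And>a. a \<in> set l \<Longrightarrow> g * a = a * (g :: 'v additive)"
  shows "g * psum l = psum l * g"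
  using assms
proof (induction l)
  case (Cons a l)
  have "g * sum_list m = sum_list m * g" if "\<And>a. a \<in> set m \<Longrightarrow> g * a = a * g" for m
    using that by (induction m) (auto simp: distrib_left distrib_right)
  then have "g * (a * sum_list l) = a * sum_list l * g"
    using Cons.prems by (metis list.set_intros mult.assoc)
  then show ?case using Cons by (simp add: distrib_left distrib_right)
qed simp

lemma vec_distinct_list:
  "distinct l \<Longrightarrow> even (length l) \<Longrightarrow> vec (set l) = sum_list (map (\<lambda>i. gen i + gen p) l)"
  by (simp add: vec_via_base [of _ p] distinct_card sum_list_distinct_conv_sum_set)

text \<open>
  The element \<open>z\<close> is the sum of the products \<open>(i p) (j p)\<close> over pairs from a list of even length.
  Two lists are used: all points except \<open>p\<close> if \<open>n\<close> is odd, and all but one of them if four divides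
  \<open>n\<close>. In the latter case the omitted transposition \<open>(q p)\<close> is the sum of the others and the all-one
  vector, which acts as zero.
\<close>
lemma psum_scalar:
  assumes ab: "a \<in> {1..n}" "b \<in> {1..n}" "a \<noteq> b" and p: "p \<in> {1..n}"
    and l: "distinct l" "even (length l)" "set l \<subseteq> {1..n} - {p}"
    and cover: "set l = {1..n} - {p} \<or> (4 dvd n \<and> (\<exists>q\<in>{1..n}. q \<noteq> p \<and> q \<notin> set l \<and> insert q (set l) = {1..n} - {p}))"
  shows "\<exists>c. \<forall>x\<in>E. app (psum (map (\<lambda>i. gen i + gen p) l)) x = s c x \<and>
     app (psum (map (\<lambda>i. gen i + gen p) l)) (app (opr (transpose a b)) x) =
       app (opr (transpose a b)) (s (c + 1) x)"
proof (rule scalar_action [OF ab])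
  let ?F = "\<lambda>i. gen i + gen p"
  let ?L = "map ?F l"
  define z where "z = psum ?L"
  have cl: "clifford_list ?L" using l p by (intro clifford_list_gen)
  have len: "even (length ?L)" using l by simp
  show "linop (psum ?L)"
    using l p by (intro linop_psum) (auto intro!: linop_add linop_gen)
  show "psum ?L * psum ?L + psum ?L \<in> {0, opr id}" by (rule psum_quadratic [OF cl len])
  show "parity_map E (app (opr (transpose a b)) ` E) False (psum ?L)"
    using l p ab by (intro parity_map_psum add_closed_E) (auto intro!: parity_map_gen)
  fix i j x
  assume ij: "i \<in> {1..n}" "j \<in> {1..n}" "i \<noteq> j" and x: "x \<in> E \<union> app (opr (transpose a b)) ` E"
  have F: "app (z * ?F i) x = app (?F i * z + ?F i) x" if i: "i \<in> {1..n}" for i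
  proof -
    consider "i = p" | "i \<in> set l" | "i \<noteq> p" "i \<notin> set l" by blast
    then show ?thesis
    proof cases
      case 1
      then show ?thesis by (simp add: char2)
    next
      case 2
      then have "?F i * z + z * ?F i = ?F i"
        unfolding z_def by (intro comm_psum_member cl len) auto
      then have "z * ?F i = ?F i * z + ?F i" by (metis char2_left)
      then show ?thesis by simp
    next
      case 3
      have ip: "i \<in> {1..n} - {p}" using i 3(1) by simp
      then have "set l \<noteq> {1..n} - {p}" using 3(2) by metis
      then obtain q where n4: "4 dvd n" and q: "insert q (set l) = {1..n} - {p}" using cover by metis
      have "i = q" using ip 3(2) q by (metis insertE)
      then have il: "insert i (set l) = {1..n} - {p}" using q by simp
      let ?v = "vec {1..n}"
      have comm: "?v * y = y * ?v" if y: "y \<in> set ?L" for y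
      proof -
        obtain j where jl: "j \<in> set l" and yj: "y = ?F j" using y by auto
        then have j: "j \<in> {1..n}" "j \<noteq> p" using l(3) by auto
        have "{1..n} \<inter> {j, p} = {j, p}" using j p by auto
        then have "?v * vec {j, p} + vec {j, p} * ?v = 0"
          using vec_comm [of "{1..n}" "{j, p}"] j p n4 by (auto elim: dvd_trans [rotated])
        then show ?thesis unfolding yj vec_pair [OF j(2), symmetric] by (rule eqI_add_zero)
      qed
      have vz: "?v * z = z * ?v" unfolding z_def by (rule commute_psum [OF comm])
      have sz: "sum_list ?L * z + z * sum_list ?L = sum_list ?L"
        unfolding z_def by (rule comm_psum_sum [OF cl len])
      have "?v = (\<Sum>j\<in>{1..n}. ?F j)" using n4 by (intro vec_via_base) (auto elim: dvd_trans [rotated])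
      also have "\<dots> = ?F p + (?F i + (\<Sum>j\<in>set l. ?F j))"
      proof -
        have "{1..n} = insert p (insert i (set l))" using il p by blast
        moreover have "p \<notin> insert i (set l)" "i \<notin> set l" using 3 l by auto
        ultimately show ?thesis by (simp only: sum.insert finite_insert finite_set not_False_eq_True)
      qed
      also have "(\<Sum>j\<in>set l. ?F j) = sum_list ?L"
        using l by (simp add: sum_list_distinct_conv_sum_set)
      finally have v: "?v = ?F i + sum_list ?L" by (simp add: char2)
      then have Fi: "?F i = ?v + sum_list ?L" by (metis char2_left add.commute)
      have "?F i * z + z * ?F i = (?v * z + z * ?v) + (sum_list ?L * z + z * sum_list ?L)"
        by (simp only: Fi distrib_left distrib_right add_ac)
      also have "\<dots> = sum_list ?L" by (simp only: vz sz char2 add_0_left)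
      also have "\<dots> = ?F i + ?v" by (simp only: v char2_left)
      finally have "?F i * z + z * ?F i = ?F i + ?v" .
      then have "z * ?F i = ?F i * z + (?F i + ?v)" by (metis char2_left)
      moreover have "app ?v x = 0" by (rule vec_all_zero [OF n4 ab x])
      ultimately show ?thesis by (simp add: app_plus)
    qed
  qed
  have tau: "opr (transpose i j) = ?F i + ?F j"
    using gen_add [OF ij] by (simp add: char2_simps)
  have "app (z * opr (transpose i j)) x = app (z * ?F i) x + app (z * ?F j) x"
    by (simp only: tau distrib_left app_plus)
  also have "\<dots> = app (opr (transpose i j) * z + opr (transpose i j)) x"
    unfolding F [OF ij(1)] F [OF ij(2)] by (simp only: tau distrib_left distrib_right app_plus add_ac)
  finally show "app (psum ?L * opr (transpose i j)) x =
      app (opr (transpose i j) * psum ?L + opr (transpose i j)) x" by (simp only: z_def)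
qed

lemma alt_young_eq:
  assumes "k < n" shows "alt_young (n - k) k = young_subgroup (n - k) k \<inter> {p. evenperm p}"
  using assms by (auto simp: alt_young_def alt_group_carrier young_subgroup_iff)

lemma young_transpose:
  assumes "k < n" and "{i, j} \<subseteq> {1..n - k} \<or> {i, j} \<subseteq> {n - k + 1..n}"
  shows "transpose i j \<in> young_subgroup (n - k) k"
proof -
  have "transpose i j permutes {1..n}" using assms by (intro permutes_swap_id) auto
  moreover have "transpose i j ` {n - k + 1..n} = {n - k + 1..n}"
    using assms by (intro transpose_image_eq) auto
  ultimately show ?thesis using assms by (simp add: young_subgroup_iff)
qed

lemma young_closed:
  assumes "k < n"
  shows "g \<in> young_subgroup (n - k) k \<Longrightarrow> g permutes {1..n}"
    "g \<in> young_subgroup (n - k) k \<Longrightarrow> h \<in> young_subgroup (n - k) k \<Longrightarrow> g \<circ> h \<in> young_subgroup (n - k) k"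
  using assms unfolding young_subgroup_iff image_comp [symmetric] by (simp_all add: permutes_compose)

text \<open>
  Both parts \<open>X\<close>, \<open>Y\<close> have odd size: for \<open>i \<in> Y\<close>, the transposition \<open>(i 1)\<close> is the sum of the all-one
  vector, the vector of \<open>X\<close> without \<open>1\<close> and the vector of \<open>Y\<close> without \<open>i\<close>.
\<close>
lemma young_irreducible_odd:
  assumes n4: "4 dvd n" and k: "odd k" "k < n"
  shows "irreducible_module s (alt_young (n - k) k) \<rho> E"
proof -
  let ?X = "{1..n - k}" and ?Y = "{n - k + 1..n}"
  have n1: "1 \<le> n - k" and evn: "even n" using k n4 by (auto elim: dvd_trans [rotated])
  have "n \<noteq> 0" using k by simp
  then have "n \<ge> 4" using n4 by (simp add: dvd_imp_le)
  obtain a b where ab: "{a, b} \<subseteq> ?X \<or> {a, b} \<subseteq> ?Y" "a \<noteq> b"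
  proof (cases "n - k \<ge> 2")
    case True
    then show ?thesis using that [of 1 2] by auto
  next
    case False
    then have "n - k + 1 \<le> n - 1" "n - 1 \<noteq> n" using \<open>n \<ge> 4\<close> by linarith+
    then show ?thesis using that [of "n - 1" n] by auto
  qed
  have abn: "a \<in> {1..n}" "b \<in> {1..n}" using ab k by auto
  show ?thesis unfolding alt_young_eq [OF k(2)]
  proof (rule irreducible_restrictI [OF young_closed [OF k(2)] abn ab(2) young_transpose [OF k(2) ab(1)],
        where p = 1])
    fix W W' i
    assume W: "W \<subseteq> E" "W' = app (opr (transpose a b)) ` W"
      and ac: "add_closed W" "add_closed W'"
      and par: "\<And>g. g \<in> young_subgroup (n - k) k \<Longrightarrow> parity_map W W' (\<not> evenperm g) (opr g)"
      and i: "i \<in> {1..n}"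
    have same: "parity_map W W' True (gen i + gen j)" if "{i, j} \<subseteq> ?X \<or> {i, j} \<subseteq> ?Y" for i j
    proof (rule parity_map_transposition [where N = "young_subgroup (n - k) k", OF ac par])
      show "i \<in> {1..n}" "j \<in> {1..n}" using that by auto
      show "transpose i j \<in> young_subgroup (n - k) k" by (rule young_transpose [OF k(2) that])
    qed
    show "parity_map W W' True (gen i + gen 1)"
    proof (cases "i \<in> ?X")
      case True
      then show ?thesis using same [of i 1] n1 by auto
    next
      case False
      then have iY: "i \<in> ?Y" using i by auto
      have "parity_map W W' True (vec (?X - {1}))"
        using n1 k evn ac by (intro parity_map_vec [where p = 1] same) auto
      moreover have "parity_map W W' True (vec (?Y - {i}))"
        using n1 k iY ac by (intro parity_map_vec [where p = i] same) auto
      moreover have "parity_map W W' True (vec {1..n})"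
      proof -
        have "app (vec {1..n}) x = 0" if "x \<in> W \<union> W'" for x
          using vec_all_zero [OF n4 abn ab(2), of x] that W by auto
        then show ?thesis using ac by (auto simp: parity_map_def add_closed_def)
      qed
      moreover have "gen i + gen 1 = vec {1..n} + (vec (?X - {1}) + vec (?Y - {i}))"
      proof -
        have "{1..n} = {i, 1} \<union> (?X - {1} \<union> (?Y - {i}))" using iY n1 by auto
        then have "vec {1..n} = vec ({i, 1} \<union> (?X - {1} \<union> (?Y - {i})))" by (rule arg_cong)
        also have "\<dots> = vec {i, 1} + (vec (?X - {1}) + vec (?Y - {i}))"
          using iY n1 by (subst vec_Un; (subst vec_Un)?) auto
        also have "vec {i, 1} = gen i + gen 1" using iY n1 by (intro vec_pair) auto
        finally show ?thesis by (simp add: char2_simps)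
      qed
      ultimately show ?thesis using ac by (simp add: parity_map_add)
    qed
  qed
qed

text \<open>
  The part of size congruent to two modulo four contributes an invertible vector \<open>v\<close> fixed by the
  Young subgroup. The central element \<open>z\<close> is a sum of \<open>w v\<close>, for a transposition \<open>w\<close> joining the two
  parts, and even elements of the Young subgroup algebra; as \<open>z\<close> acts by scalars, \<open>w\<close> is recovered.
\<close>
lemma young_irreducible_even:
  assumes n2: "n mod 4 \<noteq> 2" and k: "k mod 4 = 2" "k < n"
  shows "irreducible_module s (alt_young (n - k) k) \<rho> E"
proof -
  define m where "m = n - k"
  let ?X = "{1..m}" and ?Y = "{m + 1..n}"
  have m: "1 \<le> m" "n = m + k" using k by (auto simp: m_def)
  have k2: "2 \<le> k" "even k" "odd (k div 2)" using k by presburger+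
  define a b where "a = m + 1" and "b = m + 2"
  have ab: "{a, b} \<subseteq> ?X \<or> {a, b} \<subseteq> {n - k + 1..n}" "a \<noteq> b" using m k2 by (auto simp: a_def b_def)
  have abn: "a \<in> {1..n}" "b \<in> {1..n}" using m k2 by (auto simp: a_def b_def)
  have ab': "{a, b} \<subseteq> {1..n - k} \<or> {a, b} \<subseteq> {n - k + 1..n}" using ab by (simp add: m_def)
  \<comment> \<open>The list for \<open>z\<close> runs through all points but \<open>1\<close>, and also omits \<open>2\<close> if the degree is even.\<close>
  define c where "c = (if odd m then 2 else 3 :: nat)"
  let ?F = "\<lambda>i. gen i + gen 1"
  let ?lX = "[c..<m + 1]" and ?lY = "[m + 1..<n + 1]" and ?lY' = "[m + 2..<n + 1]"
  have lY: "?lY = (m + 1) # ?lY'" 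
  proof -
    have "Suc (m + 1) = m + 2" by simp
    moreover have "?lY = (m + 1) # [Suc (m + 1)..<n + 1]" using m k2 by (intro upt_conv_Cons) simp
    ultimately show ?thesis by (simp only:)
  qed
  have evX: "even (length ?lX)" using m k n2 by (auto simp: c_def)
  have "odd m \<or> m mod 4 = 2" using m k n2 by presburger
  then have "4 dvd n" if "even m" using that m k by presburger
  have nn1: "1 \<in> {1..n}" using m by simp
  have scalar: "\<exists>c. \<forall>x\<in>E. app (psum (map ?F (?lX @ ?lY))) x = s c x \<and>
     app (psum (map ?F (?lX @ ?lY))) (app (opr (transpose a b)) x) =
       app (opr (transpose a b)) (s (c + 1) x)"
  proof (rule psum_scalar [OF abn ab(2) nn1])
    show "distinct (?lX @ ?lY)" by auto
    show "even (length (?lX @ ?lY))" using evX m k2 by simp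
    show "set (?lX @ ?lY) \<subseteq> {1..n} - {1}" using m by (auto simp: c_def)
    show "set (?lX @ ?lY) = {1..n} - {1} \<or> (4 dvd n \<and> (\<exists>q\<in>{1..n}. q \<noteq> 1 \<and> q \<notin> set (?lX @ ?lY) \<and>
        insert q (set (?lX @ ?lY)) = {1..n} - {1}))"
    proof (cases "odd m")
      case True
      then show ?thesis using m by (auto simp: c_def)
    next
      case False
      then have "2 \<le> m" using m by (cases "m = 1") auto
      then have "2 \<in> {1..n} \<and> (2::nat) \<noteq> 1 \<and> 2 \<notin> set (?lX @ ?lY) \<and>
        insert 2 (set (?lX @ ?lY)) = {1..n} - {1}"
        using False m by (auto simp: c_def)
      then show ?thesis using False \<open>even m \<Longrightarrow> 4 dvd n\<close> by blast
    qed
  qed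
  show ?thesis unfolding alt_young_eq [OF k(2)]
  proof (rule irreducible_restrictI [OF young_closed [OF k(2)] abn ab(2) young_transpose [OF k(2) ab'],
        where p = 1])
    fix W W' i
    assume sub: "vs.subspace W" and W: "W \<subseteq> E" "W' = app (opr (transpose a b)) ` W"
      and ac: "add_closed W" "add_closed W'"
      and par: "\<And>g. g \<in> young_subgroup (n - k) k \<Longrightarrow> parity_map W W' (\<not> evenperm g) (opr g)"
      and i: "i \<in> {1..n}"
    have same: "parity_map W W' True (gen i + gen j)" if "{i, j} \<subseteq> ?X \<or> {i, j} \<subseteq> ?Y" for i j
    proof (rule parity_map_transposition [where N = "young_subgroup (n - k) k", OF ac par])
      show "i \<in> {1..n}" "j \<in> {1..n}" using that m by auto
      show "transpose i j \<in> young_subgroup (n - k) k"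
        using that by (intro young_transpose [OF k(2)]) (simp add: m_def)
    qed
    define w where "w = gen (m + 1) + gen 1"
    define v where "v = vec ?Y"
    let ?G = "\<lambda>i. gen i + gen (m + 1)"
    let ?gs = "map ?G ?lY'"
    define z where "z = psum (map ?F (?lX @ ?lY))"
    have pe: "parity_map W W' False (opr id)"
      by (rule parity_map_id [OF par abn ab(2) young_transpose [OF k(2) ab']])
    have pz: "parity_map W W' False z"
    proof -
      obtain d where d: "\<And>x. x \<in> E \<Longrightarrow> app z x = s d x \<and>
         app z (app (opr (transpose a b)) x) = app (opr (transpose a b)) (s (d + 1) x)"
        using scalar unfolding z_def by blast
      then show ?thesis using W sub unfolding parity_map_def
        by (auto simp: vs.subspace_scale subset_iff)
    qed
    have pgs: "parity_map W W' True y" if "y \<in> set ?gs" for y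
    proof -
      obtain j where "j \<in> set ?lY'" and y: "y = ?G j" using \<open>y \<in> set ?gs\<close> by auto
      then have "{j, m + 1} \<subseteq> ?Y" by simp
      then show ?thesis unfolding y using same by blast
    qed
    have pX: "parity_map W W' True y" if "y \<in> set (map ?F ?lX)" for y
    proof -
      obtain j where "j \<in> set ?lX" and y: "y = ?F j" using \<open>y \<in> set (map ?F ?lX)\<close> by auto
      then have "{j, 1} \<subseteq> ?X" using m(1) by (auto simp: c_def split: if_splits)
      then show ?thesis unfolding y using same by blast
    qed
    have pv: "parity_map W W' True v"
      unfolding v_def using m k2 ac by (intro parity_map_vec [where p = "m + 1"] same) auto
    have vsum: "v = sum_list ?gs"
    proof -
      have "v = sum_list (map ?G ?lY)"
      proof -
        have "set ?lY = ?Y" by auto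
        moreover have "even (length ?lY)" using m k2 by simp
        ultimately show ?thesis unfolding v_def using vec_distinct_list [of ?lY "m + 1"] by (metis distinct_upt)
      qed
      then show ?thesis by (simp only: lY list.map sum_list.Cons char2 add_0_left)
    qed
    have wF: "map ?F ?lY' = map (\<lambda>y. w + y) ?gs"
      by (simp add: w_def char2_simps)
    have len': "odd (length ?lY')" using m k2 by simp
    have sumY': "sum_list (map ?F ?lY') = w + v"
    proof -
      have "sum_list (map (\<lambda>y. w + y) l) = (if odd (length l) then w else 0) + sum_list l" for l
        by (induction l) (auto simp: char2_simps)
      from this [of ?gs] show ?thesis unfolding wF vsum by (simp only: length_map if_P [OF len'])
    qed
    have m1: "m + 1 \<in> {1..n}" "m + 1 \<noteq> 1" using m k2 by auto
    have ww: "w * w = opr id" unfolding w_def using sq m1 nn1 by blast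
    have uw: "unital w" unfolding w_def using unital_x m1 nn1 unital_add by blast
    have anti: "\<forall>y\<in>set ?gs. unital y \<and> y * w + w * y = opr id"
    proof
      fix y assume "y \<in> set ?gs"
      then obtain j where jY: "j \<in> set ?lY'" and yj: "y = ?G j" by auto
      have j: "j \<in> {1..n}" "j \<noteq> m + 1" "j \<noteq> 1" using jY by auto
      have "{j, m + 1} \<inter> {m + 1, 1} = {m + 1}" using j by auto
      then have "vec {j, m + 1} * vec {m + 1, 1} + vec {m + 1, 1} * vec {j, m + 1} = opr id"
        using vec_comm [of "{j, m + 1}" "{m + 1, 1}"] j m1 nn1 by simp
      then have "y * w + w * y = opr id" 
        unfolding yj w_def vec_pair [OF j(2), symmetric] vec_pair [OF m1(2), symmetric] .
      moreover have "unital y" unfolding yj by (intro unital_add unital_x j m1)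
      ultimately show "unital y \<and> y * w + w * y = opr id" by blast
    qed
    obtain d where d: "d \<in> {0, opr id}" "psum (map ?F ?lY') = d + psum ?gs"
      using psum_translate [OF ww uw anti] len' unfolding wF [symmetric] by auto
    have pd: "parity_map W W' False d" using d(1) pe ac by (auto simp: parity_map_0)
    have pY: "psum (map ?F ?lY) = w * (w + v) + (d + psum ?gs)"
      by (simp only: lY list.map psum.simps sumY' d(2) w_def)
    have sY: "sum_list (map ?F ?lY) = v"
      by (simp only: lY list.map sum_list.Cons sumY' w_def [symmetric] char2_left)
    have "z = psum (map ?F ?lX) + sum_list (map ?F ?lX) * v + (w * (w + v) + (d + psum ?gs))"
      by (simp only: z_def map_append psum_append pY sY)
    also have "w * (w + v) = opr id + w * v" by (simp add: distrib_left ww)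
    finally have "w * v = z + (psum (map ?F ?lX) + sum_list (map ?F ?lX) * v + (opr id + (d + psum ?gs)))"
      by (simp add: char2_simps)
    moreover have "parity_map W W' False (sum_list (map ?F ?lX) * v)"
    proof -
      have "parity_map W W' True (sum_list (map ?F ?lX))" by (rule parity_map_sum_list [OF ac pX])
      from parity_map_mult [OF this pv] show ?thesis by simp
    qed
    moreover have "parity_map W W' False (psum (map ?F ?lX))" "parity_map W W' False (psum ?gs)"
      using parity_map_psum [OF ac] pX pgs by blast+
    ultimately have pwv: "parity_map W W' False (w * v)"
      using ac pz pe pd by (simp add: parity_map_add)
    have "v * v = opr id"
      unfolding v_def using vec_sq [of ?Y] m k2 by simp
    then have "w = (w * v) * v" using uw by (simp add: mult.assoc unital_def)
    then have pw: "parity_map W W' True w"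
      using parity_map_mult [OF pwv pv] by simp
    show "parity_map W W' True (gen i + gen 1)"
    proof (cases "i \<in> ?X")
      case True
      then show ?thesis using same [of i 1] m by auto
    next
      case False
      then have "parity_map W W' True (gen i + gen (m + 1))" using i m k2 by (intro same) auto
      then have "parity_map W W' True (w + (gen i + gen (m + 1)))" using pw ac parity_map_add by blast
      then show ?thesis by (simp add: w_def char2_simps)
    qed
  qed
qed

lemma young_irreducible:
  assumes "n mod 4 \<noteq> 2" "1 \<le> k" "k < n" "n mod 4 = 0 \<and> odd k \<or> k mod 4 = 2"
  shows "irreducible_module s (alt_young (n - k) k) \<rho> E"
  using assms young_irreducible_odd [of k] young_irreducible_even [of k] by auto

end

section \<open>Wreath products\<close>

text \<open>The blocks of \<open>standard_blocks\<close>, numbered from 0.\<close>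
definition std_block :: "nat \<Rightarrow> nat \<Rightarrow> nat set" where
  "std_block a i = {a * i + 1..a * i + a}"

lemma standard_blocks_eq: "standard_blocks a b = std_block a ` {..<b}"
  by (auto simp: standard_blocks_def std_block_def)

lemma mem_std_block: "a > 0 \<Longrightarrow> p \<in> std_block a i \<longleftrightarrow> 1 \<le> p \<and> (p - 1) div a = i"
proof -
  assume a: "a > 0"
  show ?thesis
  proof (cases p)
    case (Suc q)
    have "q div a = i \<longleftrightarrow> a * i \<le> q \<and> q < a * i + a"
      using a by (metis div_nat_eqI dividend_less_div_times less_eq_div_iff_mult_less_eq mult.commute
          mult_Suc_right order_refl add.commute)
    then show ?thesis by (auto simp: Suc std_block_def)
  qed (simp add: std_block_def)
qed

lemma std_block_cover:
  fixes a b p :: nat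
  assumes "a > 0" "p \<in> {1..a * b}"
  shows "(p - 1) div a < b"
proof -
  have "1 \<le> p" "p \<le> b * a" using assms by (simp_all add: mult.commute)
  then have "p - 1 < b * a" by linarith
  then show ?thesis by (rule less_mult_imp_div_less)
qed

lemma std_block_subset: "i < b \<Longrightarrow> std_block a i \<subseteq> {1..a * b}"
proof -
  assume "i < b"
  then have "a * (i + 1) \<le> a * b" by (intro mult_le_mono2) simp
  then have "a * i + a \<le> a * b" by (simp only: distrib_left mult_1_right)
  then show ?thesis by (auto simp: std_block_def)
qed

lemma wreath_subgroupI:
  assumes g: "g permutes {1..a * b}" and blocks: "\<And>i. i < b \<Longrightarrow> g ` std_block a i \<in> standard_blocks a b"
  shows "g \<in> wreath_subgroup a b"
proof -
  have "finite (standard_blocks a b)" by (simp add: standard_blocks_eq)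
  moreover have "(`) g ` standard_blocks a b \<subseteq> standard_blocks a b"
    using blocks by (auto simp: standard_blocks_eq)
  moreover have "inj_on ((`) g) (standard_blocks a b)"
    using permutes_inj [OF g] by (simp add: inj_on_def inj_image_eq_iff)
  ultimately have "(`) g ` standard_blocks a b = standard_blocks a b" by (rule endo_inj_surj)
  then show ?thesis using g by (simp add: wreath_subgroup_def sym_group_carrier)
qed

lemma wreath_closed:
  "g \<in> wreath_subgroup a b \<Longrightarrow> g permutes {1..a * b}"
  "g \<in> wreath_subgroup a b \<Longrightarrow> h \<in> wreath_subgroup a b \<Longrightarrow> g \<circ> h \<in> wreath_subgroup a b"
proof -
  show "g \<in> wreath_subgroup a b \<Longrightarrow> g permutes {1..a * b}" for g
    by (simp add: wreath_subgroup_def sym_group_carrier)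
  assume g: "g \<in> wreath_subgroup a b" and h: "h \<in> wreath_subgroup a b"
  have "(\<lambda>B. (g \<circ> h) ` B) ` standard_blocks a b = (`) g ` (`) h ` standard_blocks a b"
    by (simp only: image_comp [symmetric] image_image)
  also have "\<dots> = standard_blocks a b" using g h by (simp add: wreath_subgroup_def)
  finally show "g \<circ> h \<in> wreath_subgroup a b"
    using g h by (simp add: wreath_subgroup_def sym_group_carrier permutes_compose)
qed

lemma alt_wreath_eq: "alt_wreath a b = wreath_subgroup a b \<inter> {p. evenperm p}"
  by (auto simp: alt_wreath_def alt_group_carrier dest: wreath_closed(1))

lemma transpose_wreath:
  assumes "i \<in> std_block a q" "j \<in> std_block a q" "q < b" "a > 0"
  shows "transpose i j \<in> wreath_subgroup a b"
proof (rule wreath_subgroupI)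
  show "transpose i j permutes {1..a * b}"
    using assms std_block_subset by (intro permutes_swap_id) blast+
  fix c assume "c < b"
  have "i \<in> std_block a c \<longleftrightarrow> j \<in> std_block a c" using assms by (simp add: mem_std_block)
  then have "transpose i j ` std_block a c = std_block a c" by (rule transpose_image_eq)
  then show "transpose i j ` std_block a c \<in> standard_blocks a b"
    using \<open>c < b\<close> by (simp add: standard_blocks_eq)
qed

text \<open>
  The permutation exchanging the first \<open>l\<close> points of the blocks \<open>0\<close> and \<open>q\<close>, as a product of \<open>l\<close>
  transpositions.
\<close>
primrec block_swap :: "nat \<Rightarrow> nat \<Rightarrow> nat \<Rightarrow> nat \<Rightarrow> nat" where
  "block_swap a q 0 = id"
| "block_swap a q (Suc l) = transpose (l + 1) (a * q + l + 1) \<circ> block_swap a q l"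

lemma block_swap_apply:
  assumes "q > 0" "l \<le> a"
  shows "block_swap a q l p = (if p \<in> {1..l} then p + a * q else if p \<in> {a * q + 1..a * q + l} then p - a * q else p)"
  using assms(2)
proof (induction l arbitrary: p)
  case (Suc l)
  define c where "c = a * q"
  have "c \<ge> a" using assms(1) by (simp add: c_def)
  moreover have "block_swap a q (Suc l) p = transpose (l + 1) (c + l + 1) (block_swap a q l p)"
    by (simp add: c_def)
  moreover have "l \<le> a" using Suc by simp
  ultimately show ?case
    using Suc.IH [of p] Suc.prems unfolding c_def [symmetric] by (auto simp: transpose_def)
qed simp

lemma block_swap_permutes:
  assumes "q < b" "l \<le> a"
  shows "block_swap a q l permutes {1..a * b}"
  using assms(2)
proof (induction l)
  case (Suc l)
  have "a * (q + 1) \<le> a * b" using assms(1) by (intro mult_le_mono2) simp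
  then have "a * q + a \<le> a * b" by (simp only: distrib_left mult_1_right)
  then have "a * q + l + 1 \<le> a * b" using Suc by simp
  then have "transpose (l + 1) (a * q + l + 1) permutes {1..a * b}"
    by (intro permutes_swap_id) (auto intro: order_trans [rotated])
  then show ?case using Suc by (simp only: block_swap.simps) (intro permutes_compose; simp)
qed (simp add: permutes_id)

lemma block_swap_even:
  assumes "q > 0" "q < b" "l \<le> a"
  shows "evenperm (block_swap a q l) \<longleftrightarrow> even l"
  using assms(3)
proof (induction l)
  case (Suc l)
  have "permutation (block_swap a q l)"
    using block_swap_permutes [OF assms(2), of l a] Suc permutation_permutes by auto
  moreover have "l + 1 \<noteq> a * q + l + 1" using assms(1) Suc by simp
  ultimately show ?case using Suc
    by (simp only: block_swap.simps evenperm_comp permutation_swap_id evenperm_swap) simp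
qed (simp add: evenperm_id)

lemma block_swap_wreath:
  assumes "q > 0" "q < b" "a > 0"
  shows "block_swap a q a \<in> wreath_subgroup a b"
proof (rule wreath_subgroupI)
  let ?g = "block_swap a q a"
  show "?g permutes {1..a * b}" using assms by (intro block_swap_permutes) auto
  have aq: "a * q \<ge> a" using assms(1) by simp
  fix c assume c: "c < b"
  note ap = block_swap_apply [OF assms(1) order_refl]
  consider "c = 0" | "c = q" | "c \<noteq> 0" "c \<noteq> q" by blast
  then have "\<exists>c'<b. ?g ` std_block a c = std_block a c'"
  proof cases
    case 1
    have "?g ` {1..a} = (\<lambda>p. p + a * q) ` {1..a}" by (rule image_cong) (simp_all only: ap if_True)
    also have "\<dots> = std_block a q" by (simp add: std_block_def add.commute)
    finally show ?thesis using 1 assms by (auto simp: std_block_def)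
  next
    case 2
    define c where "c = a * q"
    have "?g p = p - c" if "p \<in> std_block a q" for p
      using aq that unfolding ap std_block_def c_def [symmetric] by auto
    then have "?g ` std_block a q = (\<lambda>p. p - a * q) ` std_block a q"
      by (intro image_cong) (simp_all add: c_def)
    also have "\<dots> = std_block a 0"
    proof
      show "(\<lambda>p. p - a * q) ` std_block a q \<subseteq> std_block a 0" by (auto simp: std_block_def)
      show "std_block a 0 \<subseteq> (\<lambda>p. p - a * q) ` std_block a q"
      proof
        fix p assume "p \<in> std_block a 0"
        then show "p \<in> (\<lambda>p. p - a * q) ` std_block a q"
          by (intro image_eqI [of _ _ "p + a * q"]) (auto simp: std_block_def)
      qed
    qed
    finally show ?thesis using 2 c assms by (intro exI [of _ 0]) auto
  next
    case 3
    have "?g p = p" if "p \<in> std_block a c" for p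
    proof -
      have "p \<notin> std_block a 0" "p \<notin> std_block a q" using that 3 assms by (auto simp: mem_std_block)
      then show ?thesis by (simp only: ap std_block_def mult_0_right add_0_left if_False)
    qed
    then show ?thesis using c by (intro exI [of _ c]) simp
  qed
  then show "?g ` std_block a c \<in> standard_blocks a b" by (auto simp: standard_blocks_eq)
qed

context half_spin
begin

text \<open>
  The exchange of two blocks of odd size is a product of commuting transpositions \<open>u + m\<close>, where
  \<open>u\<close> is the vector of the union of the two blocks and the \<open>m\<close> are sums of transpositions inside the blocks and
  square to zero. Collecting the terms with and without \<open>u\<close>, the product becomes \<open>Q + u P\<close>, where
  \<open>P\<close> and \<open>Q\<close> are an even and an odd polynomial in the \<open>m\<close>, and \<open>P\<close> is its own inverse. Hence \<open>u\<close>
  belongs to the algebra of the wreath product.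
\<close>
lemma wreath_irreducible_odd:
  assumes n: "n = a * b" and a: "odd a" "a > 1" and b: "b > 1"
  shows "irreducible_module s (alt_wreath a b) \<rho> E"
proof -
  have a3: "a \<ge> 3" using a by presburger
  have n_ge: "a * 2 \<le> n" unfolding n using b by (intro mult_le_mono2) simp
  have blk: "std_block a 0 = {1..a}" by (simp add: std_block_def)
  have t12: "transpose 1 2 \<in> wreath_subgroup a b"
    using a3 b by (intro transpose_wreath [of _ _ 0]) (auto simp: blk)
  have ab: "1 \<in> {1..n}" "2 \<in> {1..n}" "(1::nat) \<noteq> 2" using a3 n_ge by auto
  show ?thesis unfolding alt_wreath_eq
  proof (rule irreducible_restrictI [OF wreath_closed(1) [of _ a b, folded n] wreath_closed(2) ab t12, where p = 1])
    fix W W' i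
    assume ac: "add_closed W" "add_closed W'"
      and par: "\<And>g. g \<in> wreath_subgroup a b \<Longrightarrow> parity_map W W' (\<not> evenperm g) (opr g)"
      and i: "i \<in> {1..n}"
    have same: "parity_map W W' True (gen i + gen j)"
      if "i \<in> std_block a q" "j \<in> std_block a q" "q < b" for i j q
    proof (rule parity_map_transposition [OF ac par])
      show "i \<in> {1..n}" "j \<in> {1..n}" using that std_block_subset [of q b a] n by auto
      show "transpose i j \<in> wreath_subgroup a b" using transpose_wreath [OF that] a by simp
    qed
    have pe: "parity_map W W' False (opr id)" by (rule parity_map_id [OF par ab t12])
    define q where "q = (i - 1) div a"
    have q: "q < b" unfolding q_def using i a by (intro std_block_cover) (auto simp: n)
    have iq: "i \<in> std_block a q" using i a by (simp add: mem_std_block q_def)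
    show "parity_map W W' True (gen i + gen 1)"
    proof (cases "q = 0")
      case True
      then show ?thesis using same [of i 0 1] iq a3 b by (simp add: blk)
    next
      case False
      then have q0: "q > 0" by simp
      define c where "c = a * q"
      have aq: "c \<ge> a" using q0 by (simp add: c_def)
      let ?X = "{1..a}" and ?Y = "{c + 1..c + a}"
      have Y: "?Y = std_block a q" by (simp add: std_block_def c_def)
      have sub: "?X \<subseteq> {1..n}" "?Y \<subseteq> {1..n}"
        using std_block_subset [of 0 b a] std_block_subset [OF q, of a] b
        by (simp_all add: n blk Y)
      have disj: "?X \<inter> ?Y = {}" using aq by auto
      have cXY: "card (?X \<union> ?Y) = 2 * a" using disj by (subst card_Un_disjoint) auto
      define u where "u = vec (?X \<union> ?Y)"
      define M where "M l = ?X \<union> ?Y - {l + 1, c + l + 1}" for l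
      define m where "m l = vec (M l)" for l
      have fin: "finite (?X \<union> ?Y)" "?X \<union> ?Y \<subseteq> {1..n}" using sub by auto
      have Msub: "finite (M l)" "M l \<subseteq> {1..n}" "M l \<subseteq> ?X \<union> ?Y" for l
        using fin by (auto simp: M_def)
      have pts: "{l + 1, c + l + 1} \<subseteq> ?X \<union> ?Y" "l + 1 \<noteq> c + l + 1" if "l < a" for l
        using that aq a by auto
      have cM: "card (M l) = 2 * a - 2" if "l < a" for l
        unfolding M_def using pts [OF that] cXY fin by (subst card_Diff_subset) auto
      have evM: "even (card (M l))" if "l < a" for l using cM [OF that] by simp
      have uu: "u * u = opr id"
        unfolding u_def using vec_sq [OF fin] cXY a by simp
      have mm: "m l * m l = 0" if l: "l < a" for l
      proof -
        have "card (M l) div 2 = a - 1" using cM [OF l] by simp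
        then have "even (card (M l) div 2)" using a by simp
        then show ?thesis unfolding m_def using vec_sq [OF Msub(1,2) evM [OF l]] by simp
      qed
      have comm_m: "m l * m l' = m l' * m l" if l: "l < a" "l' < a" for l l'
      proof (cases "l = l'")
        case False
        have "M l \<inter> M l' = ?X \<union> ?Y - ({l + 1, c + l + 1} \<union> {l' + 1, c + l' + 1})"
          by (auto simp: M_def)
        moreover have "card ({l + 1, c + l + 1} \<union> {l' + 1, c + l' + 1}) = 4"
          using False l aq by auto
        ultimately have "card (M l \<inter> M l') = 2 * a - 4"
          using pts [OF l(1)] pts [OF l(2)] cXY fin by (simp only:) (subst card_Diff_subset; auto)
        then have "even (card (M l \<inter> M l'))" by simp
        then have "m l * m l' + m l' * m l = 0"
          unfolding m_def using vec_comm [of "M l" "M l'"] Msub evM l by simp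
        then show ?thesis by (rule eqI_add_zero)
      qed simp
      have um: "u * m l = m l * u" if l: "l < a" for l
      proof -
        have "(?X \<union> ?Y) \<inter> M l = M l" using Msub by blast
        then have "u * m l + m l * u = 0"
          unfolding m_def u_def using vec_comm [of "?X \<union> ?Y" "M l"] fin cXY Msub evM l by simp
        then show ?thesis by (rule eqI_add_zero)
      qed
      have tau: "opr (transpose (l + 1) (c + l + 1)) = u + m l" if l: "l < a" for l
      proof -
        have "?X \<union> ?Y = M l \<union> {l + 1, c + l + 1}" using pts [OF l] by (auto simp: M_def)
        then have "u = m l + vec {l + 1, c + l + 1}"
          unfolding u_def m_def using vec_Un [of "M l" "{l + 1, c + l + 1}"] Msub by (auto simp: M_def)
        also have "vec {l + 1, c + l + 1} = opr (transpose (l + 1) (c + l + 1))"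
          using pts [OF l] fin gen_add [of "l + 1" "c + l + 1"] vec_pair by auto
        finally show ?thesis by (simp add: char2_simps)
      qed
      have un: "unital u" "unital (m l)" for l
        unfolding u_def m_def vec_def using fin Msub by (auto intro!: unital_sum unital_x)
      have pm: "parity_map W W' True (m l)" if l: "l < a" for l
      proof -
        have "M l = (?X - {l + 1}) \<union> (?Y - {c + l + 1})" using disj l by (auto simp: M_def)
        moreover have "(?X - {l + 1}) \<inter> (?Y - {c + l + 1}) = {}" using disj by blast
        ultimately have "m l = vec (?X - {l + 1}) + vec (?Y - {c + l + 1})"
          unfolding m_def using vec_Un [of "?X - {l + 1}" "?Y - {c + l + 1}"]
          by (simp only: finite_Diff finite_atLeastAtMost)
        moreover have "parity_map W W' True (vec (?X - {l + 1}))"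
        proof (rule parity_map_vec [OF ac, where p = 1])
          show "even (card (?X - {l + 1}))" using l a by simp
          show "parity_map W W' True (gen i + gen 1)" if "i \<in> ?X - {l + 1}" for i
            using same [of i 0 1] that b a by (simp add: blk)
        qed simp
        moreover have "parity_map W W' True (vec (?Y - {c + l + 1}))"
        proof (rule parity_map_vec [OF ac, where p = "c + 1"])
          show "even (card (?Y - {c + l + 1}))" using l a by simp
          show "parity_map W W' True (gen i + gen (c + 1))" if "i \<in> ?Y - {c + l + 1}" for i
          proof -
            have "i \<in> std_block a q" "c + 1 \<in> std_block a q" using that a unfolding Y [symmetric] by auto
            then show ?thesis using same q by blast
          qed
        qed simp
        ultimately show ?thesis using ac by (simp add: parity_map_add)
      qed
      \<comment> \<open>The product of the first \<open>l\<close> factors. Each factor exchanges the roles of \<open>P\<close> and \<open>Q\<close>, as \<open>u\<^sup>2 = 1\<close>.\<close>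
      have "\<exists>P Q. unital P \<and> unital Q \<and> P * P = opr id \<and> Q * Q = 0 \<and> P * Q = Q * P \<and>
          parity_map W W' False P \<and> parity_map W W' True Q \<and>
          (\<forall>j<a. P * m j = m j * P \<and> Q * m j = m j * Q) \<and>
          opr (block_swap a q l) = (if even l then P + u * Q else Q + u * P)" if "l \<le> a" for l
        using that
      proof (induction l)
        case 0
        have "opr (block_swap a q 0) = opr id + u * 0" by (simp only: block_swap.simps mult_zero_right add_0_right)
        moreover have "opr id * m j = m j \<and> m j * opr id = m j" for j using un(2) by (simp only: unital_def)
        moreover have "parity_map W W' True 0" by (rule parity_map_0 [OF ac])
        ultimately have "opr (block_swap a q 0) = (if even (0::nat) then opr id + u * 0 else 0 + u * opr id)"
          and "\<forall>j<a. opr id * m j = m j * opr id \<and> 0 * m j = m j * 0"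
          and "parity_map W W' True 0" by (simp_all only: even_zero if_True mult_zero_left mult_zero_right) simp
        then show ?case
          using unital_e unital_0 ee pe mult_zero_left mult_zero_right by metis
      next
        case (Suc l)
        then have "l \<le> a" by simp
        from Suc.IH [OF this] obtain P Q where PQ: "unital P" "unital Q" "P * P = opr id" "Q * Q = 0" "P * Q = Q * P"
          "parity_map W W' False P" "parity_map W W' True Q"
          and Pm: "\<And>j. j < a \<Longrightarrow> P * m j = m j * P" and Qm: "\<And>j. j < a \<Longrightarrow> Q * m j = m j * Q"
          and R: "opr (block_swap a q l) = (if even l then P + u * Q else Q + u * P)" by blast
        have l: "l < a" using Suc by simp
        define P' Q' where "P' = P + m l * Q" and "Q' = Q + m l * P"
        have mQ: "m l * Q * P = m l * (P * Q)" "P * (m l * Q) = m l * (P * Q)"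
          "m l * Q * (m l * Q) = 0" "m l * P * (m l * P) = 0"
          "Q * (m l * P) = m l * (P * Q)" "m l * P * Q = m l * (P * Q)"
          "m l * Q * Q = 0" "Q * (m l * Q) = 0" "P * (m l * P) = m l" "m l * P * P = m l"
          "m l * Q * (m l * P) = 0" "m l * P * (m l * Q) = 0"
        proof -
          show "m l * Q * P = m l * (P * Q)" by (simp add: mult.assoc PQ(5))
          show "P * (m l * Q) = m l * (P * Q)" using Pm [OF l] by (metis mult.assoc)
          have "m l * Q * (m l * Q) = m l * m l * (Q * Q)" using Qm [OF l] by (metis mult.assoc)
          then show "m l * Q * (m l * Q) = 0" by (simp add: mm l)
          have "m l * P * (m l * P) = m l * m l * (P * P)" using Pm [OF l] by (metis mult.assoc)
          then show "m l * P * (m l * P) = 0" by (simp add: mm l)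
          show "Q * (m l * P) = m l * (P * Q)" using Qm [OF l] PQ(5) by (metis mult.assoc)
          show "m l * P * Q = m l * (P * Q)" by (simp add: mult.assoc)
          show "m l * Q * Q = 0" by (simp add: mult.assoc PQ)
          show "Q * (m l * Q) = 0" using Qm [OF l] PQ(4) by (metis mult.assoc mult_zero_right)
          show "P * (m l * P) = m l" using Pm [OF l] PQ(3) un(2) by (metis mult.assoc unital_def)
          show "m l * P * P = m l" using PQ(3) un(2) by (simp add: mult.assoc unital_def)
          have "m l * Q * (m l * P) = m l * m l * (Q * P)" using Qm [OF l] by (metis mult.assoc)
          then show "m l * Q * (m l * P) = 0" by (simp add: mm l)
          have "m l * P * (m l * Q) = m l * m l * (P * Q)" using Pm [OF l] by (metis mult.assoc)
          then show "m l * P * (m l * Q) = 0" by (simp add: mm l)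
        qed
        have "unital P'" "unital Q'" unfolding P'_def Q'_def
          by (intro unital_add unital_mult PQ un)+
        moreover have "P' * P' = opr id"
          by (simp only: P'_def distrib_left distrib_right mQ PQ(3) add_0_right add.assoc char2)
        moreover have "Q' * Q' = 0"
          by (simp only: Q'_def distrib_left distrib_right mQ PQ(4) add_0_left add_0_right char2)
        moreover have "P' * Q' = Q' * P'"
          by (simp only: P'_def Q'_def distrib_left distrib_right mQ PQ(5) add_0_left add_0_right add_ac)
        moreover have "parity_map W W' False P'"
          unfolding P'_def using parity_map_mult [OF pm [OF l] PQ(7)] PQ(6) ac by (simp add: parity_map_add)
        moreover have "parity_map W W' True Q'"
          unfolding Q'_def using parity_map_mult [OF pm [OF l] PQ(6)] PQ(7) ac by (simp add: parity_map_add)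
        moreover have "P' * m j = m j * P' \<and> Q' * m j = m j * Q'" if j: "j < a" for j
        proof -
          have "m l * Q * m j = m j * (m l * Q)" "m l * P * m j = m j * (m l * P)"
            using comm_m [OF l j] Pm [OF j] Qm [OF j] by (metis mult.assoc)+
          then show ?thesis by (simp only: P'_def Q'_def distrib_left distrib_right Pm [OF j] Qm [OF j])
        qed
        moreover have "opr (block_swap a q (Suc l)) = (if even (Suc l) then P' + u * Q' else Q' + u * P')"
        proof -
          have tp: "transpose (l + 1) (c + l + 1) permutes {1..n}"
            using pts [OF l] fin by (intro permutes_swap_id) auto
          have "opr (block_swap a q (Suc l)) = (u + m l) * opr (block_swap a q l)"
            unfolding block_swap.simps c_def [symmetric]
            using opr_comp [OF tp, of "block_swap a q l"] block_swap_permutes [OF q, of l a] l n tau [OF l] by simp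
          moreover have "(u + m l) * (P + u * Q) = Q' + u * P'"
          proof -
            have "(u + m l) * (P + u * Q) = u * P + u * u * Q + m l * P + m l * u * Q"
              by (simp only: distrib_left distrib_right mult.assoc add_ac)
            also have "u * u * Q = Q" using uu PQ(2) by (simp add: unital_def)
            also have "m l * u * Q = u * (m l * Q)" by (simp only: um [OF l, symmetric] mult.assoc)
            finally show ?thesis by (simp only: P'_def Q'_def distrib_left add_ac)
          qed
          moreover have "(u + m l) * (Q + u * P) = P' + u * Q'"
          proof -
            have "(u + m l) * (Q + u * P) = u * Q + u * u * P + m l * Q + m l * u * P"
              by (simp only: distrib_left distrib_right mult.assoc add_ac)
            also have "u * u * P = P" using uu PQ(1) by (simp add: unital_def)
            also have "m l * u * P = u * (m l * P)" by (simp only: um [OF l, symmetric] mult.assoc)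
            finally show ?thesis by (simp only: P'_def Q'_def distrib_left add_ac)
          qed
          ultimately show ?thesis using R by simp
        qed
        ultimately show ?case by blast
      qed
      from this [of a] obtain P Q where PQ: "P * P = opr id" "parity_map W W' False P" "parity_map W W' True Q"
        and R: "opr (block_swap a q a) = Q + u * P" using a by auto
      have "parity_map W W' True (opr (block_swap a q a))"
        using par [OF block_swap_wreath [OF q0 q]] block_swap_even [OF q0 q order_refl] a by simp
      then have "parity_map W W' True ((opr (block_swap a q a) + Q) * P)"
        using parity_map_mult [OF parity_map_add [OF ac _ PQ(3)] PQ(2)] by simp
      moreover have "(opr (block_swap a q a) + Q) * P = u"
      proof -
        have "opr (block_swap a q a) + Q = u * P" unfolding R by (simp add: char2_simps)
        then have "(opr (block_swap a q a) + Q) * P = u * (P * P)" by (simp only: mult.assoc)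
        also have "\<dots> = u" using PQ(1) un(1) by (simp only: unital_def)
        finally show ?thesis .
      qed
      ultimately have "parity_map W W' True u" by simp
      then have "parity_map W W' True (u + m 0)" using pm [of 0] a ac by (simp add: parity_map_add)
      moreover have "u + m 0 = gen (c + 1) + gen 1"
      proof -
        have "gen 1 + gen (c + 1) = opr (transpose (0 + 1) (c + 0 + 1))"
          using pts [of 0] fin a gen_add [of 1 "c + 1"] by auto
        also have "\<dots> = u + m 0" using tau [of 0] a by simp
        finally show ?thesis by (simp add: add.commute)
      qed
      moreover have "parity_map W W' True (gen i + gen (c + 1))"
        using iq a q by (intro same [of _ q]) (auto simp: Y [symmetric])
      ultimately have "parity_map W W' True ((gen i + gen (c + 1)) + (gen (c + 1) + gen 1))"
        using ac parity_map_add by metis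
      then show ?thesis by (simp add: char2_simps)
    qed
  qed
qed

text \<open>
  For two blocks of size congruent to two modulo four the Young subgroup inside the wreath product
  already acts irreducibly.
\<close>
lemma wreath_irreducible:
  assumes n2: "n mod 4 \<noteq> 2" and n: "n = a * b" and ab: "a > 1" "b > 1"
    and cond: "odd a \<or> a mod 4 = 2 \<and> b = 2"
  shows "irreducible_module s (alt_wreath a b) \<rho> E"
proof (cases "odd a")
  case True
  then show ?thesis using wreath_irreducible_odd n ab by blast
next
  case False
  then have a: "a mod 4 = 2" and b: "b = 2" using cond by auto
  have na: "n - a = a" "a < n" "n = a * 2" using n b ab by auto
  have irr: "irreducible_module s (alt_young a a) \<rho> E"
    using young_irreducible_even [OF n2 a na(2)] na(1) by simp
  have "alt_young a a \<subseteq> alt_wreath a 2"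
  proof
    fix g assume "g \<in> alt_young a a"
    then have g: "g permutes {1..a + a}" "g ` {a + 1..a + a} = {a + 1..a + a}" "evenperm g"
      by (auto simp: alt_young_def young_subgroup_iff alt_group_carrier)
    have "{1..a} = {1..a + a} - {a + 1..a + a}" by auto
    then have g0: "g ` {1..a} = {1..a}"
      using g permutes_image [OF g(1)] by (simp only: image_set_diff [OF permutes_inj [OF g(1)]])
    have "g \<in> wreath_subgroup a 2"
    proof (rule wreath_subgroupI)
      show "g permutes {1..a * 2}" using g(1) by (simp add: mult_2_right)
      fix i :: nat assume "i < 2"
      then have "i = 0 \<or> i = 1" by auto
      then have "g ` std_block a i = std_block a i" using g(2) g0 by (auto simp: std_block_def)
      then show "g ` std_block a i \<in> standard_blocks a 2" using \<open>i < 2\<close> by (simp add: standard_blocks_eq)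
    qed
    then show "g \<in> alt_wreath a 2" using g by (simp add: alt_wreath_eq)
  qed
  moreover have "alt_wreath a 2 \<subseteq> {p. p permutes {1..n} \<and> evenperm p}"
    unfolding na(3) by (auto simp: alt_wreath_eq dest: wreath_closed(1))
  ultimately show ?thesis using irreducible_mono [OF irr] b by blast
qed

end

section \<open>Intransitive and imprimitive groups\<close>

text \<open>
  Two labellings of a finite set with equally many points of every label differ by a permutation.
  This provides the conjugating elements.
\<close>
lemma relabel_permutation:
  assumes fin: "finite X" and card: "\<And>i. card {p \<in> X. h p = i} = card {p \<in> X. h' p = i}"
  shows "\<exists>x. x permutes X \<and> (\<forall>p\<in>X. h' (x p) = h p)"
proof -
  have "\<exists>f. bij_betw f {p \<in> X. h p = i} {p \<in> X. h' p = i}" for i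
    using fin card by (intro finite_same_card_bij) auto
  then obtain f where f: "\<And>i. bij_betw (f i) {p \<in> X. h p = i} {p \<in> X. h' p = i}" by metis
  define x where "x p = (if p \<in> X then f (h p) p else p)" for p
  have x: "x p \<in> X \<and> h' (x p) = h p" if "p \<in> X" for p
    using bij_betwE [OF f [of "h p"]] that by (auto simp: x_def)
  have "inj_on x X"
  proof (rule inj_onI)
    fix p q assume pq: "p \<in> X" "q \<in> X" "x p = x q"
    then have h: "h p = h q" using x by metis
    have "f (h p) p = f (h p) q" using pq h by (simp add: x_def)
    then show "p = q" using bij_betw_imp_inj_on [OF f [of "h p"]] pq h by (auto dest: inj_onD)
  qed
  moreover have "x ` X \<subseteq> X" using x by auto
  ultimately have "bij_betw x X X" using fin by (simp add: bij_betw_def endo_inj_surj)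
  then have "x permutes X" by (rule bij_imp_permutes) (simp add: x_def)
  then show ?thesis using x by blast
qed

lemma subconjugateI:
  assumes G: "G \<subseteq> carrier (alt_group n)" and x: "x permutes {1..n}"
    and conj: "\<And>g. g \<in> G \<Longrightarrow> x \<circ> g \<circ> inv' x permutes {1..n} \<Longrightarrow> evenperm (x \<circ> g \<circ> inv' x) \<Longrightarrow>
      x \<circ> g \<circ> inv' x \<in> H"
  shows "subconjugate n G H"
  unfolding subconjugate_def
proof (intro bexI image_subsetI)
  show "x \<in> carrier (sym_group n)" using x by (simp add: sym_group_carrier)
  fix g assume g: "g \<in> G"
  then have gp: "g permutes {1..n}" "evenperm g" using G by (auto simp: alt_group_carrier)
  have ix: "inv' x permutes {1..n}" by (rule permutes_inv [OF x])
  have perm: "permutation x" "permutation g" "permutation (inv' x)"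
    using x gp ix permutation_permutes finite_atLeastAtMost by blast+
  have "x \<circ> g \<circ> inv' x permutes {1..n}" by (rule permutes_compose [OF ix permutes_compose [OF gp(1) x]])
  moreover have "evenperm (x \<circ> g \<circ> inv' x)"
    using gp perm evenperm_inv [OF perm(1)] by (simp add: evenperm_comp permutation_compose)
  ultimately show "x \<circ> g \<circ> inv' x \<in> H" using conj g by blast
qed

lemma young_subconjugate:
  assumes G: "G \<subseteq> carrier (alt_group n)" and S: "S \<subseteq> {1..n}" "card S = k" and k: "k < n"
    and stable: "\<And>g. g \<in> G \<Longrightarrow> g ` S = S"
  shows "subconjugate n G (alt_young (n - k) k)"
proof -
  let ?Y = "{n - k + 1..n}"
  have fS: "finite S" using S finite_subset by blast
  have "card {p \<in> {1..n}. (p \<in> S) = i} = card {p \<in> {1..n}. (p \<in> ?Y) = i}" for i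
  proof (cases i)
    case True
    have "{p \<in> {1..n}. (p \<in> S) = i} = S" "{p \<in> {1..n}. (p \<in> ?Y) = i} = ?Y"
      using S True by auto
    then show ?thesis using S k by simp
  next
    case False
    have "{p \<in> {1..n}. (p \<in> S) = i} = {1..n} - S" "{p \<in> {1..n}. (p \<in> ?Y) = i} = {1..n - k}"
      using S False k by auto
    then show ?thesis using S k fS by (simp add: card_Diff_subset)
  qed
  then obtain x where x: "x permutes {1..n}" "\<And>p. p \<in> {1..n} \<Longrightarrow> (x p \<in> ?Y) = (p \<in> S)"
    using relabel_permutation [of "{1..n}" "\<lambda>p. p \<in> S" "\<lambda>p. p \<in> ?Y"] by auto
  have xS: "x ` S = ?Y"
  proof
    show "x ` S \<subseteq> ?Y" using x(2) S by blast
    show "?Y \<subseteq> x ` S"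
    proof
      fix y assume y: "y \<in> ?Y"
      then have "y \<in> x ` {1..n}" using permutes_image [OF x(1)] by auto
      then show "y \<in> x ` S" using x(2) y by blast
    qed
  qed
  show ?thesis
  proof (rule subconjugateI [OF G x(1)])
    fix g assume g: "g \<in> G" and c: "x \<circ> g \<circ> inv' x permutes {1..n}" "evenperm (x \<circ> g \<circ> inv' x)"
    have "(x \<circ> g \<circ> inv' x) ` ?Y = x ` g ` inv' x ` x ` S" by (simp only: image_comp [symmetric] xS)
    also have "inv' x ` x ` S = S" by (rule image_inv_f_f [OF permutes_inj [OF x(1)]])
    finally have "(x \<circ> g \<circ> inv' x) ` ?Y = ?Y" using stable [OF g] xS by simp
    then show "x \<circ> g \<circ> inv' x \<in> alt_young (n - k) k"
      using c k by (simp only: alt_young_def young_subgroup_iff alt_group_carrier Int_iff le_add_diff_inverse2 less_imp_le)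
  qed
qed

text \<open>A system of blocks: a partition of the points into sets of size \<open>a\<close>, permuted by the group.\<close>
definition block_system :: "nat \<Rightarrow> (nat \<Rightarrow> nat) set \<Rightarrow> nat \<Rightarrow> nat set set \<Rightarrow> bool" where
  "block_system n G a BB \<longleftrightarrow> \<Union>BB = {1..n} \<and> (\<forall>C\<in>BB. \<forall>C'\<in>BB. C \<noteq> C' \<longrightarrow> C \<inter> C' = {}) \<and>
     (\<forall>C\<in>BB. card C = a) \<and> (\<forall>g\<in>G. \<forall>C\<in>BB. g ` C \<in> BB)"

lemma block_systemD:
  assumes "block_system n G a BB"
  shows "\<Union>BB = {1..n}" and "\<And>C C'. C \<in> BB \<Longrightarrow> C' \<in> BB \<Longrightarrow> C \<noteq> C' \<Longrightarrow> C \<inter> C' = {}"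
    and "\<And>C. C \<in> BB \<Longrightarrow> card C = a" and "\<And>g C. g \<in> G \<Longrightarrow> C \<in> BB \<Longrightarrow> g ` C \<in> BB"
proof -
  note A = assms [unfolded block_system_def]
  show "\<Union>BB = {1..n}" by (rule conjunct1 [OF A])
  show "\<And>C C'. C \<in> BB \<Longrightarrow> C' \<in> BB \<Longrightarrow> C \<noteq> C' \<Longrightarrow> C \<inter> C' = {}"
    by (rule conjunct1 [OF conjunct2 [OF A], rule_format])
  show "\<And>C. C \<in> BB \<Longrightarrow> card C = a"
    by (rule conjunct1 [OF conjunct2 [OF conjunct2 [OF A]], rule_format])
  show "\<And>g C. g \<in> G \<Longrightarrow> C \<in> BB \<Longrightarrow> g ` C \<in> BB"
    by (rule conjunct2 [OF conjunct2 [OF conjunct2 [OF A]], rule_format])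
qed

lemma block_system_finite: "block_system n G a BB \<Longrightarrow> finite BB"
  unfolding block_system_def by (metis finite_UnionD finite_atLeastAtMost)

lemma block_system_card:
  assumes BB: "block_system n G a BB" and P: "P \<subseteq> BB"
  shows "card (\<Union>P) = a * card P"
proof -
  have "finite P" by (rule finite_subset [OF P block_system_finite [OF BB]])
  moreover have "\<Union>P \<subseteq> {1..n}" using Union_mono [OF P] by (simp only: block_systemD(1) [OF BB])
  then have "finite (\<Union>P)" using finite_subset by blast
  moreover have "card C = a" if "C \<in> P" for C
    by (rule block_systemD(3) [OF BB subsetD [OF P that]])
  moreover have "C \<inter> C' = {}" if "C \<in> P" "C' \<in> P" "C \<noteq> C'" for C C'
    by (rule block_systemD(2) [OF BB subsetD [OF P that(1)] subsetD [OF P that(2)] that(3)])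
  ultimately have "a * card P = card (\<Union>P)" by (rule card_partition)
  then show ?thesis by simp
qed

lemma wreath_subconjugate:
  assumes G: "G \<subseteq> carrier (alt_group n)" and a: "a > 0" and BB: "block_system n G a BB"
  shows "subconjugate n G (alt_wreath a (card BB))"
proof -
  let ?b = "card BB"
  have n: "n = a * ?b" using block_system_card [OF BB order_refl] BB by (simp add: block_system_def)
  obtain e where e: "bij_betw e BB {..<?b}"
    using ex_bij_betw_finite_nat [OF block_system_finite [OF BB]] by (auto simp: atLeast0LessThan)
  define blk where "blk p = (THE C. C \<in> BB \<and> p \<in> C)" for p
  have disj: "C = C'" if "C \<in> BB" "C' \<in> BB" "p \<in> C" "p \<in> C'" for C C' p
    using BB that by (auto simp: block_system_def)
  have blk: "blk p = C" if "C \<in> BB" "p \<in> C" for C p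
    unfolding blk_def using that disj by (intro the_equality) auto
  have cover: "\<exists>C\<in>BB. p \<in> C" if "p \<in> {1..n}" for p
    using BB that unfolding block_system_def by blast
  have subC: "C \<subseteq> {1..n}" if "C \<in> BB" for C using BB that unfolding block_system_def by blast
  have "card {p \<in> {1..n}. e (blk p) = i} = card {p \<in> {1..n}. (p - 1) div a = i}" for i
  proof (cases "i < ?b")
    case True
    then obtain C where C: "C \<in> BB" "e C = i" using e by (metis bij_betw_imp_surj_on imageE lessThan_iff)
    have "{p \<in> {1..n}. e (blk p) = i} = C"
    proof (rule equalityI; rule subsetI)
      fix p assume p: "p \<in> {p \<in> {1..n}. e (blk p) = i}"
      then obtain C' where C': "C' \<in> BB" "p \<in> C'" using cover by blast
      then have "e C' = e C" using p C blk by auto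
      then show "p \<in> C" using C C' bij_betw_imp_inj_on [OF e] by (auto dest: inj_onD)
    next
      fix p assume "p \<in> C"
      then show "p \<in> {p \<in> {1..n}. e (blk p) = i}" using C(2) blk [OF C(1)] subC [OF C(1)] by auto
    qed
    moreover have "{p \<in> {1..n}. (p - 1) div a = i} = std_block a i"
    proof (rule equalityI; rule subsetI)
      fix p assume "p \<in> {p \<in> {1..n}. (p - 1) div a = i}"
      then show "p \<in> std_block a i" using mem_std_block [OF a] by simp
    next
      fix p assume p: "p \<in> std_block a i"
      have "p \<in> {1..n}" using subsetD [OF std_block_subset [OF True] p] by (simp only: n [symmetric])
      moreover have "(p - 1) div a = i" using p mem_std_block [OF a] by simp
      ultimately show "p \<in> {p \<in> {1..n}. (p - 1) div a = i}" by blast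
    qed
    moreover have "card (std_block a i) = a" by (simp add: std_block_def)
    ultimately show ?thesis using C BB by (simp add: block_system_def)
  next
    case False
    have "e (blk p) \<noteq> i" if p: "p \<in> {1..n}" for p
    proof -
      obtain C where C: "C \<in> BB" "p \<in> C" using cover [OF p] by blast
      then show ?thesis using blk [OF C] bij_betwE [OF e] False by auto
    qed
    moreover have "(p - 1) div a \<noteq> i" if "p \<in> {1..n}" for p
      using std_block_cover [OF a, of p ?b, folded n, OF that] False by simp
    ultimately have "{p \<in> {1..n}. e (blk p) = i} = {}" "{p \<in> {1..n}. (p - 1) div a = i} = {}" by blast+
    then show ?thesis by (simp only:)
  qed
  then obtain x where x: "x permutes {1..n}" "\<And>p. p \<in> {1..n} \<Longrightarrow> (x p - 1) div a = e (blk p)"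
    using relabel_permutation [of "{1..n}" "\<lambda>p. e (blk p)" "\<lambda>p. (p - 1) div a"] by auto
  have xC: "x ` C = std_block a (e C)" if C: "C \<in> BB" for C
  proof (rule card_subset_eq)
    show "finite (std_block a (e C))" by (simp add: std_block_def)
    show "x ` C \<subseteq> std_block a (e C)"
    proof (rule image_subsetI)
      fix p assume p: "p \<in> C"
      have "x p \<in> {1..n}" using subC [OF C] p permutes_in_image [OF x(1)] by blast
      then show "x p \<in> std_block a (e C)" using x(2) [of p] blk [OF C p] subC [OF C] p a
        by (auto simp: mem_std_block)
    qed
    show "card (x ` C) = card (std_block a (e C))"
      using BB C card_image [OF inj_on_subset [OF permutes_inj [OF x(1)]], of C]
      by (simp add: std_block_def block_system_def)
  qed
  show ?thesis
  proof (rule subconjugateI [OF G x(1)])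
    fix g assume g: "g \<in> G" and c: "x \<circ> g \<circ> inv' x permutes {1..n}" "evenperm (x \<circ> g \<circ> inv' x)"
    have "x \<circ> g \<circ> inv' x \<in> wreath_subgroup a ?b"
    proof (rule wreath_subgroupI)
      show "x \<circ> g \<circ> inv' x permutes {1..a * ?b}" using c n by simp
      fix i assume "i < ?b"
      then obtain C where C: "C \<in> BB" "e C = i" using e by (metis bij_betw_imp_surj_on imageE lessThan_iff)
      have gC: "g ` C \<in> BB" using BB g C by (simp add: block_system_def)
      have "(x \<circ> g \<circ> inv' x) ` std_block a i = x ` g ` inv' x ` x ` C"
        by (simp only: image_comp [symmetric] xC [OF C(1)] C(2))
      also have "inv' x ` x ` C = C" by (rule image_inv_f_f [OF permutes_inj [OF x(1)]])
      also have "x ` g ` C = std_block a (e (g ` C))" by (rule xC [OF gC])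
      finally show "(x \<circ> g \<circ> inv' x) ` std_block a i \<in> standard_blocks a ?b"
        using bij_betwE [OF e] gC by (auto simp: standard_blocks_eq)
    qed
    then show "x \<circ> g \<circ> inv' x \<in> alt_wreath a ?b" using c by (simp add: alt_wreath_eq)
  qed
qed

lemma alt_subgroup:
  assumes "subgroup G (alt_group n)"
  shows "G \<subseteq> carrier (alt_group n)" "id \<in> G" "\<And>g h. g \<in> G \<Longrightarrow> h \<in> G \<Longrightarrow> g \<circ> h \<in> G"
    "\<And>g. g \<in> G \<Longrightarrow> inv' g \<in> G" "\<And>g. g \<in> G \<Longrightarrow> g permutes {1..n}"
proof -
  show sub: "G \<subseteq> carrier (alt_group n)" by (rule subgroup.subset [OF assms])
  show "id \<in> G" using subgroup.one_closed [OF assms] by (simp add: alt_group_one)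
  show "g \<circ> h \<in> G" if "g \<in> G" "h \<in> G" for g h
    using subgroup.m_closed [OF assms that] by (simp add: alt_group_mult)
  show "inv' g \<in> G" if "g \<in> G" for g
    using subgroup.m_inv_closed [OF assms that] alt_group_inv_equality [of g n] that sub by auto
  show "g permutes {1..n}" if "g \<in> G" for g using sub that by (auto simp: alt_group_carrier)
qed

lemma block_system_of_block:
  assumes G: "subgroup G (alt_group n)" and tr: "transitive_on G {1..n}" and B: "is_block G {1..n} B"
  shows "block_system n G (card B) ((\<lambda>g. g ` B) ` G)"
proof -
  note sub = alt_subgroup [OF G]
  have Bs: "B \<subseteq> {1..n}" "B \<noteq> {}" "\<And>g. g \<in> G \<Longrightarrow> g ` B = B \<or> g ` B \<inter> B = {}"
    using B by (auto simp: is_block_def)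
  have cover: "\<Union>((\<lambda>g. g ` B) ` G) = {1..n}"
  proof
    show "\<Union>((\<lambda>g. g ` B) ` G) \<subseteq> {1..n}"
    proof (rule Union_least, elim imageE)
      fix C g assume g: "g \<in> G" and C: "C = g ` B"
      show "C \<subseteq> {1..n}" unfolding C
      proof (rule image_subsetI)
        fix p assume "p \<in> B"
        then show "g p \<in> {1..n}" using Bs(1) permutes_in_image [OF sub(5) [OF g]] by (metis subsetD)
      qed
    qed
    obtain b where b: "b \<in> B" using Bs by auto
    show "{1..n} \<subseteq> \<Union>((\<lambda>g. g ` B) ` G)"
    proof
      fix y assume "y \<in> {1..n}"
      then obtain g where "g \<in> G" "g b = y" using tr b Bs(1) unfolding transitive_on_def by blast
      then show "y \<in> \<Union>((\<lambda>g. g ` B) ` G)" using b by blast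
    qed
  qed
  have eq: "g ` B = h ` B" if gh: "g \<in> G" "h \<in> G" "g ` B \<inter> h ` B \<noteq> {}" for g h
  proof -
    have ih: "inv' h \<circ> g \<in> G" by (rule sub(3) [OF sub(4) [OF gh(2)] gh(1)])
    have invol: "inv' h (h p) = p" "h (inv' h p) = p" for p
      using permutes_inverses [OF sub(5) [OF gh(2)]] by auto
    obtain p q where "p \<in> B" "q \<in> B" "g p = h q" using gh(3) by blast
    then have "(inv' h \<circ> g) p \<in> B" using invol(1) [of q] by simp
    then have "(inv' h \<circ> g) ` B \<inter> B \<noteq> {}" using \<open>p \<in> B\<close> by blast
    then have "(inv' h \<circ> g) ` B = B" using Bs(3) [OF ih] by metis
    then have "h ` inv' h ` g ` B = h ` B" by (simp only: image_comp [symmetric])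
    then show ?thesis by (simp add: image_image invol)
  qed
  have card: "card (g ` B) = card B" if "g \<in> G" for g
    using permutes_inj [OF sub(5) [OF that]] by (intro card_image) (rule inj_on_subset [OF _ subset_UNIV])
  have img: "g ` h ` B \<in> (\<lambda>g. g ` B) ` G" if "g \<in> G" "h \<in> G" for g h
    using sub(3) [OF that] by (intro image_eqI [of _ _ "g \<circ> h"]) (simp_all only: image_comp [symmetric])
  show ?thesis unfolding block_system_def
  proof (intro conjI ballI impI)
    show "\<Union>((\<lambda>g. g ` B) ` G) = {1..n}" by (rule cover)
    show "card C = card B" if "C \<in> (\<lambda>g. g ` B) ` G" for C using that card by (elim imageE) simp
    show "g ` C \<in> (\<lambda>g. g ` B) ` G" if "g \<in> G" "C \<in> (\<lambda>g. g ` B) ` G" for g C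
      using that(2) img [OF that(1)] by (elim imageE) (simp only:)
    fix C C' assume "C \<in> (\<lambda>g. g ` B) ` G" "C' \<in> (\<lambda>g. g ` B) ` G" and ne: "C \<noteq> C'"
    then obtain g h where gh: "g \<in> G" "h \<in> G" "C = g ` B" "C' = h ` B" by (elim imageE)
    show "C \<inter> C' = {}"
    proof (rule ccontr)
      assume "C \<inter> C' \<noteq> {}"
      then show False using eq [OF gh(1,2)] ne gh(3,4) by simp
    qed
  qed
qed

context half_spin
begin

lemma reducible_stable_set:
  assumes G: "G \<subseteq> carrier (alt_group n)" and S: "S \<subseteq> {1..n}" "S \<noteq> {}" "S \<noteq> {1..n}" "4 dvd card S"
    and stable: "\<And>g. g \<in> G \<Longrightarrow> g ` S = S"
  shows "\<not> irreducible_module s G \<rho> E"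
proof -
  have fS: "finite S" using S finite_subset by blast
  obtain a where a: "a \<in> S" using S by auto
  have "card S \<noteq> 1" using S by auto
  then obtain b where b: "b \<in> S" "b \<noteq> a" using a by (metis is_singletonI' is_singleton_altdef empty_iff)
  have ab: "a \<in> {1..n}" "b \<in> {1..n}" "a \<noteq> b" using a b S by auto
  have t: "transpose a b ` S = S" using a b by (intro transpose_image_eq) simp
  have G': "G \<subseteq> {p. p permutes {1..n} \<and> evenperm p}" using G by (auto simp: alt_group_carrier)
  have "even (card S)" using S by (auto elim: dvd_trans [rotated])
  then show ?thesis
    using S t stable by (intro reducible_restrictI [OF G' _ _ ab, of "{S}"]) auto
qed

text \<open>
  The family consists of the unions of \<open>c\<close> blocks; their intersections are unions of blocks and
  have even size because the blocks do.
\<close>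
lemma reducible_block_system:
  assumes G: "G \<subseteq> carrier (alt_group n)" and BB: "block_system n G a BB"
    and a: "even a" "a > 0" and c: "4 dvd a * c" "0 < c" "c < card BB"
  shows "\<not> irreducible_module s G \<rho> E"
proof -
  have fin: "finite BB" by (rule block_system_finite [OF BB])
  define F where "F = {\<Union>P |P. P \<subseteq> BB \<and> card P = c}"
  have n: "n = a * card BB" using block_system_card [OF BB order_refl] BB by (simp add: block_system_def)
  obtain B where B: "B \<in> BB" using c fin by (metis card.empty ex_in_conv not_less_zero)
  have cB: "card B = a" "B \<subseteq> {1..n}" using block_systemD(1,3) [OF BB] B by blast+
  have "card B \<noteq> 1" "B \<noteq> {}" using cB a by auto
  then obtain p q where pq: "p \<in> B" "q \<in> B" "p \<noteq> q" by (metis is_singletonI' is_singleton_altdef)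
  have pqn: "p \<in> {1..n}" "q \<in> {1..n}" using pq cB by auto
  have disj: "C = C'" if "C \<in> BB" "C' \<in> BB" "p \<in> C" "p \<in> C'" for C C' p
    using BB that by (auto simp: block_system_def)
  have G': "G \<subseteq> {p. p permutes {1..n} \<and> evenperm p}" using G by (auto simp: alt_group_carrier)
  have finF: "finite F"
    by (rule finite_subset [of _ "Union ` Pow BB"]) (use fin in \<open>auto simp: F_def\<close>)
  obtain P0 where "P0 \<subseteq> BB" "card P0 = c" using c obtain_subset_with_card_n less_imp_le by metis
  then have "F \<noteq> {}" by (auto simp: F_def)
  then show ?thesis
  proof (rule reducible_restrictI [OF G' finF _ pqn pq(3)])
    fix S assume "S \<in> F"
    then obtain P where P: "P \<subseteq> BB" "card P = c" "S = \<Union>P" by (auto simp: F_def)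
    have cS: "card S = a * c" using block_system_card [OF BB P(1)] P by simp
    have "S \<subseteq> {1..n}" using Union_mono [OF P(1)] by (simp only: block_systemD(1) [OF BB] P(3))
    moreover have "S \<noteq> {}" using cS a c by auto
    moreover have "S \<noteq> {1..n}" using cS n a c by auto
    ultimately show "S \<subseteq> {1..n} \<and> 4 dvd card S \<and> S \<noteq> {} \<and> S \<noteq> {1..n}" using cS c by simp
    show "transpose p q ` S \<in> F"
    proof -
      have "y \<in> S \<longleftrightarrow> B \<in> P" if y: "y \<in> B" for y
      proof
        assume "y \<in> S"
        then obtain C where C: "C \<in> P" "y \<in> C" using P(3) by blast
        have "C = B" by (rule disj [OF subsetD [OF P(1) C(1)] B C(2) y])
        then show "B \<in> P" using C by simp
      qed (use P(3) y in blast)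
      then have "transpose p q ` S = S" using pq by (intro transpose_image_eq) simp
      then show ?thesis using \<open>S \<in> F\<close> by simp
    qed
    fix T assume "T \<in> F"
    then obtain Q where Q: "Q \<subseteq> BB" "card Q = c" "T = \<Union>Q" by (auto simp: F_def)
    have "S \<inter> T = \<Union>(P \<inter> Q)"
    proof
      show "S \<inter> T \<subseteq> \<Union>(P \<inter> Q)"
      proof
        fix y assume "y \<in> S \<inter> T"
        then obtain C C' where C: "C \<in> P" "C' \<in> Q" "y \<in> C" "y \<in> C'" using P Q by blast
        then have "C = C'" using disj [OF subsetD [OF P(1)] subsetD [OF Q(1)]] by metis
        then show "y \<in> \<Union>(P \<inter> Q)" using C by blast
      qed
    qed (use P Q in blast)
    moreover have "card (\<Union>(P \<inter> Q)) = a * card (P \<inter> Q)"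
      using P by (intro block_system_card [OF BB]) blast
    ultimately show "even (card (S \<inter> T))" using a by simp
  next
    fix g S assume g: "g \<in> G" and "S \<in> F"
    then obtain P where P: "P \<subseteq> BB" "card P = c" "S = \<Union>P" by (auto simp: F_def)
    have gp: "g permutes {1..n}" using G' g by blast
    have "inj_on ((`) g) P" using permutes_inj [OF gp] by (simp add: inj_on_def inj_image_eq_iff)
    then have "card ((`) g ` P) = c" using P by (simp add: card_image)
    moreover have "(`) g ` P \<subseteq> BB" using block_systemD(4) [OF BB g] P(1) by blast
    moreover have "g ` S = \<Union>((`) g ` P)" using P by blast
    ultimately show "g ` S \<in> F" unfolding F_def by blast
  qed
qed

lemma irreducible_subgroup_cases:
  assumes n2: "n mod 4 \<noteq> 2" and G: "subgroup G (alt_group n)" and irr: "irreducible_module s G \<rho> E"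
  shows "primitive_on G {1..n} \<or>
    (\<exists>k. 1 \<le> k \<and> k < n \<and> (n mod 4 = 0 \<and> odd k \<or> k mod 4 = 2) \<and> subconjugate n G (alt_young (n - k) k)) \<or>
    (\<exists>a b. a > 1 \<and> b > 1 \<and> n = a * b \<and> (odd a \<or> a mod 4 = 2 \<and> b = 2) \<and> subconjugate n G (alt_wreath a b))"
proof -
  note sub = alt_subgroup [OF G]
  have intransitive: ?thesis if nt: "\<not> transitive_on G {1..n}"
  proof -
    obtain x y where xy: "x \<in> {1..n}" "y \<in> {1..n}" "\<And>g. g \<in> G \<Longrightarrow> g x \<noteq> y"
      using nt by (auto simp: transitive_on_def)
    define S where "S = (\<lambda>g. g x) ` G"
    have S: "S \<subseteq> {1..n}" unfolding S_def
    proof (rule image_subsetI)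
      fix g assume "g \<in> G"
      then show "g x \<in> {1..n}" using permutes_in_image [OF sub(5)] xy(1) by blast
    qed
    have fS: "finite S" using S finite_subset by blast
    have xS: "x \<in> S" unfolding S_def using sub(2) by (intro image_eqI [of _ _ id]) auto
    have yS: "y \<notin> S" using xy(3) by (auto simp: S_def)
    have stable: "g ` S = S" if g: "g \<in> G" for g
    proof -
      have "g ` S \<subseteq> S"
      proof (clarsimp simp: S_def)
        fix h assume "h \<in> G"
        then show "g (h x) \<in> (\<lambda>g. g x) ` G"
          using sub(3) [OF g] by (intro image_eqI [of _ _ "g \<circ> h"]) auto
      qed
      moreover have "inj_on g S" using permutes_inj [OF sub(5) [OF g]] by (rule inj_on_subset) simp
      ultimately show ?thesis using fS by (intro endo_inj_surj)
    qed
    have stable': "g ` ({1..n} - S) = {1..n} - S" if g: "g \<in> G" for g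
      using stable [OF g] permutes_image [OF sub(5) [OF g]]
      by (simp only: image_set_diff [OF permutes_inj [OF sub(5) [OF g]]])
    define k where "k = card S"
    have ss: "S \<subset> {1..n}" using S xy(2) yS by blast
    have "k \<noteq> 0" using xS fS by (auto simp: k_def)
    moreover have "k < n" using psubset_card_mono [OF _ ss] by (simp add: k_def)
    ultimately have k: "1 \<le> k" "k < n" by linarith+
    have ck: "card ({1..n} - S) = n - k" using S fS by (simp add: card_Diff_subset k_def)
    have no: "\<not> 4 dvd k" "\<not> 4 dvd n - k"
    proof -
      show "\<not> 4 dvd k" using reducible_stable_set [OF sub(1) S _ _ _ stable] irr xS xy(2) yS unfolding k_def by blast
      show "\<not> 4 dvd n - k"
      proof
        assume d: "4 dvd n - k"
        have ne: "{1..n} - S \<noteq> {}" "{1..n} - S \<noteq> {1..n}" using xS xy(1,2) yS by blast+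
        have d': "4 dvd card ({1..n} - S)" using d ck by simp
        show False
          using reducible_stable_set [OF sub(1) Diff_subset ne d' stable'] irr by (rule notE)
      qed
    qed
    \<comment> \<open>Either the orbit or its complement plays the role of the second part.\<close>
    have "(n mod 4 = 0 \<and> odd k \<or> k mod 4 = 2) \<or> (n - k) mod 4 = 2"
    proof -
      have mod4: "m mod 4 = 2 \<or> odd m" if "\<not> 4 dvd m" for m :: nat using that by presburger
      have "k mod 4 = 2 \<or> odd k" by (rule mod4 [OF no(1)])
      moreover have "(n - k) mod 4 = 2 \<or> odd (n - k)" by (rule mod4 [OF no(2)])
      moreover have "n mod 4 = 0" if "odd k" "odd (n - k)"
      proof -
        have "even n" using that k by simp
        then show ?thesis using n2 by presburger
      qed
      ultimately show ?thesis by blast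
    qed
    then show ?thesis
    proof
      assume c: "n mod 4 = 0 \<and> odd k \<or> k mod 4 = 2"
      have "subconjugate n G (alt_young (n - k) k)"
        by (rule young_subconjugate [OF sub(1) S k_def [symmetric] k(2) stable])
      with c k show ?thesis by (intro disjI2 [OF disjI1] exI [of _ k] conjI)
    next
      assume c: "(n - k) mod 4 = 2"
      have k': "1 \<le> n - k" "n - k < n" using k by auto
      have "subconjugate n G (alt_young (n - (n - k)) (n - k))"
        by (rule young_subconjugate [OF sub(1) Diff_subset ck k'(2) stable'])
      with c k' show ?thesis by (intro disjI2 [OF disjI1] exI [of _ "n - k"] conjI disjI2 [of "(n - k) mod 4 = 2"])
    qed
  qed
  have imprimitive: ?thesis if tr: "transitive_on G {1..n}" and np: "\<not> primitive_on G {1..n}"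
  proof -
    obtain B where B: "is_block G {1..n} B" "card B \<noteq> 1" "B \<noteq> {1..n}"
      using np tr by (auto simp: primitive_on_def)
    define BB where "BB = (\<lambda>g. g ` B) ` G"
    define a b where "a = card B" and "b = card BB"
    have BB: "block_system n G a BB"
      unfolding BB_def a_def by (rule block_system_of_block [OF G tr B(1)])
    have Bs: "B \<subseteq> {1..n}" "B \<noteq> {}" using B by (auto simp: is_block_def)
    have "finite B" using Bs finite_subset by blast
    then have "a > 0" using Bs by (simp add: a_def card_gt_0_iff)
    then have a: "a > 1" using B(2) by (simp add: a_def)
    have n: "n = a * b" using block_system_card [OF BB order_refl] BB by (simp add: block_system_def b_def)
    have "a < n"
    proof -
      have "B \<subset> {1..n}" using Bs B(3) by blast
      then show ?thesis using psubset_card_mono [of "{1..n}" B] by (simp add: a_def)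
    qed
    then have b: "b > 1" using n by (cases "b = 0 \<or> b = 1") auto
    have wr: "subconjugate n G (alt_wreath a b)"
      unfolding b_def by (rule wreath_subconjugate [OF sub(1) \<open>a > 0\<close> BB])
    have "odd a \<or> a mod 4 = 2 \<and> b = 2"
    proof (rule ccontr)
      assume cond: "\<not> (odd a \<or> a mod 4 = 2 \<and> b = 2)"
      show False
      proof (cases "4 dvd a")
        case True
        then show False
          using reducible_block_system [OF sub(1) BB _ \<open>a > 0\<close>, of 1] cond b irr by (simp add: b_def)
      next
        case False
        moreover have "m mod 4 = 2 \<or> odd m" if "\<not> 4 dvd m" for m :: nat using that by presburger
        ultimately have a4: "a mod 4 = 2" "b \<noteq> 2" using cond by blast+
        define a' where "a' = a div 4"
        have a': "a = 4 * a' + 2" using a4(1) mult_div_mod_eq [of 4 a] by (simp add: a'_def)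
        have "even b"
        proof (rule ccontr)
          assume "odd b"
          then obtain b' where "b = 2 * b' + 1" by (elim oddE)
          then have "n = 4 * (2 * a' * b' + a' + b') + 2" using n a' by (simp add: algebra_simps)
          moreover have "(4 * w + 2) mod 4 = 2" for w :: nat by presburger
          ultimately have "n mod 4 = 2" by (simp only:)
          then show False using n2 by (rule notE [rotated])
        qed
        have "2 < b" using b a4(2) by linarith
        moreover have "4 dvd a * 2" unfolding a' by presburger
        ultimately show False
          using reducible_block_system [OF sub(1) BB _ \<open>a > 0\<close>, of 2] cond irr by (simp add: b_def)
      qed
    qed
    with a b n wr show ?thesis by (intro disjI2 [OF disjI2] exI [of _ a] exI [of _ b] conjI)
  qed
  show ?thesis
  proof (cases "transitive_on G {1..n}")
    case True
    show ?thesis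
      by (cases "primitive_on G {1..n}") (rule disjI1, assumption, rule imprimitive [OF True])
  qed (rule intransitive)
qed

end

lemma half_spin_of_summand:
  fixes s :: "'f::alg_closed_field \<Rightarrow> 'v::ab_group_add \<Rightarrow> 'v"
  assumes char: "CHAR('f) = 2" and n: "n \<ge> 5" and E: "basic_spin_summands n s \<rho> D E\<^sub>p E\<^sub>m"
  shows "half_spin s \<rho> D n E\<^sub>p" and "half_spin s \<rho> D n E\<^sub>m"
proof -
  have carr: "carrier (alt_group n) = {p. p permutes {1..n} \<and> evenperm p}"
    by (auto simp: alt_group_carrier)
  have irr: "irreducible_module s {p. p permutes {1..n} \<and> evenperm p} \<rho> E\<^sub>p"
    "irreducible_module s {p. p permutes {1..n} \<and> evenperm p} \<rho> E\<^sub>m"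
    and D: "D = {a + b |a b. a \<in> E\<^sub>p \<and> b \<in> E\<^sub>m}" and basic: "basic_spin_module n s \<rho> D"
    using E unfolding basic_spin_summands_def internal_direct_sum_def carr by blast+
  interpret spin_module s \<rho> D n
    using char n basic by (intro spin_module_of_basic) auto
  have z: "0 \<in> E\<^sub>p" "0 \<in> E\<^sub>m"
    using irr by (auto simp: irreducible_module_def perm_module_def vs.subspace_0)
  have "E\<^sub>p \<subseteq> D" "E\<^sub>m \<subseteq> D"
    unfolding D using z by (force intro: exI [of _ 0])+
  then show "half_spin s \<rho> D n E\<^sub>p" "half_spin s \<rho> D n E\<^sub>m"
    using irr by unfold_locales auto
qed

theorem theorem4:
  fixes s :: "'f::alg_closed_field \<Rightarrow> 'v::ab_group_add \<Rightarrow> 'v"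
    and \<rho> :: "(nat \<Rightarrow> nat) \<Rightarrow> 'v \<Rightarrow> 'v"
    and D E\<^sub>p E\<^sub>m :: "'v set"
    and n :: nat
  assumes "CHAR('f) = 2"
    and "n \<ge> 5"
    and "n mod 4 \<noteq> 2"
    and "basic_spin_summands n s \<rho> D E\<^sub>p E\<^sub>m"
  shows
    "(\<forall>G. subgroup G (alt_group n) \<and>
          (irreducible_module s G \<rho> E\<^sub>p \<or> irreducible_module s G \<rho> E\<^sub>m) \<longrightarrow>
        primitive_on G {1..n} \<or>
        (\<exists>k. 1 \<le> k \<and> k < n \<and> (n mod 4 = 0 \<and> odd k \<or> k mod 4 = 2) \<and>
             subconjugate n G (alt_young (n - k) k)) \<or>
        (\<exists>a b. a > 1 \<and> b > 1 \<and> n = a * b \<and> (odd a \<or> a mod 4 = 2 \<and> b = 2) \<and>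
             subconjugate n G (alt_wreath a b)))
     \<and> (\<forall>k. 1 \<le> k \<and> k < n \<and> (n mod 4 = 0 \<and> odd k \<or> k mod 4 = 2) \<longrightarrow>
          irreducible_module s (alt_young (n - k) k) \<rho> E\<^sub>p \<and>
          irreducible_module s (alt_young (n - k) k) \<rho> E\<^sub>m)
     \<and> (\<forall>a b. a > 1 \<and> b > 1 \<and> n = a * b \<and> (odd a \<or> a mod 4 = 2 \<and> b = 2) \<longrightarrow>
          irreducible_module s (alt_wreath a b) \<rho> E\<^sub>p \<and>
          irreducible_module s (alt_wreath a b) \<rho> E\<^sub>m)"
proof -
  note half = half_spin_of_summand [OF assms(1,2,4)]
  note cases = half_spin.irreducible_subgroup_cases [OF half(1) assms(3)]
    half_spin.irreducible_subgroup_cases [OF half(2) assms(3)]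
  note young = half_spin.young_irreducible [OF half(1) assms(3)]
    half_spin.young_irreducible [OF half(2) assms(3)]
  note wreath = half_spin.wreath_irreducible [OF half(1) assms(3)]
    half_spin.wreath_irreducible [OF half(2) assms(3)]
  show ?thesis
  proof (intro conjI allI impI, goal_cases)
    case (1 G)
    then have G: "subgroup G (alt_group n)"
      and irr: "irreducible_module s G \<rho> E\<^sub>p \<or> irreducible_module s G \<rho> E\<^sub>m"
      by (rule conjunct1, rule conjunct2)
    show ?case by (rule disjE [OF irr cases(1) [OF G] cases(2) [OF G]])
  next
    case (2 k)
    then show ?case by (elim conjE) (rule young(1))
  next
    case (3 k)
    then show ?case by (elim conjE) (rule young(2))
  next
    case (4 a b)
    then show ?case by (elim conjE) (rule wreath(1))
  next
    case (5 a b)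
    then show ?case by (elim conjE) (rule wreath(2))
  qed
qed

end
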